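(* Let $\frac12<H_1<H_2<1$ with $H_2-H_1>\frac14$, and let $T>0$ be such that equation (E$_T$) below has a unique solution $h_T$ with $t\mapsto h_T(t)t^{1/2-H_1}\in L^2[0,T]$. Then: (i) $N(t)=E_0\big(X_1(t)\,\big|\,\mathcal F^X_t\big)$, $t\in[0,T]$, is a square integrable Gaussian $(\mathcal F^X_t)$-martingale under $P_0$, with $N(T)=\int_0^Th_T(t)\,dX(t)$ and $$\langle N\rangle(T)=E_0N(T)^2=\gamma_{H_1}^2\int_0^Th_T(t)\,t^{1-2H_1}\,dt;$$ (ii) the likelihood function $L_T(\theta)=E_0\big(\tfrac{dP_\theta}{dP_0}\,\big|\,\mathcal F^X_T\big)$ equals $$L_T(\theta)=\exp\Big\{\theta\kappa N(T)-\tfrac12\theta^2\kappa^2\langle N\rangle(T)\Big\},\qquad\theta\in\mathbb R;$$ (iii) the maximum likelihood estimator of $\theta$ is $$\widehat\theta_T=\frac{N(T)}{\kappa\,\langle N\rangle(T)}.$$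
   Context: Standing setup. Fix $\frac12<H_1<H_2<1$. On $(\Omega,\mathcal F,P_0)$ let $W_1,W_2$ be independent standard Wiener processes. Let $\gamma_{H_1}>0$ be the constant for which the Molchan martingale $M^{H_1}(t)=\int_0^t(t-s)^{1/2-H_1}s^{1/2-H_1}dB^{H_1}(s)$ of a fractional Brownian motion $B^{H_1}$ has the representation $\gamma_{H_1}\int_0^ts^{1/2-H_1}dW(s)$. Set $X_1(t)=\gamma_{H_1}\int_0^ts^{1/2-H_1}dW_1(s)$, $X_2(t)=\int_0^tK_{H_1,H_2}(t,s)\,dW_2(s)$ (this equals $\int_0^t(t-s)^{1/2-H_1}s^{1/2-H_1}dB^{H_2}(s)$ for the fBm $B^{H_2}(t)=\int_0^t K_{H_2}(t,s)dW_2(s)$), $X=X_1+X_2$, and $\mathcal F^X_t=\sigma\{X(s),s\le t\}$. Here for $0<s<t$ $K_{H_1,H_2}(t,s)=\beta_{H_2}s^{1/2-H_2}\int_s^t (t-u)^{1/2-H_1}u^{H_2-H_1}(u-s)^{H_2-3/2}du$ (and $0$ for $s\ge t$), $\beta_H=\big(H(2H-1)/\mathrm B(H-\frac12,2-2H)\big)^{1/2}$, $\mathrm B$ the Beta function. Let $\mathcal B_{H_1}=\mathrm B(\frac32-H_1,\frac32-H_1)$ and $\kappa=(2-2H_1)\mathcal B_{H_1}/\gamma_{H_1}^2$. For $\theta\in\mathbb R$ the measure $P_\theta$ is defined by $\frac{dP_\theta}{dP_0}=\exp\{\theta\kappa X_1(T)-\frac12\theta^2\kappa^2\frac{\gamma_{H_1}^2T^{2-2H_1}}{2-2H_1}\}$;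 under $P_\theta$ the observed process is $X(t)=\theta\mathcal B_{H_1}t^{2-2H_1}+\widetilde X_1(t)+X_2(t)$ where $\widetilde X_1$ has the $P_0$-law of $X_1$ and is independent of $X_2$ (the model with $\sigma=1$). For $h$ with $h(t)t^{1/2-H_1}\in L^2[0,T]$, $\int_0^Th\,dX:=\gamma_{H_1}\int_0^Th(t)t^{1/2-H_1}dW_1(t)+\int_0^T\big(\int_s^Th(t)\partial_tK_{H_1,H_2}(t,s)dt\big)dW_2(s)$. With $k(s,u)=\int_0^{s\wedge u}\partial_sK_{H_1,H_2}(s,v)\partial_uK_{H_1,H_2}(u,v)dv$, equation (E$_T$) is $$\gamma_{H_1}^2u^{1-2H_1}=\gamma_{H_1}^2h(u)u^{1-2H_1}+\int_0^Th(s)k(s,u)\,ds,\quad u\in(0,T].$$ *)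

theory Defs
  imports "HOL-Probability.Probability"
begin

definition wiener_process :: "'a measure \<Rightarrow> (real \<Rightarrow> 'a \<Rightarrow> real) \<Rightarrow> bool" where
  "wiener_process M W \<longleftrightarrow>
     (\<forall>t\<ge>0. W t \<in> borel_measurable M) \<and>
     (\<forall>\<omega>\<in>space M. W 0 \<omega> = 0) \<and>
     (AE \<omega> in M. continuous_on {0..} (\<lambda>t. W t \<omega>)) \<and>
     (\<forall>s t. 0 \<le> s \<and> s < t \<longrightarrow>
        distributed M lborel (\<lambda>\<omega>. W t \<omega> - W s \<omega>)
          (\<lambda>x. ennreal (normal_density 0 (sqrt (t - s)) x))) \<and>
     (\<forall>(n::nat) (\<tau>::nat \<Rightarrow> real). 0 \<le> \<tau> 0 \<and> (\<forall>i<n. \<tau> i < \<tau> (Suc i)) \<longrightarrow>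
        prob_space.indep_vars M (\<lambda>_. borel) (\<lambda>i \<omega>. W (\<tau> (Suc i)) \<omega> - W (\<tau> i) \<omega>) {..<n})"

definition indep_processes :: "'a measure \<Rightarrow> (real \<Rightarrow> 'a \<Rightarrow> real) \<Rightarrow> (real \<Rightarrow> 'a \<Rightarrow> real) \<Rightarrow> bool" where
  "indep_processes M V W \<longleftrightarrow>
     prob_space.indep_var M (Pi\<^sub>M {0..} (\<lambda>_. borel)) (\<lambda>\<omega>. \<lambda>t\<in>{0..}. V t \<omega>)
                            (Pi\<^sub>M {0..} (\<lambda>_. borel)) (\<lambda>\<omega>. \<lambda>t\<in>{0..}. W t \<omega>)"

definition step_fun :: "(nat \<Rightarrow> real) \<Rightarrow> (nat \<Rightarrow> real) \<Rightarrow> nat \<Rightarrow> real \<Rightarrow> real" where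
  "step_fun c \<tau> n = (\<lambda>s. \<Sum>i<n. c i * indicator {\<tau> i<..\<tau> (Suc i)} s)"

definition step_int :: "(real \<Rightarrow> 'a \<Rightarrow> real) \<Rightarrow> (nat \<Rightarrow> real) \<Rightarrow> (nat \<Rightarrow> real) \<Rightarrow> nat \<Rightarrow> 'a \<Rightarrow> real" where
  "step_int W c \<tau> n = (\<lambda>\<omega>. \<Sum>i<n. c i * (W (\<tau> (Suc i)) \<omega> - W (\<tau> i) \<omega>))"

definition is_wiener_int :: "'a measure \<Rightarrow> (real \<Rightarrow> 'a \<Rightarrow> real) \<Rightarrow> real \<Rightarrow> real \<Rightarrow> (real \<Rightarrow> real) \<Rightarrow> ('a \<Rightarrow> real) \<Rightarrow> bool" where
  "is_wiener_int M W a b f Y \<longleftrightarrow>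
     Y \<in> borel_measurable M \<and>
     (\<exists>(c::nat \<Rightarrow> nat \<Rightarrow> real) (\<tau>::nat \<Rightarrow> nat \<Rightarrow> real) (n::nat \<Rightarrow> nat).
        (\<forall>k. \<tau> k 0 = a \<and> \<tau> k (n k) = b \<and> (\<forall>i<n k. \<tau> k i \<le> \<tau> k (Suc i))) \<and>
        ((\<lambda>k. \<integral>\<^sup>+ s. ennreal ((f s - step_fun (c k) (\<tau> k) (n k) s)\<^sup>2) * indicator {a..b} s \<partial>lborel)
           \<longlonglongrightarrow> 0) \<and>
        ((\<lambda>k. \<integral>\<^sup>+ \<omega>. ennreal ((Y \<omega> - step_int W (c k) (\<tau> k) (n k) \<omega>)\<^sup>2) \<partial>M) \<longlonglongrightarrow> 0))"

definition wiener_int :: "'a measure \<Rightarrow> (real \<Rightarrow> 'a \<Rightarrow> real) \<Rightarrow> real \<Rightarrow> real \<Rightarrow> (real \<Rightarrow> real) \<Rightarrow> 'a \<Rightarrow> real" where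
  "wiener_int M W a b f = (SOME Y. is_wiener_int M W a b f Y)"

definition nat_filtr :: "'a measure \<Rightarrow> (real \<Rightarrow> 'a \<Rightarrow> real) \<Rightarrow> real \<Rightarrow> 'a measure" where
  "nat_filtr M X t = sigma (space M) {X s -` B \<inter> space M | s B. s \<in> {0..t} \<and> B \<in> sets borel}"

definition martingale_on :: "'a measure \<Rightarrow> (real \<Rightarrow> 'a measure) \<Rightarrow> (real \<Rightarrow> 'a \<Rightarrow> real) \<Rightarrow> real \<Rightarrow> bool" where
  "martingale_on M F N T \<longleftrightarrow>
     (\<forall>t\<in>{0..T}. N t \<in> borel_measurable (F t) \<and> N t \<in> borel_measurable M \<and> integrable M (N t) \<and>
        (\<forall>s\<in>{0..t}. AE \<omega> in M. real_cond_exp M (F s) (N t) \<omega> = N s \<omega>))"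

definition sq_int_martingale_on :: "'a measure \<Rightarrow> (real \<Rightarrow> 'a measure) \<Rightarrow> (real \<Rightarrow> 'a \<Rightarrow> real) \<Rightarrow> real \<Rightarrow> bool" where
  "sq_int_martingale_on M F N T \<longleftrightarrow>
     martingale_on M F N T \<and> (\<forall>t\<in>{0..T}. integrable M (\<lambda>\<omega>. (N t \<omega>)\<^sup>2))"

definition gaussian_rv :: "'a measure \<Rightarrow> ('a \<Rightarrow> real) \<Rightarrow> bool" where
  "gaussian_rv M Y \<longleftrightarrow> Y \<in> borel_measurable M \<and>
     ((\<exists>\<mu>. AE \<omega> in M. Y \<omega> = \<mu>) \<or>
      (\<exists>\<mu> \<sigma>. \<sigma> > 0 \<and> distributed M lborel Y (\<lambda>x. ennreal (normal_density \<mu> \<sigma> x))))"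

definition gaussian_process_on :: "'a measure \<Rightarrow> (real \<Rightarrow> 'a \<Rightarrow> real) \<Rightarrow> real set \<Rightarrow> bool" where
  "gaussian_process_on M N I \<longleftrightarrow>
     (\<forall>(n::nat) (\<tau>::nat \<Rightarrow> real) (c::nat \<Rightarrow> real). (\<forall>i<n. \<tau> i \<in> I) \<longrightarrow>
        gaussian_rv M (\<lambda>\<omega>. \<Sum>i<n. c i * N (\<tau> i) \<omega>))"

definition betaH :: "real \<Rightarrow> real" where
  "betaH H = sqrt (H * (2 * H - 1) / Beta (H - 1/2) (2 - 2 * H))"

definition gammaH :: "real \<Rightarrow> real" where
  "gammaH H = betaH H * Beta (3/2 - H) (H - 1/2)"

definition BH :: "real \<Rightarrow> real" where
  "BH H = Beta (3/2 - H) (3/2 - H)"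

definition kappaH :: "real \<Rightarrow> real" where
  "kappaH H = (2 - 2 * H) * BH H / (gammaH H)\<^sup>2"

definition K12 :: "real \<Rightarrow> real \<Rightarrow> real \<Rightarrow> real \<Rightarrow> real" where
  "K12 H1 H2 t s = (if 0 < s \<and> s < t then
      betaH H2 * s powr (1/2 - H2) *
      (LINT u:{s..t}|lborel. (t - u) powr (1/2 - H1) * u powr (H2 - H1) * (u - s) powr (H2 - 3/2))
    else 0)"

definition dK12 :: "real \<Rightarrow> real \<Rightarrow> real \<Rightarrow> real \<Rightarrow> real" where
  "dK12 H1 H2 t s = deriv (\<lambda>t'. K12 H1 H2 t' s) t"

definition kk :: "real \<Rightarrow> real \<Rightarrow> real \<Rightarrow> real \<Rightarrow> real" where
  "kk H1 H2 s u = (LINT v:{0..min s u}|lborel. dK12 H1 H2 s v * dK12 H1 H2 u v)"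

definition solves_ET :: "real \<Rightarrow> real \<Rightarrow> real \<Rightarrow> (real \<Rightarrow> real) \<Rightarrow> bool" where
  "solves_ET H1 H2 T h \<longleftrightarrow>
     set_borel_measurable lborel {0..T} h \<and>
     set_integrable lborel {0..T} (\<lambda>t. (h t * t powr (1/2 - H1))\<^sup>2) \<and>
     (\<forall>u\<in>{0<..T}. set_integrable lborel {0..T} (\<lambda>s. h s * kk H1 H2 s u) \<and>
        (gammaH H1)\<^sup>2 * u powr (1 - 2 * H1) =
          (gammaH H1)\<^sup>2 * h u * u powr (1 - 2 * H1) + (LINT s:{0..T}|lborel. h s * kk H1 H2 s u))"

definition X1 :: "'a measure \<Rightarrow> (real \<Rightarrow> 'a \<Rightarrow> real) \<Rightarrow> real \<Rightarrow> real \<Rightarrow> 'a \<Rightarrow> real" where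
  "X1 M W1 H1 t = (\<lambda>\<omega>. gammaH H1 * wiener_int M W1 0 t (\<lambda>s. s powr (1/2 - H1)) \<omega>)"

definition X2 :: "'a measure \<Rightarrow> (real \<Rightarrow> 'a \<Rightarrow> real) \<Rightarrow> real \<Rightarrow> real \<Rightarrow> real \<Rightarrow> 'a \<Rightarrow> real" where
  "X2 M W2 H1 H2 t = wiener_int M W2 0 t (\<lambda>s. K12 H1 H2 t s)"

definition Xobs :: "'a measure \<Rightarrow> (real \<Rightarrow> 'a \<Rightarrow> real) \<Rightarrow> (real \<Rightarrow> 'a \<Rightarrow> real) \<Rightarrow> real \<Rightarrow> real \<Rightarrow> real \<Rightarrow> 'a \<Rightarrow> real" where
  "Xobs M W1 W2 H1 H2 t = (\<lambda>\<omega>. X1 M W1 H1 t \<omega> + X2 M W2 H1 H2 t \<omega>)"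

definition int_dX :: "'a measure \<Rightarrow> (real \<Rightarrow> 'a \<Rightarrow> real) \<Rightarrow> (real \<Rightarrow> 'a \<Rightarrow> real) \<Rightarrow> real \<Rightarrow> real \<Rightarrow> real \<Rightarrow> (real \<Rightarrow> real) \<Rightarrow> 'a \<Rightarrow> real" where
  "int_dX M W1 W2 H1 H2 T h = (\<lambda>\<omega>.
      gammaH H1 * wiener_int M W1 0 T (\<lambda>t. h t * t powr (1/2 - H1)) \<omega> +
      wiener_int M W2 0 T (\<lambda>s. LINT t:{s..T}|lborel. h t * dK12 H1 H2 t s) \<omega>)"

definition dens :: "'a measure \<Rightarrow> (real \<Rightarrow> 'a \<Rightarrow> real) \<Rightarrow> real \<Rightarrow> real \<Rightarrow> real \<Rightarrow> 'a \<Rightarrow> real" where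
  "dens M W1 H1 T \<theta> = (\<lambda>\<omega>. exp (\<theta> * kappaH H1 * X1 M W1 H1 T \<omega>
       - 1/2 * \<theta>\<^sup>2 * (kappaH H1)\<^sup>2 * ((gammaH H1)\<^sup>2 * T powr (2 - 2 * H1) / (2 - 2 * H1))))"

definition FX :: "'a measure \<Rightarrow> (real \<Rightarrow> 'a \<Rightarrow> real) \<Rightarrow> (real \<Rightarrow> 'a \<Rightarrow> real) \<Rightarrow> real \<Rightarrow> real \<Rightarrow> real \<Rightarrow> 'a measure" where
  "FX M W1 W2 H1 H2 = nat_filtr M (Xobs M W1 W2 H1 H2)"

definition Nproc :: "'a measure \<Rightarrow> (real \<Rightarrow> 'a \<Rightarrow> real) \<Rightarrow> (real \<Rightarrow> 'a \<Rightarrow> real) \<Rightarrow> real \<Rightarrow> real \<Rightarrow> real \<Rightarrow> 'a \<Rightarrow> real" where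
  "Nproc M W1 W2 H1 H2 t = real_cond_exp M (FX M W1 W2 H1 H2 t) (X1 M W1 H1 t)"

end

theory Submission
  imports Defs
begin

text \<open>Everything lives in a Gaussian space, the \<open>L\<^sup>2\<close> closure of the linear span of the two
Wiener processes, and in such a space a variable orthogonal to all \<open>X s\<close>, \<open>s \<le> t\<close>, is independent of
the \<open>\<sigma>\<close>-algebra they generate. Hence \<open>N t\<close> is the orthogonal projection of \<open>X1 t\<close> onto the closed span of
\<open>X s\<close>, \<open>s \<le> t\<close>; since \<open>X1 t - X1 s\<close> is orthogonal to \<open>X r\<close> for \<open>r \<le> s \<le> t\<close>, the increments \<open>N t - N s\<close>
are independent of the past, and \<open>X1 T - N T\<close> is a Gaussian variable independent of the observation, which
gives the likelihood function.

Integrating the equation \<open>E\<^sub>T\<close> over \<open>(0, r]\<close> says precisely that \<open>X1 T - \<integral> h\<^sub>T dX\<close> is orthogonal to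
\<open>X r\<close>. Schur's test for the kernel \<open>\<partial>\<^sub>tK(t, s)\<close> bounds the norm of \<open>\<integral> h dX\<close> by the weighted \<open>L\<^sup>2\<close> norm of
\<open>h\<close>, so that \<open>\<integral> h\<^sub>T dX\<close>, approximated by step functions, lies in the closed span of \<open>X\<close>. It is therefore
\<open>N T\<close>.\<close>

section \<open>Square integrable functions\<close>

text \<open>Elements of \<open>L2\<close> are functions, not classes: \<open>real_cond_exp\<close>
  and \<open>wiener_int\<close> deliver mere versions, and each change of version is made explicit
  by an almost everywhere congruence.

  Let p = H2 - H1, which is below 1/2. The time derivative of the kernel has the singularity (t -
  s)^(p - 1), which is not square integrable in s, so the derivative has no Wiener integral for
  fixed t. Only the operator that sends h to its integrand against W2 is bounded. With g(t) = h(t)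
  t^(1/2 - H1) and q = H2 - 1/2 its kernel is dominated by a multiple of s^(-q) t^q (t - s)^(p - 1).
  The test function s^(-q) turns the row integral into one of a pure power and the column integral
  into a Beta integral, finite because 2 q < 1. The same bound, with absolute values inside,
  justifies the Fubini exchange behind the orthogonality relation.

  Gaussian variables are described by characteristic functions rather than densities, since limits
  of combinations may be degenerate; conditional laws then follow from orthogonality alone.\<close>

definition L2 :: "'a measure \<Rightarrow> ('a \<Rightarrow> real) set" where
  "L2 M = {f \<in> borel_measurable M. integrable M (\<lambda>x. (f x)\<^sup>2)}"

definition nrm :: "'a measure \<Rightarrow> ('a \<Rightarrow> real) \<Rightarrow> real" where
  "nrm M f = sqrt (\<integral>x. (f x)\<^sup>2 \<partial>M)"

lemma L2_meas [measurable_dest]: "f \<in> L2 M \<Longrightarrow> f \<in> borel_measurable M"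
  by (simp add: L2_def)

lemma L2_sq_integrable: "f \<in> L2 M \<Longrightarrow> integrable M (\<lambda>x. (f x)\<^sup>2)"
  by (simp add: L2_def)

lemma L2_mult_integrable:
  assumes "f \<in> L2 M" "g \<in> L2 M"
  shows "integrable M (\<lambda>x. f x * g x)"
proof (rule Bochner_Integration.integrable_bound)
  show "integrable M (\<lambda>x. (f x)\<^sup>2 + (g x)\<^sup>2)"
    using assms by (simp add: L2_sq_integrable)
  show "(\<lambda>x. f x * g x) \<in> borel_measurable M"
    using assms[THEN L2_meas] by simp
  have "\<bar>f x * g x\<bar> \<le> (f x)\<^sup>2 + (g x)\<^sup>2" for x
    using sum_squares_bound[of "\<bar>f x\<bar>" "\<bar>g x\<bar>"] mult_nonneg_nonneg[of "\<bar>f x\<bar>" "\<bar>g x\<bar>"]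
    unfolding abs_mult power2_abs by linarith
  then show "AE x in M. norm (f x * g x) \<le> norm ((f x)\<^sup>2 + (g x)\<^sup>2)" by simp
qed

lemma L2_lin:
  assumes "f \<in> L2 M" "g \<in> L2 M"
  shows "(\<lambda>x. a * f x + b * g x) \<in> L2 M"
proof -
  have "integrable M (\<lambda>x. a\<^sup>2 * (f x)\<^sup>2 + 2 * a * b * (f x * g x) + b\<^sup>2 * (g x)\<^sup>2)"
    using assms by (simp add: L2_sq_integrable L2_mult_integrable)
  moreover have "(\<lambda>x. a\<^sup>2 * (f x)\<^sup>2 + 2 * a * b * (f x * g x) + b\<^sup>2 * (g x)\<^sup>2)
      = (\<lambda>x. (a * f x + b * g x)\<^sup>2)"
    by (auto simp: power2_eq_square algebra_simps)
  ultimately show ?thesis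
    using assms[THEN L2_meas] by (simp add: L2_def)
qed

lemma L2_zero [simp]: "(\<lambda>x. 0) \<in> L2 M"
  by (simp add: L2_def)

lemma L2_add: "f \<in> L2 M \<Longrightarrow> g \<in> L2 M \<Longrightarrow> (\<lambda>x. f x + g x) \<in> L2 M"
  using L2_lin[of f M g 1 1] by simp

lemma L2_diff: "f \<in> L2 M \<Longrightarrow> g \<in> L2 M \<Longrightarrow> (\<lambda>x. f x - g x) \<in> L2 M"
  using L2_lin[of f M g 1 "-1"] by simp

lemma L2_scale: "f \<in> L2 M \<Longrightarrow> (\<lambda>x. c * f x) \<in> L2 M"
  using L2_lin[of f M f c 0] by simp

lemma nrm_nonneg [simp]: "0 \<le> nrm M f"
  by (simp add: nrm_def)

lemma nrm_sq: "(nrm M f)\<^sup>2 = (\<integral>x. (f x)\<^sup>2 \<partial>M)"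
  by (simp add: nrm_def)

lemma nrm_zero [simp]: "nrm M (\<lambda>x. 0) = 0"
  by (simp add: nrm_def)

lemma nrm_scale: "nrm M (\<lambda>x. c * f x) = \<bar>c\<bar> * nrm M f"
  by (simp add: nrm_def power_mult_distrib real_sqrt_mult)

lemma nrm_minus_commute: "nrm M (\<lambda>x. f x - g x) = nrm M (\<lambda>x. g x - f x)"
  by (simp add: nrm_def power2_commute)

lemma integral_sq_lin:
  assumes "f \<in> L2 M" "g \<in> L2 M"
  shows "(\<integral>x. (a * f x + b * g x)\<^sup>2 \<partial>M)
    = a\<^sup>2 * (\<integral>x. (f x)\<^sup>2 \<partial>M) + 2 * a * b * (\<integral>x. f x * g x \<partial>M) + b\<^sup>2 * (\<integral>x. (g x)\<^sup>2 \<partial>M)"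
proof -
  have "(\<lambda>x. (a * f x + b * g x)\<^sup>2)
      = (\<lambda>x. a\<^sup>2 * (f x)\<^sup>2 + 2 * a * b * (f x * g x) + b\<^sup>2 * (g x)\<^sup>2)"
    by (auto simp: power2_eq_square algebra_simps)
  then show ?thesis
    using assms by (simp add: L2_sq_integrable L2_mult_integrable)
qed

text \<open>Discriminant argument: the integral of the square of a f + b g is a nonnegative
  quadratic form in a and b, and evaluating it at well chosen points suffices.\<close>

lemma L2_Cauchy_Schwarz:
  assumes "f \<in> L2 M" "g \<in> L2 M"
  shows "\<bar>\<integral>x. f x * g x \<partial>M\<bar> \<le> nrm M f * nrm M g"
proof -
  define A B C where "A = (\<integral>x. (f x)\<^sup>2 \<partial>M)" and "B = (\<integral>x. f x * g x \<partial>M)"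
    and "C = (\<integral>x. (g x)\<^sup>2 \<partial>M)"
  have nn: "A \<ge> 0" "C \<ge> 0" by (simp_all add: A_def C_def)
  have q: "a\<^sup>2 * A + 2 * a * b * B + b\<^sup>2 * C \<ge> 0" for a b
    using integral_sq_lin[OF assms, of a b] integral_nonneg_AE[of "\<lambda>x. (a * f x + b * g x)\<^sup>2" M]
    by (simp add: A_def B_def C_def)
  have "B\<^sup>2 \<le> A * C"
  proof (cases "C = 0")
    case True
    have "B = 0"
    proof (rule ccontr)
      assume "B \<noteq> 0"
      \<comment> \<open>With \<open>C = 0\<close> the form is affine in b, and this b gives it the
        value -1.\<close>
      with q[of 1 "- (A + 1) / (2 * B)"] True show False by (simp add: field_simps)
    qed
    with True show ?thesis by simp
  next
    case False
    with nn have "C > 0" by simp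
    from q[of C "- B"] have "0 \<le> C * (A * C - B\<^sup>2)"
      by (simp add: power2_eq_square algebra_simps)
    with \<open>C > 0\<close> show ?thesis by (simp add: zero_le_mult_iff)
  qed
  then have "sqrt (B\<^sup>2) \<le> sqrt (A * C)" by (rule real_sqrt_le_mono)
  then show ?thesis
    by (simp add: nrm_def A_def B_def C_def real_sqrt_mult)
qed

lemma nrm_triangle:
  assumes "f \<in> L2 M" "g \<in> L2 M"
  shows "nrm M (\<lambda>x. f x + g x) \<le> nrm M f + nrm M g"
proof (rule power2_le_imp_le)
  have "(nrm M (\<lambda>x. f x + g x))\<^sup>2 = (nrm M f)\<^sup>2 + 2 * (\<integral>x. f x * g x \<partial>M) + (nrm M g)\<^sup>2"
    using integral_sq_lin[OF assms, of 1 1] by (simp add: nrm_sq)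
  also have "\<dots> \<le> (nrm M f)\<^sup>2 + 2 * (nrm M f * nrm M g) + (nrm M g)\<^sup>2"
    using L2_Cauchy_Schwarz[OF assms] by simp
  finally show "(nrm M (\<lambda>x. f x + g x))\<^sup>2 \<le> (nrm M f + nrm M g)\<^sup>2"
    by (simp add: power2_sum)
qed simp

lemma nrm_triangle_diff:
  assumes "f \<in> L2 M" "g \<in> L2 M" "h \<in> L2 M"
  shows "nrm M (\<lambda>x. f x - h x) \<le> nrm M (\<lambda>x. f x - g x) + nrm M (\<lambda>x. g x - h x)"
  using nrm_triangle[OF L2_diff[OF assms(1,2)] L2_diff[OF assms(2,3)]] by simp

lemma nrm_diff_abs:
  assumes "f \<in> L2 M" "g \<in> L2 M"
  shows "\<bar>nrm M f - nrm M g\<bar> \<le> nrm M (\<lambda>x. f x - g x)"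
  using nrm_triangle_diff[OF assms L2_zero] nrm_triangle_diff[OF assms(2,1) L2_zero]
    nrm_minus_commute[of M f g] by simp

lemma nrm_cong_AE: "AE x in M. f x = g x \<Longrightarrow> f \<in> borel_measurable M \<Longrightarrow> g \<in> borel_measurable M \<Longrightarrow> nrm M f = nrm M g"
  unfolding nrm_def by (rule arg_cong[of _ _ sqrt], rule integral_cong_AE) auto

lemma L2_cong_AE:
  assumes "AE x in M. f x = g x" "f \<in> L2 M" "g \<in> borel_measurable M"
  shows "g \<in> L2 M"
proof -
  have "integrable M (\<lambda>x. (g x)\<^sup>2) \<longleftrightarrow> integrable M (\<lambda>x. (f x)\<^sup>2)"
    by (rule integrable_cong_AE) (use assms L2_meas[OF assms(2)] in auto)
  then show ?thesis using assms by (simp add: L2_def)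
qed

lemma nrm_eq_0_AE:
  assumes "f \<in> L2 M" "nrm M f = 0"
  shows "AE x in M. f x = 0"
  using assms integral_nonneg_eq_0_iff_AE[of M "\<lambda>x. (f x)\<^sup>2"] L2_sq_integrable[OF assms(1)]
  by (simp add: nrm_def)

lemma nn_integral_sq_L2:
  "f \<in> L2 M \<Longrightarrow> (\<integral>\<^sup>+x. ennreal ((f x)\<^sup>2) \<partial>M) = ennreal ((nrm M f)\<^sup>2)"
  by (simp add: nrm_sq nn_integral_eq_integral L2_sq_integrable)

lemma L2_I_nn:
  assumes "f \<in> borel_measurable M" "(\<integral>\<^sup>+x. ennreal ((f x)\<^sup>2) \<partial>M) < \<infinity>"
  shows "f \<in> L2 M"
  using assms unfolding L2_def by (auto intro!: integrableI_nonneg)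

lemma (in finite_measure) L2_integrable:
  assumes "f \<in> L2 M" shows "integrable M f"
proof -
  have "(\<lambda>x. 1) \<in> L2 M" by (simp add: L2_def)
  from L2_mult_integrable[OF assms this] show ?thesis by simp
qed

lemma (in finite_measure) L2_abs_integral_le:
  assumes "f \<in> L2 M"
  shows "(\<integral>x. \<bar>f x\<bar> \<partial>M) \<le> nrm M f * sqrt (measure M (space M))"
proof -
  have 1: "(\<lambda>x. 1) \<in> L2 M" by (simp add: L2_def)
  have 2: "(\<lambda>x. \<bar>f x\<bar>) \<in> L2 M" using assms by (auto simp: L2_def)
  have "nrm M (\<lambda>x. \<bar>f x\<bar>) = nrm M f" by (simp add: nrm_def)
  moreover have "nrm M (\<lambda>x. 1) = sqrt (measure M (space M))" by (simp add: nrm_def)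
  ultimately show ?thesis
    using L2_Cauchy_Schwarz[OF 2 1] by (simp add: abs_le_iff)
qed

text \<open>On a finite measure space an L2 Cauchy sequence is also L1 Cauchy, hence has a
  subsequence converging almost everywhere. Fatou's lemma upgrades the pointwise limit to the L2
  limit of the whole sequence.\<close>

lemma (in finite_measure) L2_complete:
  fixes f :: "nat \<Rightarrow> 'a \<Rightarrow> real"
  assumes f: "\<And>n. f n \<in> L2 M"
    and C: "\<And>e. e > 0 \<Longrightarrow> \<exists>N. \<forall>i\<ge>N. \<forall>j\<ge>N. nrm M (\<lambda>x. f i x - f j x) < e"
  shows "\<exists>g\<in>L2 M. (\<lambda>n. nrm M (\<lambda>x. f n x - g x)) \<longlonglongrightarrow> 0"
proof -
  note [measurable] = L2_meas[OF f]
  \<comment> \<open>The summand 1 keeps the divisor positive on a null space.\<close>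
  define c where "c = sqrt (measure M (space M)) + 1"
  have c: "c > 0" by (simp add: c_def add_nonneg_pos)
  obtain r where r: "strict_mono r" and AEC: "AE x in M. Cauchy (\<lambda>i. f (r i) x)"
  proof (rule cauchy_L1_AE_cauchy_subseq[of M f])
    show "integrable M (f n)" for n by (rule L2_integrable[OF f])
    fix e :: real assume "e > 0"
    then obtain N where N: "\<And>i j. i \<ge> N \<Longrightarrow> j \<ge> N \<Longrightarrow> nrm M (\<lambda>x. f i x - f j x) < e / c"
      using C[of "e / c"] c by auto
    have "(LINT x|M. norm (f i x - f j x)) < e" if "i \<ge> N" "j \<ge> N" for i j
    proof -
      have "(LINT x|M. \<bar>f i x - f j x\<bar>) \<le> nrm M (\<lambda>x. f i x - f j x) * sqrt (measure M (space M))"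
        by (rule L2_abs_integral_le[OF L2_diff[OF f f]])
      also have "\<dots> \<le> nrm M (\<lambda>x. f i x - f j x) * c"
        by (rule mult_left_mono) (simp_all add: c_def)
      also have "\<dots> < e" using N[OF that] c by (simp add: field_simps)
      finally show ?thesis by simp
    qed
    then show "\<exists>N. \<forall>i\<ge>N. \<forall>j\<ge>N. (LINT x|M. norm (f i x - f j x)) < e" by blast
  qed
  define g where "g = (\<lambda>x. lim (\<lambda>i. f (r i) x))"
  have g [measurable]: "g \<in> borel_measurable M" unfolding g_def by measurable
  have lim: "AE x in M. (\<lambda>i. f (r i) x) \<longlonglongrightarrow> g x"
    using AEC by eventually_elim (auto simp: g_def dest: Cauchy_convergent convergent_LIMSEQ_iff[THEN iffD1])
  \<comment> \<open>Fatou along the subsequence, with n fixed. The nonnegative integral allows the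
    distance to be bounded before \<open>g\<close> is known to be square integrable; that membership
    is then read off from the case e = 1.\<close>
  have key: "\<exists>N. \<forall>n\<ge>N. (\<integral>\<^sup>+x. ennreal ((f n x - g x)\<^sup>2) \<partial>M) \<le> ennreal (e\<^sup>2)" if e: "e > 0" for e
  proof -
    obtain N where N: "\<And>i j. i \<ge> N \<Longrightarrow> j \<ge> N \<Longrightarrow> nrm M (\<lambda>x. f i x - f j x) < e"
      using C[OF e] by auto
    have "(\<integral>\<^sup>+x. ennreal ((f n x - g x)\<^sup>2) \<partial>M) \<le> ennreal (e\<^sup>2)" if n: "n \<ge> N" for n
    proof -
      have "(\<integral>\<^sup>+x. ennreal ((f n x - g x)\<^sup>2) \<partial>M)
          = (\<integral>\<^sup>+x. liminf (\<lambda>i. ennreal ((f n x - f (r i) x)\<^sup>2)) \<partial>M)"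
      proof (rule nn_integral_cong_AE, use lim in eventually_elim)
        fix x assume "(\<lambda>i. f (r i) x) \<longlonglongrightarrow> g x"
        then have "(\<lambda>i. ennreal ((f n x - f (r i) x)\<^sup>2)) \<longlonglongrightarrow> ennreal ((f n x - g x)\<^sup>2)"
          by (intro tendsto_intros)
        then show "ennreal ((f n x - g x)\<^sup>2) = liminf (\<lambda>i. ennreal ((f n x - f (r i) x)\<^sup>2))"
          by (intro lim_imp_Liminf[symmetric] trivial_limit_sequentially)
      qed
      also have "\<dots> \<le> liminf (\<lambda>i. \<integral>\<^sup>+x. ennreal ((f n x - f (r i) x)\<^sup>2) \<partial>M)"
        by (rule nn_integral_liminf) measurable
      also have "\<dots> \<le> ennreal (e\<^sup>2)"
      proof (rule Liminf_le)
        show "eventually (\<lambda>i. (\<integral>\<^sup>+x. ennreal ((f n x - f (r i) x)\<^sup>2) \<partial>M) \<le> ennreal (e\<^sup>2)) sequentially"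
        proof (rule eventually_sequentiallyI[of N])
          fix i assume "i \<ge> N"
          then have "r i \<ge> N" using seq_suble[OF r, of i] by simp
          then have "nrm M (\<lambda>x. f n x - f (r i) x) \<le> e" using N[OF n] by (simp add: less_imp_le)
          then show "(\<integral>\<^sup>+x. ennreal ((f n x - f (r i) x)\<^sup>2) \<partial>M) \<le> ennreal (e\<^sup>2)"
            by (simp add: nn_integral_sq_L2[OF L2_diff[OF f f]] power_mono)
        qed
      qed simp
      finally show ?thesis .
    qed
    then show ?thesis by blast
  qed
  obtain n where "(\<integral>\<^sup>+x. ennreal ((f n x - g x)\<^sup>2) \<partial>M) \<le> ennreal (1\<^sup>2)"
    using key[of 1] by auto
  then have "(\<lambda>x. f n x - g x) \<in> L2 M"
    by (intro L2_I_nn) (auto intro: le_less_trans)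
  from L2_diff[OF f[of n] this] have gL: "g \<in> L2 M" by simp
  have "(\<lambda>n. nrm M (\<lambda>x. f n x - g x)) \<longlonglongrightarrow> 0"
  proof (rule LIMSEQ_I)
    fix e :: real assume e: "e > 0"
    then obtain N where N: "\<And>n. n \<ge> N \<Longrightarrow> (\<integral>\<^sup>+x. ennreal ((f n x - g x)\<^sup>2) \<partial>M) \<le> ennreal ((e/2)\<^sup>2)"
      using key[of "e/2"] by auto
    have "nrm M (\<lambda>x. f n x - g x) < e" if "n \<ge> N" for n
    proof -
      have "(nrm M (\<lambda>x. f n x - g x))\<^sup>2 \<le> (e / 2)\<^sup>2"
        using N[OF that] unfolding nn_integral_sq_L2[OF L2_diff[OF f gL]] by simp
      then have "nrm M (\<lambda>x. f n x - g x) \<le> e / 2" by (rule power2_le_imp_le) (use e in simp)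
      then show ?thesis using e by simp
    qed
    then show "\<exists>N. \<forall>n\<ge>N. norm (nrm M (\<lambda>x. f n x - g x) - 0) < e"
      by (intro exI[of _ N]) simp
  qed
  with gL show ?thesis by blast
qed

section \<open>Closures of linear sets and orthogonal projection\<close>

definition L2_closure :: "'a measure \<Rightarrow> ('a \<Rightarrow> real) set \<Rightarrow> ('a \<Rightarrow> real) set" where
  "L2_closure M S = {f \<in> L2 M. \<forall>e>0. \<exists>g\<in>S. nrm M (\<lambda>x. f x - g x) < e}"

definition lin_set :: "('a \<Rightarrow> real) set \<Rightarrow> bool" where
  "lin_set S \<longleftrightarrow> (\<lambda>x. 0) \<in> S \<and> (\<forall>f\<in>S. \<forall>g\<in>S. \<forall>a b. (\<lambda>x. a * f x + b * g x) \<in> S)"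

lemma lin_set_zero: "lin_set S \<Longrightarrow> (\<lambda>x. 0) \<in> S"
  unfolding lin_set_def by (rule conjunct1)

lemma lin_setD:
  assumes "lin_set S" and f: "f \<in> S" and g: "g \<in> S"
  shows "(\<lambda>x. a * f x + b * g x) \<in> S"
proof -
  have "\<forall>f\<in>S. \<forall>g\<in>S. \<forall>a b. (\<lambda>x. a * f x + b * g x) \<in> S"
    using assms(1) unfolding lin_set_def by (rule conjunct2)
  from this[THEN bspec, OF f, THEN bspec, OF g, THEN spec, THEN spec] show ?thesis .
qed

lemma lin_set_diff: "lin_set S \<Longrightarrow> f \<in> S \<Longrightarrow> g \<in> S \<Longrightarrow> (\<lambda>x. f x - g x) \<in> S"
  using lin_setD[of S f g 1 "-1"] by simp

lemma lin_set_add: "lin_set S \<Longrightarrow> f \<in> S \<Longrightarrow> g \<in> S \<Longrightarrow> (\<lambda>x. f x + g x) \<in> S"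
  using lin_setD[of S f g 1 1] by simp

lemma lin_set_scale: "lin_set S \<Longrightarrow> f \<in> S \<Longrightarrow> (\<lambda>x. c * f x) \<in> S"
  using lin_setD[of S f f c 0] by simp

lemma lin_set_sum:
  assumes "lin_set S" "\<And>i. i \<in> I \<Longrightarrow> f i \<in> S"
  shows "(\<lambda>x. \<Sum>i\<in>I. c i * f i x) \<in> S"
  using assms(2)
proof (induction I rule: infinite_finite_induct)
  case (insert i I)
  then show ?case
    using lin_setD[OF assms(1), of "f i" "\<lambda>x. \<Sum>i\<in>I. c i * f i x" "c i" 1] by simp
qed (simp_all add: lin_set_zero assms(1))

lemma L2_closureD: "f \<in> L2_closure M S \<Longrightarrow> e > 0 \<Longrightarrow> \<exists>g\<in>S. nrm M (\<lambda>x. f x - g x) < e"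
  by (simp add: L2_closure_def)

lemma L2_closure_L2: "f \<in> L2_closure M S \<Longrightarrow> f \<in> L2 M"
  by (simp add: L2_closure_def)

lemma subset_L2_closure: "S \<subseteq> L2 M \<Longrightarrow> f \<in> S \<Longrightarrow> f \<in> L2_closure M S"
  unfolding L2_closure_def by (auto intro!: bexI[of _ f])

lemma L2_closure_mono: "S \<subseteq> S' \<Longrightarrow> L2_closure M S \<subseteq> L2_closure M S'"
  unfolding L2_closure_def by blast

lemma L2_closure_closed:
  assumes S: "S \<subseteq> L2 M" and f: "f \<in> L2 M"
    and app: "\<And>e. e > 0 \<Longrightarrow> \<exists>g\<in>L2_closure M S. nrm M (\<lambda>x. f x - g x) < e"
  shows "f \<in> L2_closure M S"
proof -
  have "\<exists>g\<in>S. nrm M (\<lambda>x. f x - g x) < e" if e: "e > 0" for e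
  proof -
    obtain g where g: "g \<in> L2_closure M S" "nrm M (\<lambda>x. f x - g x) < e / 2"
      using app[of "e/2"] e by auto
    obtain h where h: "h \<in> S" "nrm M (\<lambda>x. g x - h x) < e / 2"
      using L2_closureD[OF g(1), of "e/2"] e by auto
    have "h \<in> L2 M" using h S by auto
    from nrm_triangle_diff[OF f L2_closure_L2[OF g(1)] this] have "nrm M (\<lambda>x. f x - h x) < e"
      using h g by linarith
    then show ?thesis using h(1) by (rule bexI)
  qed
  with f show ?thesis by (simp add: L2_closure_def)
qed

lemma lin_set_L2_closure:
  assumes S: "S \<subseteq> L2 M" "lin_set S"
  shows "lin_set (L2_closure M S)"
  unfolding lin_set_def
proof (intro conjI ballI allI)
  show "(\<lambda>x. 0) \<in> L2_closure M S"
    by (rule subset_L2_closure[OF S(1) lin_set_zero[OF S(2)]])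
  fix f g a b assume f: "f \<in> L2_closure M S" and g: "g \<in> L2_closure M S"
  note fL = L2_closure_L2[OF f] and gL = L2_closure_L2[OF g]
  show "(\<lambda>x. a * f x + b * g x) \<in> L2_closure M S"
    unfolding L2_closure_def
  proof (intro CollectI conjI allI impI L2_lin fL gL)
    fix e :: real assume e: "e > 0"
    define d where "d = e / (\<bar>a\<bar> + \<bar>b\<bar> + 1)"
    have d: "d > 0" using e by (simp add: d_def)
    obtain f' where f': "f' \<in> S" "nrm M (\<lambda>x. f x - f' x) < d" using L2_closureD[OF f d] by auto
    obtain g' where g': "g' \<in> S" "nrm M (\<lambda>x. g x - g' x) < d" using L2_closureD[OF g d] by auto
    have f'L: "f' \<in> L2 M" and g'L: "g' \<in> L2 M" using f' g' S by auto
    have "nrm M (\<lambda>x. (a * f x + b * g x) - (a * f' x + b * g' x))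
        = nrm M (\<lambda>x. a * (f x - f' x) + b * (g x - g' x))"
      by (simp add: algebra_simps)
    also have "\<dots> \<le> \<bar>a\<bar> * nrm M (\<lambda>x. f x - f' x) + \<bar>b\<bar> * nrm M (\<lambda>x. g x - g' x)"
      using nrm_triangle[OF L2_scale[OF L2_diff[OF fL f'L]] L2_scale[OF L2_diff[OF gL g'L]], of a b]
      by (simp add: nrm_scale)
    also have "\<dots> \<le> \<bar>a\<bar> * d + \<bar>b\<bar> * d"
      using f' g' by (intro add_mono mult_left_mono) auto
    also have "\<dots> < (\<bar>a\<bar> + \<bar>b\<bar> + 1) * d"
      using d by (simp add: algebra_simps)
    also have "\<dots> = e" by (simp add: d_def)
    finally have *: "nrm M (\<lambda>x. (a * f x + b * g x) - (a * f' x + b * g' x)) < e" .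
    show "\<exists>h\<in>S. nrm M (\<lambda>x. (a * f x + b * g x) - h x) < e"
      by (rule bexI[of _ "\<lambda>x. a * f' x + b * g' x"], rule *, rule lin_setD[OF S(2) f'(1) g'(1)])
  qed
qed

text \<open>Continuity of the inner product: orthogonality survives L2 limits. Relations with the
  closed span of a process are reduced to single indices through this.\<close>

lemma L2_closure_orth:
  assumes S: "S \<subseteq> L2 M" and Z: "Z \<in> L2 M" and o: "\<And>V. V \<in> S \<Longrightarrow> (\<integral>x. Z x * V x \<partial>M) = 0"
    and Y: "Y \<in> L2_closure M S"
  shows "(\<integral>x. Z x * Y x \<partial>M) = 0"
proof -
  note YL = L2_closure_L2[OF Y]
  have "\<bar>\<integral>x. Z x * Y x \<partial>M\<bar> \<le> e" if e: "e > 0" for e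
  proof -
    define d where "d = e / (nrm M Z + 1)"
    have d: "d > 0" using e by (simp add: d_def add_nonneg_pos)
    obtain V where V: "V \<in> S" "nrm M (\<lambda>x. Y x - V x) < d" using L2_closureD[OF Y d] by auto
    then have VL: "V \<in> L2 M" using S by auto
    have "(\<integral>x. Z x * Y x \<partial>M) = (\<integral>x. Z x * (Y x - V x) \<partial>M)"
      unfolding right_diff_distrib
      by (subst Bochner_Integration.integral_diff[OF L2_mult_integrable[OF Z YL] L2_mult_integrable[OF Z VL]])
        (simp only: o[OF V(1)] diff_0_right)
    also have "\<bar>\<dots>\<bar> \<le> nrm M Z * nrm M (\<lambda>x. Y x - V x)"
      by (rule L2_Cauchy_Schwarz[OF Z L2_diff[OF YL VL]])
    also have "\<dots> \<le> nrm M Z * d" using V by (intro mult_left_mono) auto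
    also have "\<dots> \<le> (nrm M Z + 1) * d" using d by simp
    also have "\<dots> = e" by (simp add: d_def add_nonneg_eq_0_iff)
    finally show ?thesis .
  qed
  then have "\<bar>\<integral>x. Z x * Y x \<partial>M\<bar> \<le> 0" by (rule field_le_epsilon) (simp only: add_0)
  then show ?thesis by simp
qed

text \<open>The projection theorem by a minimising sequence. \<open>S\<close> need not be closed, so
  the minimiser is found in the closure, whereas orthogonality is claimed only against
  \<open>S\<close>; \<open>L2_closure_orth\<close> extends it to the closure.\<close>

lemma (in finite_measure) L2_projection:
  assumes S: "S \<subseteq> L2 M" "lin_set S" and Z: "Z \<in> L2 M"
  shows "\<exists>Y\<in>L2_closure M S. \<forall>V\<in>S. (\<integral>x. (Z x - Y x) * V x \<partial>M) = 0"
proof -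
  define D where "D = (\<lambda>V. (nrm M (\<lambda>x. Z x - V x))\<^sup>2) ` S"
  define d where "d = Inf D"
  have ne: "D \<noteq> {}" using lin_set_zero[OF S(2)] by (auto simp: D_def)
  have bd: "bdd_below D" unfolding D_def by (auto intro!: bdd_belowI[of _ 0])
  have d_le: "d \<le> (nrm M (\<lambda>x. Z x - V x))\<^sup>2" if "V \<in> S" for V
    unfolding d_def using that bd by (intro cInf_lower) (auto simp: D_def)
  have "\<exists>V\<in>S. (nrm M (\<lambda>x. Z x - V x))\<^sup>2 < d + 1 / Suc n" for n
    using cInf_lessD[OF ne, of "d + 1 / Suc n"] by (auto simp: D_def d_def)
  then obtain V where V: "\<And>n. V n \<in> S" "\<And>n. (nrm M (\<lambda>x. Z x - V n x))\<^sup>2 < d + 1 / Suc n"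
    by metis
  have VL: "V n \<in> L2 M" for n using V S by auto
  \<comment> \<open>Parallelogram identity: the midpoint of \<open>V i\<close> and
    \<open>V j\<close> lies in \<open>S\<close>, so its squared distance to \<open>Z\<close> is at
    least the infimum. This makes the minimising sequence Cauchy.\<close>
  have par: "(nrm M (\<lambda>x. V i x - V j x))\<^sup>2 \<le> 2 / Suc i + 2 / Suc j" for i j
  proof -
    let ?f = "\<lambda>x. Z x - V i x" and ?g = "\<lambda>x. Z x - V j x"
    have L: "?f \<in> L2 M" "?g \<in> L2 M" using Z VL by (auto intro: L2_diff)
    have "(\<lambda>x. (1/2) * V i x + (1/2) * V j x) \<in> S" by (intro lin_setD S V)
    note mem = this
    have eq: "Z x - ((1/2) * V i x + (1/2) * V j x) = (1/2) * ?f x + (1/2) * ?g x" for x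
      by (simp add: field_simps)
    have "d \<le> (\<integral>x. ((1/2) * ?f x + (1/2) * ?g x)\<^sup>2 \<partial>M)"
      using d_le[OF mem] by (simp only: nrm_sq eq)
    also have "\<dots> = (1/4) * (nrm M ?f)\<^sup>2 + (1/2) * (\<integral>x. ?f x * ?g x \<partial>M) + (1/4) * (nrm M ?g)\<^sup>2"
      by (subst integral_sq_lin[OF L]) (simp add: nrm_sq power_divide)
    finally have a: "4 * d \<le> (nrm M ?f)\<^sup>2 + 2 * (\<integral>x. ?f x * ?g x \<partial>M) + (nrm M ?g)\<^sup>2" by simp
    have "(nrm M (\<lambda>x. V i x - V j x))\<^sup>2 = (\<integral>x. (1 * ?g x + (-1) * ?f x)\<^sup>2 \<partial>M)"
      by (simp add: nrm_sq)
    also have "\<dots> = (nrm M ?f)\<^sup>2 - 2 * (\<integral>x. ?f x * ?g x \<partial>M) + (nrm M ?g)\<^sup>2"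
      by (subst integral_sq_lin[OF L(2,1)]) (simp add: nrm_sq mult.commute)
    finally have b: "(nrm M (\<lambda>x. V i x - V j x))\<^sup>2 = (nrm M ?f)\<^sup>2 - 2 * (\<integral>x. ?f x * ?g x \<partial>M) + (nrm M ?g)\<^sup>2" .
    show ?thesis using a b V(2)[of i] V(2)[of j] by simp
  qed
  obtain Y where Y: "Y \<in> L2 M" "(\<lambda>n. nrm M (\<lambda>x. V n x - Y x)) \<longlonglongrightarrow> 0"
  proof (rule bexE[OF L2_complete[OF VL]])
    fix e :: real assume e: "e > 0"
    obtain N where N: "inverse (real (Suc N)) < e\<^sup>2 / 4"
      using reals_Archimedean[of "e\<^sup>2 / 4"] e by auto
    have "nrm M (\<lambda>x. V i x - V j x) < e" if "i \<ge> N" "j \<ge> N" for i j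
    proof (rule power2_less_imp_less)
      have "2 / real (Suc i) \<le> 2 / Suc N" "2 / real (Suc j) \<le> 2 / Suc N"
        using that by (auto intro!: divide_left_mono)
      then show "(nrm M (\<lambda>x. V i x - V j x))\<^sup>2 < e\<^sup>2"
        using par[of i j] N by (simp add: inverse_eq_divide)
    qed (use e in simp)
    then show "\<exists>N. \<forall>i\<ge>N. \<forall>j\<ge>N. nrm M (\<lambda>x. V i x - V j x) < e" by blast
  qed (use that in blast)
  have Ycl: "Y \<in> L2_closure M S"
    unfolding L2_closure_def
  proof (intro CollectI conjI Y allI impI)
    fix e :: real assume "e > 0"
    then obtain n where "nrm M (\<lambda>x. V n x - Y x) < e"
      using LIMSEQ_D[OF Y(2), of e] by auto
    then show "\<exists>g\<in>S. nrm M (\<lambda>x. Y x - g x) < e"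
      using V(1)[of n] nrm_minus_commute[of M Y "V n"] by metis
  qed
  \<comment> \<open>The infimum over \<open>S\<close> is also a lower bound over the closure, which
    is needed because the variation below perturbs \<open>Y\<close>, a point of the closure.\<close>
  have lower: "d \<le> (nrm M (\<lambda>x. Z x - U x))\<^sup>2" if U: "U \<in> L2_closure M S" for U
  proof -
    have *: "d \<le> (nrm M (\<lambda>x. Z x - U x))\<^sup>2 + e" if e: "e > 0" for e
    proof -
      define b where "b = nrm M (\<lambda>x. Z x - U x)"
      have b0: "b \<ge> 0" by (simp add: b_def)
      define q where "q = min 1 (e / (2 * b + 1))"
      have q: "q > 0" "q \<le> 1" "q \<le> e / (2 * b + 1)" using e b0
        by (auto simp: q_def)
      then have q': "(2 * b + 1) * q \<le> e" using b0 by (simp add: pos_le_divide_eq mult.commute)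
      obtain g where g: "g \<in> S" "nrm M (\<lambda>x. U x - g x) < q" using L2_closureD[OF U q(1)] by auto
      have "nrm M (\<lambda>x. Z x - g x) \<le> b + q"
        using nrm_triangle_diff[OF Z L2_closure_L2[OF U], of g] g S by (auto simp: b_def)
      then have "(nrm M (\<lambda>x. Z x - g x))\<^sup>2 \<le> (b + q)\<^sup>2" by (intro power_mono) auto
      also have "\<dots> = b\<^sup>2 + (2 * b + q) * q" by (simp add: power2_eq_square algebra_simps)
      also have "\<dots> \<le> b\<^sup>2 + (2 * b + 1) * q" using q by (intro add_left_mono mult_right_mono) auto
      also have "\<dots> \<le> b\<^sup>2 + e" using q' by simp
      finally have "(nrm M (\<lambda>x. Z x - g x))\<^sup>2 \<le> b\<^sup>2 + e" .
      then show ?thesis using d_le[OF g(1)] by (simp add: b_def)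
    qed
    show ?thesis by (rule field_le_epsilon) (rule *)
  qed
  have upper: "(nrm M (\<lambda>x. Z x - Y x))\<^sup>2 \<le> d"
  proof -
    have d0: "d \<ge> 0" unfolding d_def by (rule cInf_greatest[OF ne]) (auto simp: D_def)
    have "nrm M (\<lambda>x. Z x - Y x) \<le> sqrt d + 0"
    proof (rule LIMSEQ_le_const)
      have "(\<lambda>n. sqrt (d + 1 / Suc n) + nrm M (\<lambda>x. V n x - Y x)) \<longlonglongrightarrow> sqrt (d + 0) + 0"
        by (intro tendsto_intros Y LIMSEQ_Suc[OF lim_1_over_n])
      then show "(\<lambda>n. sqrt (d + 1 / Suc n) + nrm M (\<lambda>x. V n x - Y x)) \<longlonglongrightarrow> sqrt d + 0" by simp
      have "nrm M (\<lambda>x. Z x - Y x) \<le> sqrt (d + 1 / Suc n) + nrm M (\<lambda>x. V n x - Y x)" for n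
        using nrm_triangle_diff[OF Z VL Y(1), of n] V(2)[of n]
          real_le_rsqrt[of "nrm M (\<lambda>x. Z x - V n x)" "d + 1 / Suc n"] by linarith
      then show "\<exists>N. \<forall>n\<ge>N. nrm M (\<lambda>x. Z x - Y x) \<le> sqrt (d + 1 / Suc n) + nrm M (\<lambda>x. V n x - Y x)"
        by blast
    qed
    then have "(nrm M (\<lambda>x. Z x - Y x))\<^sup>2 \<le> (sqrt d)\<^sup>2" by (intro power_mono) auto
    then show ?thesis using d0 by simp
  qed
  have "(\<integral>x. (Z x - Y x) * W x \<partial>M) = 0" if W: "W \<in> S" for W
  proof -
    have WL: "W \<in> L2 M" using W S by auto
    define B C where "B = (\<integral>x. (Z x - Y x) * W x \<partial>M)" and "C = (\<integral>x. (W x)\<^sup>2 \<partial>M)"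
    have C: "C \<ge> 0" by (simp add: C_def)
    have q: "0 \<le> - 2 * a * B + a\<^sup>2 * C" for a
    proof -
      have "(\<lambda>x. 1 * Y x + a * W x) \<in> L2_closure M S"
        by (intro lin_setD lin_set_L2_closure S Ycl subset_L2_closure W)
      from lower[OF this] have "d \<le> (\<integral>x. (1 * (Z x - Y x) + (- a) * W x)\<^sup>2 \<partial>M)"
        by (simp add: nrm_sq algebra_simps)
      also have "\<dots> = (nrm M (\<lambda>x. Z x - Y x))\<^sup>2 - 2 * a * B + a\<^sup>2 * C"
        by (subst integral_sq_lin[OF L2_diff[OF Z Y(1)] WL]) (simp add: nrm_sq B_def C_def)
      finally show ?thesis using upper by simp
    qed
    \<comment> \<open>Minimising the quadratic would suggest B / C; the denominator C + 1 also
      covers C = 0 and still forces k = 0.\<close>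
    define k where "k = B / (C + 1)"
    have B: "B = k * (C + 1)" using C by (simp add: k_def)
    have "0 \<le> - (k\<^sup>2 * (C + 2))" using q[of k] by (simp add: B power2_eq_square algebra_simps)
    then have "k = 0" using C by (simp add: zero_le_mult_iff mult_le_0_iff)
    then show ?thesis using B by (simp add: B_def)
  qed
  then show ?thesis using Ycl by (intro bexI[of _ Y]) auto
qed

section \<open>Uniqueness for characteristic functions\<close>

text \<open>The Lipschitz bound that carries characteristic functions through L2 limits in
  \<open>gaussian_space_closure\<close>.\<close>

lemma norm_iexp_diff_le: "norm (iexp a - iexp b) \<le> \<bar>a - b\<bar>"
proof -
  have "iexp a - iexp b = iexp b * (iexp (a - b) - 1)"
    by (simp add: algebra_simps flip: exp_add)
  then have "norm (iexp a - iexp b) = norm (iexp (a - b) - 1)"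
    by (simp add: norm_mult)
  also have "\<dots> \<le> \<bar>a - b\<bar>"
    using iexp_approx1[of "a - b" 0] by simp
  finally show ?thesis .
qed

text \<open>For large \<open>C\<close> the function \<open>1 + U / C\<close> is a probability density, and changing the measure by it
leaves the characteristic function of \<open>X\<close> unchanged.\<close>

lemma (in prob_space) integral_weighted_eq_0_if_char_real:
  fixes X U :: "'a \<Rightarrow> real" and g :: "real \<Rightarrow> 'b::{banach, second_countable_topology}"
  assumes X [measurable]: "X \<in> borel_measurable M" and U [measurable]: "U \<in> borel_measurable M"
    and bd: "\<And>x. \<bar>U x\<bar> \<le> c"
    and char: "\<And>r. (\<integral>x. iexp (r * X x) * U x \<partial>M) = 0"
    and g [measurable]: "g \<in> borel_measurable borel"
    and int: "integrable M (\<lambda>x. g (X x))"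
  shows "(\<integral>x. U x *\<^sub>R g (X x) \<partial>M) = 0"
proof -
  define C where "C = \<bar>c\<bar> + 1"
  have C: "C > 0" by (simp add: C_def)
  define w where "w = (\<lambda>x. 1 + U x / C)"
  have w [measurable]: "w \<in> borel_measurable M" by (simp add: w_def)
  have w0: "0 \<le> w x" for x
  proof -
    have "\<bar>U x\<bar> \<le> C" using bd[of x] by (simp add: C_def)
    then have "- 1 \<le> U x / C" using C by (simp add: pos_le_divide_eq)
    then show ?thesis by (simp add: w_def)
  qed
  have Ui: "integrable M U" by (rule integrable_const_bound[of _ c]) (use bd in auto)
  have iU: "integrable M (\<lambda>x. iexp (r * X x) * U x)" for r
    by (rule integrable_const_bound[of _ c]) (use bd in \<open>auto simp: norm_mult\<close>)
  have ie: "integrable M (\<lambda>x. iexp (r * X x))" for r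
    by (rule integrable_const_bound[of _ 1]) auto
  \<comment> \<open>The hypothesis at r = 0 says that \<open>U\<close> has mean zero, so
    \<open>w\<close> has total mass one.\<close>
  have "complex_of_real (\<integral>x. U x \<partial>M) = 0" using char[of 0] by simp
  then have U0: "(\<integral>x. U x \<partial>M) = 0" using of_real_eq_0_iff by blast
  have wi: "integrable M w" "(\<integral>x. w x \<partial>M) = 1"
    using Ui U0 by (simp_all add: w_def prob_space)
  define D where "D = density M (\<lambda>x. ennreal (w x))"
  have D: "prob_space D"
    unfolding D_def by (rule prob_spaceI)
      (use wi w0 in \<open>simp add: emeasure_density nn_integral_eq_integral cong: nn_integral_cong\<close>)
  have eq: "distr D borel X = distr M borel X"
  proof (rule Levy_uniqueness)
    have XD: "X \<in> borel_measurable D" by (simp add: D_def)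
    show "real_distribution (distr D borel X)"
      by (rule prob_space.real_distribution_distr[OF D XD])
    show "real_distribution (distr M borel X)"
      by (rule real_distribution_distr[OF X])
    show "char (distr D borel X) = char (distr M borel X)"
    proof
      fix r
      have "char (distr D borel X) r = (\<integral>x. iexp (r * X x) \<partial>D)"
        unfolding char_def by (rule integral_distr) (simp_all add: D_def)
      also have "\<dots> = (\<integral>x. w x *\<^sub>R iexp (r * X x) \<partial>M)"
        unfolding D_def by (rule integral_density) (use w0 in auto)
      also have "\<dots> = (\<integral>x. iexp (r * X x) + (iexp (r * X x) * U x) / C \<partial>M)"
        by (rule Bochner_Integration.integral_cong) (simp_all add: w_def scaleR_conv_of_real algebra_simps)
      also have "\<dots> = (\<integral>x. iexp (r * X x) \<partial>M)"
        using ie[of r] iU[of r] char[of r] by simp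
      also have "\<dots> = char (distr M borel X) r"
        unfolding char_def by (rule integral_distr[symmetric]) simp_all
      finally show "char (distr D borel X) r = char (distr M borel X) r" .
    qed
  qed
  have "(\<integral>x. w x *\<^sub>R g (X x) \<partial>M) = (\<integral>x. g (X x) \<partial>D)"
    unfolding D_def by (rule integral_density[symmetric]) (use w0 in auto)
  also have "\<dots> = (\<integral>y. g y \<partial>distr D borel X)"
    by (rule integral_distr[symmetric]) (simp_all add: D_def)
  also have "\<dots> = (\<integral>x. g (X x) \<partial>M)"
    unfolding eq by (rule integral_distr) simp_all
  finally have 1: "(\<integral>x. w x *\<^sub>R g (X x) \<partial>M) = (\<integral>x. g (X x) \<partial>M)" .
  have Ug: "integrable M (\<lambda>x. U x *\<^sub>R g (X x))"
  proof (rule Bochner_Integration.integrable_bound)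
    show "integrable M (\<lambda>x. c * norm (g (X x)))" using int by simp
    show "AE x in M. norm (U x *\<^sub>R g (X x)) \<le> norm (c * norm (g (X x)))"
    proof (rule AE_I2)
      fix x
      have "\<bar>U x\<bar> * norm (g (X x)) \<le> c * norm (g (X x))" by (rule mult_right_mono[OF bd]) simp
      then show "norm (U x *\<^sub>R g (X x)) \<le> norm (c * norm (g (X x)))"
        by (simp add: abs_mult) (metis abs_ge_self mult_right_mono norm_ge_zero order_trans)
    qed
  qed measurable
  have "(\<integral>x. w x *\<^sub>R g (X x) \<partial>M) = (\<integral>x. g (X x) + (1 / C) *\<^sub>R (U x *\<^sub>R g (X x)) \<partial>M)"
    by (rule Bochner_Integration.integral_cong) (simp_all add: w_def scaleR_left_distrib)
  also have "\<dots> = (\<integral>x. g (X x) \<partial>M) + (1 / C) *\<^sub>R (\<integral>x. U x *\<^sub>R g (X x) \<partial>M)"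
    by (simp only: Bochner_Integration.integral_add[OF int integrable_scaleR_right[OF Ug]] integral_scaleR_right)
  finally show ?thesis using 1 C by simp
qed

text \<open>The hypothesis is invariant under conjugation of \<open>U\<close>, because r may be
  replaced by -r. It therefore holds for the real and the imaginary part, and the real case applies
  to both.\<close>

lemma (in prob_space) integral_weighted_eq_0_if_char:
  fixes X :: "'a \<Rightarrow> real" and U :: "'a \<Rightarrow> complex" and g :: "real \<Rightarrow> real"
  assumes X [measurable]: "X \<in> borel_measurable M" and U [measurable]: "U \<in> borel_measurable M"
    and bd: "\<And>x. norm (U x) \<le> c"
    and char: "\<And>r. (\<integral>x. iexp (r * X x) * U x \<partial>M) = 0"
    and g [measurable]: "g \<in> borel_measurable borel"
    and int: "integrable M (\<lambda>x. g (X x))"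
  shows "(\<integral>x. U x * g (X x) \<partial>M) = 0"
proof -
  have iU: "integrable M (\<lambda>x. iexp (r * X x) * U x)" for r
    by (rule integrable_const_bound[of _ c]) (use bd in \<open>auto simp: norm_mult\<close>)
  have char': "(\<integral>x. iexp (r * X x) * cnj (U x) \<partial>M) = 0" for r
  proof -
    have "(\<integral>x. iexp (r * X x) * cnj (U x) \<partial>M) = (\<integral>x. cnj (iexp ((- r) * X x) * U x) \<partial>M)"
      by (rule Bochner_Integration.integral_cong) (simp_all add: exp_cnj)
    also have "\<dots> = cnj (\<integral>x. iexp ((- r) * X x) * U x \<partial>M)"
      by (rule integral_bounded_linear[OF bounded_linear_cnj iU])
    finally show ?thesis using char[of "- r"] by simp
  qed
  have iU': "integrable M (\<lambda>x. iexp (r * X x) * cnj (U x))" for r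
  proof -
    have "integrable M (\<lambda>x. cnj (iexp ((- r) * X x) * U x))"
      by (rule integrable_bounded_linear[OF bounded_linear_cnj iU])
    moreover have "(\<lambda>x. cnj (iexp ((- r) * X x) * U x)) = (\<lambda>x. iexp (r * X x) * cnj (U x))"
      by (simp add: exp_cnj)
    ultimately show ?thesis by simp
  qed
  have cR: "(\<integral>x. iexp (r * X x) * Re (U x) \<partial>M) = 0" for r
  proof -
    have "(\<integral>x. iexp (r * X x) * Re (U x) \<partial>M)
        = (\<integral>x. (iexp (r * X x) * U x + iexp (r * X x) * cnj (U x)) / 2 \<partial>M)"
      by (rule Bochner_Integration.integral_cong) (auto simp: complex_add_cnj simp flip: distrib_left)
    also have "\<dots> = 0" using char[of r] char'[of r] iU iU' by simp
    finally show ?thesis .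
  qed
  have cI: "(\<integral>x. iexp (r * X x) * Im (U x) \<partial>M) = 0" for r
  proof -
    have "(\<integral>x. iexp (r * X x) * Im (U x) \<partial>M)
        = (\<integral>x. (iexp (r * X x) * U x - iexp (r * X x) * cnj (U x)) / (2 * \<i>) \<partial>M)"
    proof (rule Bochner_Integration.integral_cong)
      fix x
      have e: "complex_of_real (Im (U x)) = (U x - cnj (U x)) / (2 * \<i>)"
        unfolding complex_diff_cnj by (simp add: complex_eq_iff)
      show "iexp (r * X x) * Im (U x) = (iexp (r * X x) * U x - iexp (r * X x) * cnj (U x)) / (2 * \<i>)"
        unfolding e by (simp add: right_diff_distrib)
    qed simp
    also have "\<dots> = 0" using char[of r] char'[of r] iU iU' by simp
    finally show ?thesis .
  qed
  have bR: "\<bar>Re (U x)\<bar> \<le> c" and bI: "\<bar>Im (U x)\<bar> \<le> c" for x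
    using abs_Re_le_cmod[of "U x"] abs_Im_le_cmod[of "U x"] bd[of x] by auto
  have R: "(\<integral>x. Re (U x) *\<^sub>R complex_of_real (g (X x)) \<partial>M) = 0"
    by (rule integral_weighted_eq_0_if_char_real[where c = c and X = X]) (use bR cR int in auto)
  \<comment> \<open>The real case admits vector valued integrands, so the imaginary unit can be
    absorbed into \<open>g\<close>.\<close>
  have I: "(\<integral>x. Im (U x) *\<^sub>R (\<i> * complex_of_real (g (X x))) \<partial>M) = 0"
    by (rule integral_weighted_eq_0_if_char_real[where c = c and X = X and g = "\<lambda>y. \<i> * complex_of_real (g y)"]) (use bI cI int in auto)
  have iR: "integrable M (\<lambda>x. Re (U x) *\<^sub>R complex_of_real (g (X x)))"
    and iI: "integrable M (\<lambda>x. Im (U x) *\<^sub>R (\<i> * complex_of_real (g (X x))))"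
    by (rule Bochner_Integration.integrable_bound[of _ "\<lambda>x. c * \<bar>g (X x)\<bar>"];
        use int bR bI in \<open>auto simp: norm_mult abs_mult intro!: AE_I2 mult_right_mono intro: order_trans[OF _ abs_ge_self]\<close>)+
  have "(\<integral>x. U x * g (X x) \<partial>M)
      = (\<integral>x. Re (U x) *\<^sub>R complex_of_real (g (X x)) + Im (U x) *\<^sub>R (\<i> * complex_of_real (g (X x))) \<partial>M)"
    by (rule Bochner_Integration.integral_cong) (auto simp: complex_eq_iff)
  also have "\<dots> = 0" using R I iR iI by simp
  finally show ?thesis .
qed

text \<open>No uniqueness theorem in several dimensions is needed: the factors \<open>iexp (r * X i x)\<close> are replaced by
indicators of events one coordinate at a time.\<close>

lemma (in prob_space) integral_eq_0_on_generated:
  fixes X :: "'i \<Rightarrow> 'a \<Rightarrow> real" and \<xi> :: "'a \<Rightarrow> complex"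
  assumes Y: "lin_set Y" "Y \<subseteq> borel_measurable M" and X: "\<And>i. i \<in> I \<Longrightarrow> X i \<in> Y"
    and \<xi> [measurable]: "\<xi> \<in> borel_measurable M" and bd: "\<And>x. norm (\<xi> x) \<le> c"
    and char: "\<And>y. y \<in> Y \<Longrightarrow> (\<integral>x. iexp (y x) * \<xi> x \<partial>M) = 0"
    and A: "A \<in> sigma_sets (space M) {X i -` B \<inter> space M |i B. i \<in> I \<and> B \<in> sets borel}"
  shows "(\<integral>x. \<xi> x * indicator A x \<partial>M) = 0"
proof -
  define G where "G = {X i -` B \<inter> space M |i B. i \<in> I \<and> B \<in> sets (borel :: real measure)}"
  have YM [measurable]: "y \<in> Y \<Longrightarrow> y \<in> borel_measurable M" for y using Y by auto
  have GM: "G \<subseteq> sets M" using YM[OF X] by (auto simp: G_def)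
  \<comment> \<open>\<open>y\<close> stays arbitrary in the induction: the factor
    \<open>iexp (r * X i x)\<close> belonging to a new event is absorbed into \<open>y\<close> by
    linearity of \<open>Y\<close>.\<close>
  have fin: "(\<integral>x. iexp (y x) * (\<xi> x * (\<Prod>E\<in>F. indicator E x)) \<partial>M) = 0"
    if "finite F" "F \<subseteq> G" "y \<in> Y" for F y
    using that
  proof (induction F arbitrary: y rule: finite_induct)
    case empty then show ?case using char by simp
  next
    case (insert E F)
    note [measurable] = YM[OF insert.prems(2)]
    from insert.prems obtain i B where E: "E = X i -` B \<inter> space M" "i \<in> I" and B [measurable]: "B \<in> sets borel"
      by (auto simp: G_def)
    have [measurable]: "X i \<in> borel_measurable M" using X E YM by auto
    have F [measurable]: "\<And>E'. E' \<in> F \<Longrightarrow> E' \<in> sets M" using insert.prems GM by auto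
    define U where "U = (\<lambda>x. iexp (y x) * (\<xi> x * (\<Prod>E\<in>F. indicator E x)))"
    have [measurable]: "U \<in> borel_measurable M" unfolding U_def by measurable
    have bU: "norm (U x) \<le> c" for x
    proof -
      have "norm (\<Prod>E\<in>F. indicator E x :: complex) \<le> 1"
        unfolding prod_norm[symmetric] by (intro prod_le_1) (auto simp: indicator_def)
      then have "norm (\<xi> x) * norm (\<Prod>E\<in>F. indicator E x :: complex) \<le> norm (\<xi> x) * 1"
        by (intro mult_left_mono) auto
      then show ?thesis using bd[of x] by (simp add: U_def norm_mult)
    qed
    have "(\<integral>x. iexp (r * X i x) * U x \<partial>M) = 0" for r
    proof -
      have yi: "(\<lambda>x. 1 * y x + r * X i x) \<in> Y" by (intro lin_setD Y insert.prems X E)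
      have "(\<integral>x. iexp (r * X i x) * U x \<partial>M)
          = (\<integral>x. iexp (1 * y x + r * X i x) * (\<xi> x * (\<Prod>E\<in>F. indicator E x)) \<partial>M)"
        by (rule Bochner_Integration.integral_cong) (simp_all add: U_def exp_add algebra_simps)
      also have "\<dots> = 0" using insert.prems by (intro insert.IH yi) auto
      finally show ?thesis .
    qed
    note cU = this
    have "(\<integral>x. U x * complex_of_real (indicator B (X i x)) \<partial>M) = 0"
    proof (rule integral_weighted_eq_0_if_char[of "X i" U c "indicator B", OF _ _ bU cU])
      show "integrable M (\<lambda>x. indicator B (X i x) :: real)"
        by (rule integrable_const_bound[of _ 1]) (auto simp: indicator_def)
    qed simp_all
    moreover have "(\<integral>x. U x * complex_of_real (indicator B (X i x)) \<partial>M)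
        = (\<integral>x. iexp (y x) * (\<xi> x * (\<Prod>E\<in>insert E F. indicator E x)) \<partial>M)"
      using insert.hyps by (intro Bochner_Integration.integral_cong) (auto simp: U_def E indicator_def)
    ultimately show ?case by simp
  qed
  \<comment> \<open>A generating system stable under intersection. Empty families are excluded
    because their intersection is \<open>UNIV\<close> and not the space.\<close>
  define PP where "PP = {\<Inter>F |F. finite F \<and> F \<noteq> {} \<and> F \<subseteq> G}"
  have fin': "(\<integral>x. \<xi> x * indicator E x \<partial>M) = 0" if "E \<in> PP" for E
  proof -
    from that obtain F where F: "finite F" "F \<noteq> {}" "F \<subseteq> G" "E = \<Inter>F" by (auto simp: PP_def)
    have "(\<lambda>x. 0) \<in> Y" using Y by (simp add: lin_set_def)
    from fin[OF F(1,3) this] have "(\<integral>x. \<xi> x * (\<Prod>E\<in>F. indicator E x) \<partial>M) = 0" by simp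
    moreover have "(\<Prod>E\<in>F. indicator E x :: complex) = indicator E x" for x
      using F(1) by (cases "x \<in> E") (auto simp: F(4) indicator_def intro!: prod.neutral)
    ultimately show ?thesis by simp
  qed
  have A': "A \<in> sigma_sets (space M) G" using A by (simp add: G_def)
  have GP: "G \<subseteq> PP"
  proof
    fix E assume "E \<in> G" then show "E \<in> PP" unfolding PP_def by (intro CollectI exI[of _ "{E}"]) auto
  qed
  have PM: "PP \<subseteq> sets M"
  proof
    fix E assume "E \<in> PP"
    then obtain F where "finite F" "F \<noteq> {}" "F \<subseteq> G" "E = \<Inter>F" by (auto simp: PP_def)
    then show "E \<in> sets M" using GM sets.finite_INT[of F "\<lambda>x. x" M] by auto
  qed
  have AP: "A \<in> sigma_sets (space M) PP"
    using A' sigma_sets_mono'[OF GP] by blast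
  have PI: "Int_stable PP"
  proof (rule Int_stableI)
    fix a b assume "a \<in> PP" "b \<in> PP"
    then obtain F F' where "finite F" "F \<noteq> {}" "F \<subseteq> G" "a = \<Inter>F" "finite F'" "F' \<noteq> {}" "F' \<subseteq> G" "b = \<Inter>F'"
      by (auto simp: PP_def)
    then show "a \<inter> b \<in> PP" unfolding PP_def by (intro CollectI exI[of _ "F \<union> F'"]) auto
  qed
  have "PP \<subseteq> Pow (space M)" using PM sets.space_closed by blast
  from PI this AP show ?thesis
  proof (induction rule: sigma_sets_induct_disjoint)
    case (basic A)
    then show ?case by (rule fin')
  next
    case empty
    then show ?case by simp
  next
    case (compl A)
    have [measurable]: "A \<in> sets M" using compl(1) PM sets.sigma_sets_subset by blast
    have 0: "(\<lambda>x. 0) \<in> Y" using Y by (simp add: lin_set_def)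
    have "(\<integral>x. \<xi> x * indicator (space M - A) x \<partial>M) = (\<integral>x. \<xi> x - \<xi> x * indicator A x \<partial>M)"
      by (rule Bochner_Integration.integral_cong) (auto simp: indicator_def)
    also have "\<dots> = (\<integral>x. \<xi> x \<partial>M) - (\<integral>x. \<xi> x * indicator A x \<partial>M)"
      by (rule Bochner_Integration.integral_diff; rule integrable_const_bound[of _ c])
        (use bd in \<open>auto simp: norm_mult indicator_def intro: order_trans[OF norm_ge_zero]\<close>)
    finally show ?case using compl char[OF 0] by simp
  next
    case (union A)
    have [measurable]: "A i \<in> sets M" for i using union(2) PM sets.sigma_sets_subset by blast
    have c0: "0 \<le> c" using bd order_trans norm_ge_zero by blast
    \<comment> \<open>Countable additivity for a complex weight: dominated convergence along the
      finite unions, with the bound on \<xi> as majorant.\<close>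
    have "(\<lambda>i. \<integral>x. \<xi> x * indicator (\<Union>j<i. A j) x \<partial>M) \<longlonglongrightarrow> (\<integral>x. \<xi> x * indicator (\<Union>i. A i) x \<partial>M)"
    proof (rule integral_dominated_convergence[where w = "\<lambda>_. c"])
      show "AE x in M. (\<lambda>i. \<xi> x * indicator (\<Union>j<i. A j) x) \<longlonglongrightarrow> \<xi> x * indicator (\<Union>i. A i) x"
        by (intro AE_I2 tendsto_intros LIMSEQ_indicator_UN)
      show "AE x in M. norm (\<xi> x * indicator (\<Union>j<i. A j) x) \<le> c" for i
        using bd c0 by (auto simp: norm_mult indicator_def)
    qed simp_all
    moreover have "(\<integral>x. \<xi> x * indicator (\<Union>j<i. A j) x \<partial>M) = 0" for i
    proof -
      have d: "disjoint_family_on A {..<i}" using union(1) by (auto simp: disjoint_family_on_def)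
      have "(\<integral>x. \<xi> x * indicator (\<Union>j<i. A j) x \<partial>M) = (\<integral>x. (\<Sum>j<i. \<xi> x * indicator (A j) x) \<partial>M)"
        by (rule Bochner_Integration.integral_cong) (simp_all add: indicator_UN_disjoint[OF _ d] sum_distrib_left)
      also have "\<dots> = (\<Sum>j<i. \<integral>x. \<xi> x * indicator (A j) x \<partial>M)"
        by (rule Bochner_Integration.integral_sum; rule integrable_const_bound[of _ c])
          (use bd c0 in \<open>auto simp: norm_mult indicator_def\<close>)
      also have "\<dots> = 0" using union(3) by simp
      finally show ?thesis .
    qed
    ultimately show ?case by (simp add: LIMSEQ_const_iff)
  qed
qed

section \<open>Gaussian spaces\<close>

text \<open>Centred Gaussian variables are encoded by the characteristic function at 1; linearity of
  \<open>L\<close> supplies every other argument. The formula admits variance 0 and is continuous in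
  the L2 norm, unlike a condition on densities.\<close>

definition gaussian_space :: "'a measure \<Rightarrow> ('a \<Rightarrow> real) set \<Rightarrow> bool" where
  "gaussian_space M L \<longleftrightarrow> L \<subseteq> L2 M \<and> lin_set L \<and>
     (\<forall>Y\<in>L. (\<integral>x. iexp (Y x) \<partial>M) = complex_of_real (exp (- (nrm M Y)\<^sup>2 / 2)))"

lemma gaussian_space_L2: "gaussian_space M L \<Longrightarrow> Y \<in> L \<Longrightarrow> Y \<in> L2 M"
  unfolding gaussian_space_def by blast

lemma gaussian_space_lin: "gaussian_space M L \<Longrightarrow> lin_set L"
  unfolding gaussian_space_def by (elim conjE)

lemma gaussian_space_char:
  assumes "gaussian_space M L" "Y \<in> L"
  shows "(\<integral>x. iexp (r * Y x) \<partial>M) = complex_of_real (exp (- r\<^sup>2 * (nrm M Y)\<^sup>2 / 2))"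
proof -
  have "(\<lambda>x. r * Y x) \<in> L" by (rule lin_set_scale[OF gaussian_space_lin[OF assms(1)] assms(2)])
  moreover have "\<forall>Y\<in>L. (\<integral>x. iexp (Y x) \<partial>M) = complex_of_real (exp (- (nrm M Y)\<^sup>2 / 2))"
    using assms(1) unfolding gaussian_space_def by (elim conjE)
  ultimately have "(\<integral>x. iexp (r * Y x) \<partial>M) = complex_of_real (exp (- (nrm M (\<lambda>x. r * Y x))\<^sup>2 / 2))"
    by (rule bspec[rotated])
  then show ?thesis by (simp add: nrm_scale power_mult_distrib)
qed

context prob_space
begin

lemma gaussian_space_normal:
  assumes L: "gaussian_space M L" "Y \<in> L" and pos: "nrm M Y > 0"
  shows "distributed M lborel Y (\<lambda>x. ennreal (normal_density 0 (nrm M Y) x))"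
proof -
  define \<sigma> where "\<sigma> = nrm M Y"
  have s: "\<sigma> > 0" using pos by (simp add: \<sigma>_def)
  note [measurable] = L2_meas[OF gaussian_space_L2[OF L]]
  define Z where "Z = (\<lambda>x. Y x / \<sigma>)"
  have Z [measurable]: "Z \<in> borel_measurable M" by (simp add: Z_def)
  have "distr M borel Z = std_normal_distribution"
  proof (rule Levy_uniqueness)
    show "real_distribution (distr M borel Z)" by (rule real_distribution_distr[OF Z])
    show "real_distribution std_normal_distribution" by (rule real_dist_normal_dist)
    show "char (distr M borel Z) = char std_normal_distribution"
    proof
      fix r
      have "char (distr M borel Z) r = (\<integral>x. iexp (r * Z x) \<partial>M)"
        unfolding char_def by (rule integral_distr) simp_all
      also have "\<dots> = (\<integral>x. iexp ((r / \<sigma>) * Y x) \<partial>M)" by (simp add: Z_def)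
      also have "\<dots> = complex_of_real (exp (- (r / \<sigma>)\<^sup>2 * (nrm M Y)\<^sup>2 / 2))"
        by (rule gaussian_space_char[OF L])
      also have "- (r / \<sigma>)\<^sup>2 * (nrm M Y)\<^sup>2 / 2 = - (r\<^sup>2) / 2"
        using s by (simp add: power_divide flip: \<sigma>_def)
      finally show "char (distr M borel Z) r = char std_normal_distribution r"
        unfolding char_std_normal_distribution by simp
    qed
  qed
  then have "distributed M lborel Z (\<lambda>x. ennreal (std_normal_density x))"
    unfolding distributed_def
    by (auto cong: distr_cong simp: distr_cong[OF refl sets_lborel refl])
  from normal_density_affine[OF this, of \<sigma> 0] s
  have "distributed M lborel (\<lambda>x. \<sigma> * Z x) (\<lambda>x. ennreal (normal_density 0 \<sigma> x))" by simp
  moreover have "(\<lambda>x. \<sigma> * Z x) = Y" using s by (simp add: Z_def)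
  ultimately show ?thesis by (simp add: \<sigma>_def)
qed

lemma gaussian_space_gaussian_rv:
  assumes L: "gaussian_space M L" "Y \<in> L"
  shows "gaussian_rv M Y"
proof (cases "nrm M Y = 0")
  case True
  then show ?thesis
    using nrm_eq_0_AE[OF gaussian_space_L2[OF L]] L2_meas[OF gaussian_space_L2[OF L]]
    unfolding gaussian_rv_def by blast
next
  case False
  then have "nrm M Y > 0" using nrm_nonneg[of M Y] by linarith
  then show ?thesis
    using gaussian_space_normal[OF L] L2_meas[OF gaussian_space_L2[OF L]]
    unfolding gaussian_rv_def by blast
qed

lemma gaussian_space_mean:
  assumes L: "gaussian_space M L" "Y \<in> L"
  shows "(\<integral>x. Y x \<partial>M) = 0"
proof (cases "nrm M Y = 0")
  case True
  have "(\<integral>x. Y x \<partial>M) = (\<integral>x. 0 \<partial>M)"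
    by (rule integral_cong_AE)
      (use nrm_eq_0_AE[OF gaussian_space_L2[OF L] True] L2_meas[OF gaussian_space_L2[OF L]] in auto)
  then show ?thesis by simp
next
  case False
  then have pos: "nrm M Y > 0" using nrm_nonneg[of M Y] by linarith
  show ?thesis
    by (rule normal_distributed_expectation[OF pos gaussian_space_normal[OF L pos]])
qed

lemma gaussian_space_mgf:
  assumes L: "gaussian_space M L" "Y \<in> L"
  shows "integrable M (\<lambda>x. exp (a * Y x))"
    and "(\<integral>x. exp (a * Y x) \<partial>M) = exp (a\<^sup>2 * (nrm M Y)\<^sup>2 / 2)"
proof -
  note [measurable] = L2_meas[OF gaussian_space_L2[OF L]]
  have "integrable M (\<lambda>x. exp (a * Y x)) \<and> (\<integral>x. exp (a * Y x) \<partial>M) = exp (a\<^sup>2 * (nrm M Y)\<^sup>2 / 2)"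
  proof (cases "nrm M Y = 0")
    case True
    have AE: "AE x in M. exp (a * Y x) = 1"
      using nrm_eq_0_AE[OF gaussian_space_L2[OF L] True] by eventually_elim simp
    have "integrable M (\<lambda>x. exp (a * Y x)) \<longleftrightarrow> integrable M (\<lambda>x. 1::real)"
      by (rule integrable_cong_AE) (use AE in auto)
    moreover have "(\<integral>x. exp (a * Y x) \<partial>M) = (\<integral>x. 1 \<partial>M)"
      by (rule integral_cong_AE) (use AE in auto)
    ultimately show ?thesis using True by (simp add: prob_space)
  next
    case False
    define \<sigma> where "\<sigma> = nrm M Y"
    have s: "\<sigma> > 0" using False nrm_nonneg[of M Y] unfolding \<sigma>_def by linarith
    have D: "distributed M lborel Y (\<lambda>x. ennreal (normal_density 0 \<sigma> x))"
      unfolding \<sigma>_def by (rule gaussian_space_normal[OF L]) (use s \<sigma>_def in simp)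
    \<comment> \<open>Completing the square: the exponential tilt moves the mean from 0 to a
      \<sigma>^2, so the integral is a constant times the total mass of another normal
      density.\<close>
    have eq: "normal_density 0 \<sigma> x * exp (a * x) = exp (a\<^sup>2 * \<sigma>\<^sup>2 / 2) * normal_density (a * \<sigma>\<^sup>2) \<sigma> x" for x
    proof -
      have "- (x - 0)\<^sup>2 / (2 * \<sigma>\<^sup>2) + a * x = a\<^sup>2 * \<sigma>\<^sup>2 / 2 + - (x - a * \<sigma>\<^sup>2)\<^sup>2 / (2 * \<sigma>\<^sup>2)"
        using s by (simp add: field_simps power2_eq_square)
      then have "exp (- (x - 0)\<^sup>2 / (2 * \<sigma>\<^sup>2)) * exp (a * x) = exp (a\<^sup>2 * \<sigma>\<^sup>2 / 2) * exp (- (x - a * \<sigma>\<^sup>2)\<^sup>2 / (2 * \<sigma>\<^sup>2))"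
        by (simp only: exp_add[symmetric])
      then show ?thesis unfolding normal_density_def by (simp add: field_simps)
    qed
    have "integrable M (\<lambda>x. exp (a * Y x)) \<longleftrightarrow> integrable lborel (\<lambda>x. normal_density 0 \<sigma> x * exp (a * x))"
      by (rule distributed_integrable[OF D, symmetric]) auto
    moreover have "(\<integral>x. normal_density 0 \<sigma> x * exp (a * x) \<partial>lborel) = (\<integral>x. exp (a * Y x) \<partial>M)"
      by (rule distributed_integral[OF D]) auto
    ultimately show ?thesis
      using s unfolding eq by (simp add: integrable_normal_density integral_normal_density \<sigma>_def[symmetric])
  qed
  then show "integrable M (\<lambda>x. exp (a * Y x))"
    and "(\<integral>x. exp (a * Y x) \<partial>M) = exp (a\<^sup>2 * (nrm M Y)\<^sup>2 / 2)" by auto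
qed

text \<open>Both sides of the defining identity are continuous in L2: the right side through the
  norm, the characteristic function because it is Lipschitz for the L1 distance.\<close>

lemma gaussian_space_closure:
  assumes L: "gaussian_space M L"
  shows "gaussian_space M (L2_closure M L)"
proof -
  have LL: "L \<subseteq> L2 M" "lin_set L" using L by (auto simp: gaussian_space_def)
  have "(\<integral>x. iexp (Y x) \<partial>M) = complex_of_real (exp (- (nrm M Y)\<^sup>2 / 2))" if Y: "Y \<in> L2_closure M L" for Y
  proof -
    note YL = L2_closure_L2[OF Y]
    note [measurable] = L2_meas[OF YL]
    have "\<exists>V\<in>L. nrm M (\<lambda>x. Y x - V x) < 1 / Suc n" for n
      by (rule L2_closureD[OF Y]) simp
    then obtain V where V: "\<And>n. V n \<in> L" "\<And>n. nrm M (\<lambda>x. Y x - V n x) < 1 / Suc n" by metis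
    have VL: "V n \<in> L2 M" for n using V LL by auto
    note [measurable] = L2_meas[OF VL]
    have lim0: "(\<lambda>n. 1 / real (Suc n)) \<longlonglongrightarrow> 0" by (rule LIMSEQ_Suc[OF lim_1_over_n])
    have "(\<lambda>n. nrm M (V n) - nrm M Y) \<longlonglongrightarrow> 0"
    proof (rule Lim_null_comparison[OF _ lim0], rule always_eventually, rule allI)
      fix n show "norm (nrm M (V n) - nrm M Y) \<le> 1 / real (Suc n)"
        using nrm_diff_abs[OF YL VL, of n] V(2)[of n] by (simp add: abs_minus_commute)
    qed
    then have nl: "(\<lambda>n. nrm M (V n)) \<longlonglongrightarrow> nrm M Y" by (rule LIM_zero_cancel)
    have cint: "complex_integrable M (\<lambda>x. iexp (Z x))" if "Z \<in> borel_measurable M" for Z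
      by (rule integrable_const_bound[of _ 1]) (use that in auto)
    have "(\<lambda>n. (\<integral>x. iexp (V n x) \<partial>M) - (\<integral>x. iexp (Y x) \<partial>M)) \<longlonglongrightarrow> 0"
    proof (rule Lim_null_comparison[OF _ lim0], rule always_eventually, rule allI)
      fix n
      have "norm ((\<integral>x. iexp (V n x) \<partial>M) - (\<integral>x. iexp (Y x) \<partial>M)) = norm (\<integral>x. iexp (V n x) - iexp (Y x) \<partial>M)"
        by (subst Bochner_Integration.integral_diff) (auto intro!: cint)
      also have "\<dots> \<le> (\<integral>x. norm (iexp (V n x) - iexp (Y x)) \<partial>M)"
        by (rule integral_norm_bound)
      also have "\<dots> \<le> (\<integral>x. \<bar>Y x - V n x\<bar> \<partial>M)"
      proof (rule integral_mono)
        show "integrable M (\<lambda>x. norm (iexp (V n x) - iexp (Y x)))"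
          by (intro integrable_norm Bochner_Integration.integrable_diff cint) auto
        show "integrable M (\<lambda>x. \<bar>Y x - V n x\<bar>)"
          using L2_integrable[OF L2_diff[OF YL VL[of n]]] by simp
        show "norm (iexp (V n x) - iexp (Y x)) \<le> \<bar>Y x - V n x\<bar>" for x
          using norm_iexp_diff_le[of "V n x" "Y x"] by (simp add: abs_minus_commute)
      qed
      also have "\<dots> \<le> nrm M (\<lambda>x. Y x - V n x)"
        using L2_abs_integral_le[OF L2_diff[OF YL VL[of n]]] by (simp add: prob_space)
      finally show "norm ((\<integral>x. iexp (V n x) \<partial>M) - (\<integral>x. iexp (Y x) \<partial>M)) \<le> 1 / real (Suc n)"
        using V(2)[of n] by simp
    qed
    then have l1: "(\<lambda>n. \<integral>x. iexp (V n x) \<partial>M) \<longlonglongrightarrow> (\<integral>x. iexp (Y x) \<partial>M)" by (rule LIM_zero_cancel)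
    have "(\<integral>x. iexp (V n x) \<partial>M) = complex_of_real (exp (- (nrm M (V n))\<^sup>2 / 2))" for n
      using gaussian_space_char[OF L V(1), of 1 n] by simp
    moreover have "(\<lambda>n. complex_of_real (exp (- (nrm M (V n))\<^sup>2 / 2))) \<longlonglongrightarrow> complex_of_real (exp (- (nrm M Y)\<^sup>2 / 2))"
      by (intro tendsto_intros nl) simp
    ultimately show ?thesis using l1 LIMSEQ_unique by fastforce
  qed
  moreover have "L2_closure M L \<subseteq> L2 M" using L2_closure_L2 by blast
  ultimately show ?thesis
    unfolding gaussian_space_def using lin_set_L2_closure[OF LL] by (intro conjI ballI)
qed

text \<open>In a Gaussian space orthogonality gives independence. For y orthogonal to Z the
  variances of y and r Z add, so \<open>iexp (y x)\<close> is uncorrelated with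
  \<open>iexp (r * Z x) - c\<close>. \<open>integral_eq_0_on_generated\<close> passes from these y
  to events, and uniqueness of characteristic functions passes from exponentials of Z to arbitrary
  \<open>g\<close>.\<close>

lemma gaussian_space_indep:
  fixes X :: "'i \<Rightarrow> 'a \<Rightarrow> real" and g :: "real \<Rightarrow> real"
  assumes L: "gaussian_space M L" and Z: "Z \<in> L" and X: "\<And>i. i \<in> I \<Longrightarrow> X i \<in> L"
    and orth: "\<And>i. i \<in> I \<Longrightarrow> (\<integral>x. Z x * X i x \<partial>M) = 0"
    and A: "A \<in> sigma_sets (space M) {X i -` B \<inter> space M |i B. i \<in> I \<and> B \<in> sets borel}"
    and g [measurable]: "g \<in> borel_measurable borel" and int: "integrable M (\<lambda>x. g (Z x))"
  shows "(\<integral>x. indicator A x * g (Z x) \<partial>M) = prob A * (\<integral>x. g (Z x) \<partial>M)"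
proof -
  note L2 = gaussian_space_L2[OF L]
  note ZL = L2[OF Z]
  note [measurable] = L2_meas[OF ZL]
  have AM [measurable]: "A \<in> sets M"
  proof -
    have "{X i -` B \<inter> space M |i B. i \<in> I \<and> B \<in> sets (borel :: real measure)} \<subseteq> sets M"
      using L2_meas[OF L2[OF X]] by auto
    then show ?thesis using A sets.sigma_sets_subset by blast
  qed
  \<comment> \<open>The orthogonal complement of \<open>Z\<close> in \<open>L\<close> is a linear
    set containing all \<open>X i\<close>, as the passage to generated events demands.\<close>
  define Y where "Y = {y \<in> L. (\<integral>x. Z x * y x \<partial>M) = 0}"
  have YL: "Y \<subseteq> L" by (auto simp: Y_def)
  have linY: "lin_set Y"
    unfolding lin_set_def
  proof (intro conjI ballI allI)
    show "(\<lambda>x. 0) \<in> Y" using lin_set_zero[OF gaussian_space_lin[OF L]] by (simp add: Y_def)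
    fix f h a b assume f: "f \<in> Y" and h: "h \<in> Y"
    have fL: "f \<in> L" and hL: "h \<in> L" using f h YL by auto
    have "(\<integral>x. Z x * (a * f x + b * h x) \<partial>M) = (\<integral>x. a * (Z x * f x) + b * (Z x * h x) \<partial>M)"
      by (simp add: algebra_simps)
    also have "\<dots> = a * (\<integral>x. Z x * f x \<partial>M) + b * (\<integral>x. Z x * h x \<partial>M)"
      using L2_mult_integrable[OF ZL L2[OF fL]] L2_mult_integrable[OF ZL L2[OF hL]] by simp
    also have "\<dots> = 0" using f h by (simp add: Y_def)
    finally have "(\<integral>x. Z x * (a * f x + b * h x) \<partial>M) = 0" .
    moreover have "(\<lambda>x. a * f x + b * h x) \<in> L" by (rule lin_setD[OF gaussian_space_lin[OF L] fL hL])
    ultimately show "(\<lambda>x. a * f x + b * h x) \<in> Y" by (simp add: Y_def)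
  qed
  have YM: "Y \<subseteq> borel_measurable M" using YL L2_meas[OF L2] by blast
  have ci: "complex_integrable M (\<lambda>x. iexp (V x))" if "V \<in> borel_measurable M" for V
    by (rule integrable_const_bound[of _ 1]) (use that in auto)
  have ch: "(\<integral>x. iexp (r * Z x) * indicator A x \<partial>M) = (\<integral>x. iexp (r * Z x) \<partial>M) * prob A" for r
  proof -
    define c where "c = (\<integral>x. iexp (r * Z x) \<partial>M)"
    have "(\<integral>x. (iexp (r * Z x) - c) * indicator A x \<partial>M) = 0"
    proof (rule integral_eq_0_on_generated[OF linY YM _ _ _ _ A, where c = "1 + norm c"])
      show "X i \<in> Y" if "i \<in> I" for i using that X orth by (simp add: Y_def)
      show "norm (iexp (r * Z x) - c) \<le> 1 + norm c" for x
        using norm_triangle_ineq4[of "iexp (r * Z x)" c] by simp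
      fix y assume y: "y \<in> Y"
      then have yL: "y \<in> L" using YL by auto
      note [measurable] = L2_meas[OF L2[OF yL]]
      have "(\<integral>x. iexp (y x) * (iexp (r * Z x) - c) \<partial>M)
          = (\<integral>x. iexp (1 * y x + r * Z x) - c * iexp (y x) \<partial>M)"
        by (rule Bochner_Integration.integral_cong) (simp_all add: exp_add algebra_simps)
      also have "\<dots> = (\<integral>x. iexp (1 * y x + r * Z x) \<partial>M) - c * (\<integral>x. iexp (y x) \<partial>M)"
        by (subst Bochner_Integration.integral_diff) (auto intro!: ci integrable_mult_right simp del: of_real_add of_real_mult)
      also have "(\<integral>x. iexp (1 * y x + r * Z x) \<partial>M) = exp (- (nrm M (\<lambda>x. 1 * y x + r * Z x))\<^sup>2 / 2)"
        using gaussian_space_char[OF L lin_setD[OF gaussian_space_lin[OF L] yL Z], of 1 1 r] by simp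
      also have "(nrm M (\<lambda>x. 1 * y x + r * Z x))\<^sup>2 = (nrm M y)\<^sup>2 + r\<^sup>2 * (nrm M Z)\<^sup>2"
        using y unfolding nrm_sq integral_sq_lin[OF L2[OF yL] ZL] by (simp add: Y_def mult.commute)
      also have "(\<integral>x. iexp (y x) \<partial>M) = exp (- (nrm M y)\<^sup>2 / 2)"
        using gaussian_space_char[OF L yL, of 1] by simp
      finally have "(\<integral>x. iexp (y x) * (iexp (r * Z x) - c) \<partial>M)
          = exp (- ((nrm M y)\<^sup>2 + r\<^sup>2 * (nrm M Z)\<^sup>2) / 2) - c * exp (- (nrm M y)\<^sup>2 / 2)" .
      moreover have "c = exp (- r\<^sup>2 * (nrm M Z)\<^sup>2 / 2)" unfolding c_def by (rule gaussian_space_char[OF L Z])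
      then have "c * exp (- (nrm M y)\<^sup>2 / 2)
          = exp (- r\<^sup>2 * (nrm M Z)\<^sup>2 / 2 + - (nrm M y)\<^sup>2 / 2)"
        unfolding exp_add by (simp only: of_real_mult)
      moreover have "- r\<^sup>2 * (nrm M Z)\<^sup>2 / 2 + - (nrm M y)\<^sup>2 / 2 = - ((nrm M y)\<^sup>2 + r\<^sup>2 * (nrm M Z)\<^sup>2) / 2"
        by (simp add: field_simps)
      ultimately show "(\<integral>x. iexp (y x) * (iexp (r * Z x) - c) \<partial>M) = 0"
        by (simp only: diff_self)
    qed (use Y_def in auto)
    moreover have "(\<integral>x. (iexp (r * Z x) - c) * indicator A x \<partial>M)
        = (\<integral>x. iexp (r * Z x) * indicator A x - c * indicator A x \<partial>M)"
      by (simp add: algebra_simps)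
    moreover have "\<dots> = (\<integral>x. iexp (r * Z x) * indicator A x \<partial>M) - (\<integral>x. c * indicator A x \<partial>M)"
      by (rule Bochner_Integration.integral_diff; rule integrable_const_bound[of _ "1 + norm c"])
        (auto simp: norm_mult indicator_def)
    moreover have "(\<integral>x. c * indicator A x \<partial>M) = c * prob A"
    proof -
      have "(\<integral>x. c * indicator A x \<partial>M) = (\<integral>x. c * complex_of_real (indicator A x) \<partial>M)"
        by (rule Bochner_Integration.integral_cong) (auto simp: indicator_def)
      also have "\<dots> = c * complex_of_real (\<integral>x. indicator A x \<partial>M)" by (simp del: of_real_indicator)
      finally show ?thesis by simp
    qed
    ultimately show ?thesis by (simp add: c_def)
  qed
  \<comment> \<open>Now the centred indicator of \<open>A\<close> is the weight and \<open>Z\<close>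
    the variable. In this form \<open>g\<close> may be unbounded, as the identity, the square and
    the exponentials used later are.\<close>
  have "(\<integral>x. (indicator A x - prob A) *\<^sub>R g (Z x) \<partial>M) = 0"
  proof (rule integral_weighted_eq_0_if_char_real[where X = Z and c = 2])
    show "\<bar>indicator A x - prob A\<bar> \<le> 2" for x
    proof -
      have "0 \<le> indicat_real A x" "indicat_real A x \<le> 1" by (auto simp: indicator_def)
      then show ?thesis using prob_le_1[of A] measure_nonneg[of M A] by linarith
    qed
    fix r
    have "(\<integral>x. iexp (r * Z x) * complex_of_real (indicator A x - prob A) \<partial>M)
        = (\<integral>x. iexp (r * Z x) * indicator A x - iexp (r * Z x) * prob A \<partial>M)"
      by (rule Bochner_Integration.integral_cong) (auto simp: indicator_def algebra_simps)
    also have "\<dots> = (\<integral>x. iexp (r * Z x) * indicator A x \<partial>M) - (\<integral>x. iexp (r * Z x) * prob A \<partial>M)"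
      by (rule Bochner_Integration.integral_diff; rule integrable_const_bound[of _ 1])
        (auto simp: norm_mult indicator_def)
    also have "\<dots> = 0" using ch[of r] by simp
    finally show "(\<integral>x. iexp (r * Z x) * complex_of_real (indicator A x - prob A) \<partial>M) = 0" .
  qed (use int in auto)
  moreover have "(\<integral>x. (indicator A x - prob A) *\<^sub>R g (Z x) \<partial>M)
      = (\<integral>x. indicator A x * g (Z x) - prob A * g (Z x) \<partial>M)"
    by (simp add: algebra_simps)
  moreover have "\<dots> = (\<integral>x. indicator A x * g (Z x) \<partial>M) - (\<integral>x. prob A * g (Z x) \<partial>M)"
    by (rule Bochner_Integration.integral_diff) (use int integrable_real_mult_indicator[OF AM int] in \<open>auto simp: mult.commute\<close>)
  ultimately show ?thesis by simp
qed

lemma real_cond_exp_gaussian_indep: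
  fixes X :: "real \<Rightarrow> 'a \<Rightarrow> real" and g :: "real \<Rightarrow> real"
  assumes L: "gaussian_space M L" and Z: "Z \<in> L" and X: "\<And>i. i \<in> {0..t} \<Longrightarrow> X i \<in> L"
    and orth: "\<And>i. i \<in> {0..t} \<Longrightarrow> (\<integral>x. Z x * X i x \<partial>M) = 0"
    and sub: "subalgebra M (nat_filtr M X t)"
    and g [measurable]: "g \<in> borel_measurable borel" and int: "integrable M (\<lambda>x. g (Z x))"
  shows "AE x in M. real_cond_exp M (nat_filtr M X t) (\<lambda>x. g (Z x)) x = (\<integral>x. g (Z x) \<partial>M)"
proof -
  interpret F: finite_measure_subalgebra M "nat_filtr M X t" by unfold_locales (rule sub)
  show ?thesis
  proof (rule F.real_cond_exp_charact[OF _ int])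
    fix A assume A: "A \<in> sets (nat_filtr M X t)"
    have gen: "{X s -` B \<inter> space M |s B. s \<in> {0..t} \<and> B \<in> sets (borel :: real measure)} \<subseteq> Pow (space M)"
      by auto
    have A': "A \<in> sigma_sets (space M) {X s -` B \<inter> space M |s B. s \<in> {0..t} \<and> B \<in> sets borel}"
      using A unfolding nat_filtr_def sets_measure_of[OF gen] .
    have "A \<in> sets M" using A sub by (auto simp: subalgebra_def)
    then show "(\<integral>x\<in>A. g (Z x) \<partial>M) = (\<integral>x\<in>A. (\<integral>x. g (Z x) \<partial>M) \<partial>M)"
      using gaussian_space_indep[OF L Z X orth A' g int]
      by (simp add: set_lebesgue_integral_def)
  qed auto
qed

end

section \<open>Filtering a Gaussian process\<close>

text \<open>The linear combination with coefficients \<open>c\<close> at the indices \<open>b\<close>, for a list of pairs \<open>(c, b)\<close>.\<close>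

fun lincomb :: "(real \<Rightarrow> real) \<Rightarrow> (real \<times> real) list \<Rightarrow> real" where
  "lincomb v [] = 0"
| "lincomb v ((c, b) # xs) = c * v b + lincomb v xs"

lemma lincomb_append: "lincomb v (xs @ ys) = lincomb v xs + lincomb v ys"
  by (induction xs) auto

lemma lincomb_scale: "lincomb v (map (\<lambda>(c, b). (a * c, b)) xs) = a * lincomb v xs"
  by (induction xs) (auto simp: algebra_simps)

text \<open>Lists allow one combination to be evaluated on several families: a Wiener process, the
  indicators \<open>upto_ind\<close>, the observation and the kernel. An isometry then compares two
  evaluations of the same list.\<close>

definition process_span :: "(real \<Rightarrow> 'a \<Rightarrow> real) \<Rightarrow> real set \<Rightarrow> ('a \<Rightarrow> real) set" where
  "process_span X I = {\<lambda>x. lincomb (\<lambda>b. X b x) xs | xs. snd ` set xs \<subseteq> I}"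

lemma process_spanI: "snd ` set xs \<subseteq> I \<Longrightarrow> (\<lambda>x. lincomb (\<lambda>b. X b x) xs) \<in> process_span X I"
  unfolding process_span_def by blast

lemma process_span_base: "i \<in> I \<Longrightarrow> X i \<in> process_span X I"
  using process_spanI[of "[(1, i)]" I X] by simp

lemma lin_set_process_span: "lin_set (process_span X I)"
  unfolding lin_set_def
proof (intro conjI ballI allI)
  show "(\<lambda>x. 0) \<in> process_span X I" using process_spanI[of "[]" I X] by simp
  fix f g a b assume "f \<in> process_span X I" "g \<in> process_span X I"
  then obtain xs ys where f: "f = (\<lambda>x. lincomb (\<lambda>b. X b x) xs)" "snd ` set xs \<subseteq> I"
    and g: "g = (\<lambda>x. lincomb (\<lambda>b. X b x) ys)" "snd ` set ys \<subseteq> I"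
    unfolding process_span_def by blast
  have "snd ` set (map (\<lambda>(c, i). (a * c, i)) xs @ map (\<lambda>(c, i). (b * c, i)) ys) \<subseteq> I"
    using f g by (auto simp: image_iff)
  from process_spanI[OF this, of X] show "(\<lambda>x. a * f x + b * g x) \<in> process_span X I"
    by (simp add: f g lincomb_append lincomb_scale)
qed

lemma process_span_subset:
  assumes "lin_set L" "\<And>i. i \<in> I \<Longrightarrow> X i \<in> L"
  shows "process_span X I \<subseteq> L"
proof
  fix f assume "f \<in> process_span X I"
  then obtain xs where f: "f = (\<lambda>x. lincomb (\<lambda>b. X b x) xs)" and xs: "snd ` set xs \<subseteq> I"
    unfolding process_span_def by blast
  from xs show "f \<in> L" unfolding f
  proof (induction xs)
    case Nil
    then show ?case using lin_set_zero[OF assms(1)] by simp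
  next
    case (Cons p xs)
    obtain c b where p: "p = (c, b)" by force
    have "(\<lambda>x. c * X b x + 1 * lincomb (\<lambda>b. X b x) xs) \<in> L"
      by (rule lin_setD[OF assms(1)]) (use Cons p assms(2) in auto)
    then show ?case by (simp add: p)
  qed
qed

lemma space_nat_filtr [simp]: "space (nat_filtr M X t) = space M"
  unfolding nat_filtr_def by (rule space_measure_of) auto

lemma sets_nat_filtr:
  "sets (nat_filtr M X t) = sigma_sets (space M) {X s -` B \<inter> space M |s B. s \<in> {0..t} \<and> B \<in> sets borel}"
  unfolding nat_filtr_def by (rule sets_measure_of) auto

lemma nat_filtr_measurable:
  assumes "s \<in> {0..t}" shows "X s \<in> borel_measurable (nat_filtr M X t)"
proof (rule measurableI)
  fix A :: "real set" assume "A \<in> sets borel"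
  then show "X s -` A \<inter> space (nat_filtr M X t) \<in> sets (nat_filtr M X t)"
    unfolding sets_nat_filtr space_nat_filtr using assms by (intro sigma_sets.Basic) blast
qed simp

lemma subalgebra_nat_filtr:
  assumes "\<And>s. s \<in> {0..t} \<Longrightarrow> X s \<in> borel_measurable M"
  shows "subalgebra M (nat_filtr M X t)"
  unfolding subalgebra_def sets_nat_filtr
  using assms by (auto intro!: sets.sigma_sets_subset simp del: atLeastAtMost_iff)

text \<open>Beyond Gaussianity only second order structure is assumed: \<open>X\<close> is the
  observation, \<open>S\<close> the signal, and future increments of the signal are uncorrelated
  with past observations. Closedness of \<open>L\<close> keeps projections inside the Gaussian
  space.\<close>

locale gaussian_filtering = prob_space M for M :: "'a measure" +
  fixes L :: "('a \<Rightarrow> real) set" and X S :: "real \<Rightarrow> 'a \<Rightarrow> real" and T :: real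
  assumes gauss: "gaussian_space M L" and closed: "L2_closure M L \<subseteq> L"
    and T_nonneg: "0 \<le> T"
    and X_in: "\<And>t. t \<in> {0..T} \<Longrightarrow> X t \<in> L" and S_in: "\<And>t. t \<in> {0..T} \<Longrightarrow> S t \<in> L"
    and orth: "\<And>r s t. 0 \<le> r \<Longrightarrow> r \<le> s \<Longrightarrow> s \<le> t \<Longrightarrow> t \<le> T \<Longrightarrow> (\<integral>x. (S t x - S s x) * X r x \<partial>M) = 0"
begin

section \<open>Conditional expectation as orthogonal projection\<close>

abbreviation F where "F \<equiv> nat_filtr M X"

definition N where "N t = real_cond_exp M (F t) (S t)"

abbreviation sp where "sp t \<equiv> process_span X {0..t}"

lemma lin_L: "lin_set L" by (rule gaussian_space_lin[OF gauss])

lemma L_L2: "Y \<in> L \<Longrightarrow> Y \<in> L2 M" by (rule gaussian_space_L2[OF gauss])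

lemma L_meas: "Y \<in> L \<Longrightarrow> Y \<in> borel_measurable M" by (rule L2_meas[OF L_L2])

lemma sub: "t \<le> T \<Longrightarrow> subalgebra M (F t)"
  by (rule subalgebra_nat_filtr) (use X_in L_meas in auto)

lemma fms: "t \<le> T \<Longrightarrow> finite_measure_subalgebra M (F t)"
  using sub by unfold_locales

lemma sp_L: "t \<le> T \<Longrightarrow> sp t \<subseteq> L"
  by (rule process_span_subset[OF lin_L]) (use X_in in auto)

lemma sp_L2: "t \<le> T \<Longrightarrow> sp t \<subseteq> L2 M"
  using sp_L L_L2 by blast

lemma clsp_L: "t \<le> T \<Longrightarrow> L2_closure M (sp t) \<subseteq> L"
  using L2_closure_mono[OF sp_L] closed by blast

lemma orth_clsp:
  assumes t: "t \<le> T" and Z: "Z \<in> L" and o: "\<And>r. r \<in> {0..t} \<Longrightarrow> (\<integral>x. Z x * X r x \<partial>M) = 0"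
    and V: "V \<in> L2_closure M (sp t)"
  shows "(\<integral>x. Z x * V x \<partial>M) = 0"
proof (rule L2_closure_orth[OF sp_L2[OF t] L_L2[OF Z] _ V])
  fix U assume "U \<in> sp t"
  then obtain xs where U: "U = (\<lambda>x. lincomb (\<lambda>b. X b x) xs)" and xs: "snd ` set xs \<subseteq> {0..t}"
    unfolding process_span_def by blast
  from xs have "integrable M (\<lambda>x. Z x * lincomb (\<lambda>b. X b x) xs) \<and> (\<integral>x. Z x * lincomb (\<lambda>b. X b x) xs \<partial>M) = 0"
  proof (induction xs)
    case Nil
    then show ?case by simp
  next
    case (Cons p xs)
    obtain c b where p: "p = (c, b)" by force
    have b: "b \<in> {0..t}" using Cons p by auto
    have e: "Z x * lincomb (\<lambda>b. X b x) (p # xs) = c * (Z x * X b x) + Z x * lincomb (\<lambda>b. X b x) xs" for x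
      by (simp add: p algebra_simps)
    have i: "integrable M (\<lambda>x. c * (Z x * X b x))"
      using L2_mult_integrable[OF L_L2[OF Z] L_L2[OF X_in]] b t by auto
    show ?case unfolding e using Cons i o[OF b] by simp
  qed
  then show "(\<integral>x. Z x * U x \<partial>M) = 0" by (simp add: U)
qed

lemma cond_exp_indep:
  assumes t: "t \<le> T" and Z: "Z \<in> L" and o: "\<And>r. r \<in> {0..t} \<Longrightarrow> (\<integral>x. Z x * X r x \<partial>M) = 0"
    and g: "g \<in> borel_measurable borel" and int: "integrable M (\<lambda>x. g (Z x))"
  shows "AE x in M. real_cond_exp M (F t) (\<lambda>x. g (Z x)) x = (\<integral>x. g (Z x) \<partial>M)"
  by (rule real_cond_exp_gaussian_indep[OF gauss Z _ o sub[OF t] g int]) (use X_in t in auto)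

lemma cond_exp_orth:
  assumes t: "t \<le> T" and Z: "Z \<in> L" and o: "\<And>r. r \<in> {0..t} \<Longrightarrow> (\<integral>x. Z x * X r x \<partial>M) = 0"
  shows "AE x in M. real_cond_exp M (F t) Z x = 0"
  using cond_exp_indep[OF t Z o, of "\<lambda>x. x"] L2_integrable[OF L_L2[OF Z]] gaussian_space_mean[OF gauss Z]
  by simp

text \<open>An element of the closure is in general only almost everywhere equal to an
  \<open>F t\<close> measurable function, so it cannot be treated as measurable directly. It is
  compared with an element V of the span, for which this is possible, and L1 contractivity of
  conditional expectation bounds the error by twice the norm of \<open>Y - V\<close>.\<close>

lemma cond_exp_closure:
  assumes t: "t \<le> T" and Y: "Y \<in> L2_closure M (sp t)"
  shows "AE x in M. real_cond_exp M (F t) Y x = Y x"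
proof -
  interpret F: finite_measure_subalgebra M "F t" by (rule fms[OF t])
  note YL = L2_closure_L2[OF Y]
  have iY: "integrable M Y" by (rule L2_integrable[OF YL])
  let ?E = "real_cond_exp M (F t)"
  have iE: "integrable M (?E Y)" using F.real_cond_exp_int(1)[OF iY] .
  have "(\<integral>x. \<bar>?E Y x - Y x\<bar> \<partial>M) \<le> 0 + e" if e: "e > 0" for e
  proof -
    obtain V where V: "V \<in> sp t" "nrm M (\<lambda>x. Y x - V x) < e / 2" using L2_closureD[OF Y, of "e/2"] e by auto
    have VL: "V \<in> L2 M" using sp_L2[OF t] V by auto
    have iV: "integrable M V" by (rule L2_integrable[OF VL])
    have Vm: "V \<in> borel_measurable (F t)"
    proof -
      obtain xs where V': "V = (\<lambda>x. lincomb (\<lambda>b. X b x) xs)" and xs: "snd ` set xs \<subseteq> {0..t}"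
        using V(1) unfolding process_span_def by blast
      from xs show ?thesis unfolding V'
      proof (induction xs)
        case (Cons p xs)
        obtain c b where p: "p = (c, b)" by force
        have [measurable]: "X b \<in> borel_measurable (F t)" by (rule nat_filtr_measurable) (use Cons p in auto)
        have [measurable]: "(\<lambda>x. lincomb (\<lambda>b. X b x) xs) \<in> borel_measurable (F t)" using Cons by auto
        show ?case unfolding p lincomb.simps by measurable
      qed simp
    qed
    define D where "D = (\<lambda>x. Y x - V x)"
    have DL: "D \<in> L2 M" unfolding D_def by (rule L2_diff[OF YL VL])
    have iD: "integrable M D" by (rule L2_integrable[OF DL])
    have iD': "integrable M (\<lambda>x. \<bar>D x\<bar>)" and iD'': "integrable M (\<lambda>x. - 1 * \<bar>D x\<bar>)" using iD by auto
    have ED: "AE x in M. ?E D x = ?E Y x - V x"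
      using F.real_cond_exp_diff[OF iY iV] F.real_cond_exp_F_meas[OF iV Vm] unfolding D_def
      by eventually_elim simp
    \<comment> \<open>Contractivity from monotonicity: \<open>D\<close> lies between its absolute
      value and the negative of it.\<close>
    have m1: "AE x in M. ?E D x \<le> ?E (\<lambda>x. \<bar>D x\<bar>) x"
      by (rule F.real_cond_exp_mono[OF _ iD iD']) auto
    have m2: "AE x in M. ?E (\<lambda>x. - 1 * \<bar>D x\<bar>) x \<le> ?E D x"
      by (rule F.real_cond_exp_mono[OF _ iD'' iD]) auto
    have "(\<integral>x. \<bar>?E Y x - Y x\<bar> \<partial>M) \<le> (\<integral>x. ?E (\<lambda>x. \<bar>D x\<bar>) x + \<bar>D x\<bar> \<partial>M)"
    proof (rule integral_mono_AE)
      show "integrable M (\<lambda>x. \<bar>?E Y x - Y x\<bar>)" using iE iY by simp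
      show "integrable M (\<lambda>x. ?E (\<lambda>x. \<bar>D x\<bar>) x + \<bar>D x\<bar>)"
        using F.real_cond_exp_int(1)[of "\<lambda>x. \<bar>D x\<bar>"] iD by simp
      show "AE x in M. \<bar>?E Y x - Y x\<bar> \<le> ?E (\<lambda>x. \<bar>D x\<bar>) x + \<bar>D x\<bar>"
        using ED m1 m2 F.real_cond_exp_cmult[OF iD', of "- 1"]
      proof eventually_elim
        case (elim x)
        have "?E Y x - Y x = ?E D x - D x" using elim(1) by (simp add: D_def)
        then show ?case using elim(2-4) by linarith
      qed
    qed
    also have "\<dots> = 2 * (\<integral>x. \<bar>D x\<bar> \<partial>M)"
      using F.real_cond_exp_int[of "\<lambda>x. \<bar>D x\<bar>"] iD by simp
    also have "\<dots> \<le> 2 * nrm M D" using L2_abs_integral_le[OF DL] by (simp add: prob_space)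
    finally show ?thesis using V(2) by (simp add: D_def)
  qed
  then have "(\<integral>x. \<bar>?E Y x - Y x\<bar> \<partial>M) \<le> 0" by (rule field_le_epsilon)
  moreover have "0 \<le> (\<integral>x. \<bar>?E Y x - Y x\<bar> \<partial>M)" by (rule integral_nonneg_AE) simp
  ultimately have "(\<integral>x. \<bar>?E Y x - Y x\<bar> \<partial>M) = 0" by simp
  then have "AE x in M. \<bar>?E Y x - Y x\<bar> = 0"
    by (subst integral_nonneg_eq_0_iff_AE[symmetric]) (use iE iY in auto)
  then show ?thesis by eventually_elim simp
qed

text \<open>The orthogonal residual \<open>S t - Y\<close> is independent of \<open>F t\<close> and
  has mean zero, so its conditional expectation vanishes. The criterion serves both the abstract
  projection and the integral against the observation, which is how the two are identified.\<close>

lemma N_unique: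
  assumes t: "t \<in> {0..T}" and Y: "Y \<in> L2_closure M (sp t)"
    and o: "\<And>r. r \<in> {0..t} \<Longrightarrow> (\<integral>x. (S t x - Y x) * X r x \<partial>M) = 0"
  shows "AE x in M. N t x = Y x"
proof -
  have tT: "t \<le> T" using t by simp
  interpret F: finite_measure_subalgebra M "F t" by (rule fms[OF tT])
  have YL: "Y \<in> L" using clsp_L[OF tT] Y by auto
  have ZL: "(\<lambda>x. S t x - Y x) \<in> L" by (rule lin_set_diff[OF lin_L S_in[OF t] YL])
  note i = L2_integrable[OF L_L2]
  have "AE x in M. real_cond_exp M (F t) (\<lambda>x. S t x - Y x) x = 0"
    by (rule cond_exp_orth[OF tT ZL o])
  then show ?thesis
    using cond_exp_closure[OF tT Y] F.real_cond_exp_diff[OF i[OF S_in[OF t]] i[OF YL]]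
    by eventually_elim (simp add: N_def)
qed

lemma N_ex:
  assumes t: "t \<in> {0..T}"
  shows "\<exists>Y\<in>L2_closure M (sp t). (\<forall>V\<in>sp t. (\<integral>x. (S t x - Y x) * V x \<partial>M) = 0) \<and> (AE x in M. N t x = Y x)"
proof -
  have tT: "t \<le> T" using t by simp
  obtain Y where Y: "Y \<in> L2_closure M (sp t)" "\<And>V. V \<in> sp t \<Longrightarrow> (\<integral>x. (S t x - Y x) * V x \<partial>M) = 0"
    using L2_projection[OF sp_L2[OF tT] lin_set_process_span L_L2[OF S_in[OF t]]] by blast
  have "AE x in M. N t x = Y x"
    by (rule N_unique[OF t Y(1)]) (intro Y(2) process_span_base)
  with Y show ?thesis by blast
qed

lemma N_meas: "N t \<in> borel_measurable M" "N t \<in> borel_measurable (F t)"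
  by (simp_all add: N_def)

text \<open>Membership in the closure depends on the almost everywhere class and on measurability,
  so it passes from the projection to the version chosen by \<open>real_cond_exp\<close>.\<close>

lemma N_closure:
  assumes t: "t \<in> {0..T}" shows "N t \<in> L2_closure M (sp t)"
proof -
  have tT: "t \<le> T" using t by simp
  obtain Y where Y: "Y \<in> L2_closure M (sp t)" "AE x in M. N t x = Y x" using N_ex[OF t] by blast
  note YL = L2_closure_L2[OF Y(1)]
  have NL: "N t \<in> L2 M"
    by (rule L2_cong_AE[OF _ YL N_meas(1)]) (use Y(2) in eventually_elim, simp)
  have "nrm M (\<lambda>x. N t x - g x) = nrm M (\<lambda>x. Y x - g x)" if "g \<in> sp t" for g
    by (rule nrm_cong_AE) (use Y N_meas L2_meas[OF YL] L2_meas sp_L2[OF tT] that in auto)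
  then have "\<exists>g\<in>sp t. nrm M (\<lambda>x. N t x - g x) < e" if "e > 0" for e
    using L2_closureD[OF Y(1) that] by (metis (no_types, lifting))
  then show ?thesis using NL by (simp add: L2_closure_def)
qed

lemma N_in: "t \<in> {0..T} \<Longrightarrow> N t \<in> L"
  using clsp_L[of t] N_closure[of t] by auto

lemma N_orth_X:
  assumes t: "t \<in> {0..T}" and r: "r \<in> {0..t}" shows "(\<integral>x. (S t x - N t x) * X r x \<partial>M) = 0"
proof -
  obtain Y where Y: "Y \<in> L2_closure M (sp t)" "\<And>V. V \<in> sp t \<Longrightarrow> (\<integral>x. (S t x - Y x) * V x \<partial>M) = 0" "AE x in M. N t x = Y x" using N_ex[OF t] by blast
  have "(\<integral>x. (S t x - N t x) * X r x \<partial>M) = (\<integral>x. (S t x - Y x) * X r x \<partial>M)"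
    using Y(3) L_meas[OF N_in[OF t]] L_meas[OF S_in[OF t]] L2_meas[OF L2_closure_L2[OF Y(1)]] L_meas[OF X_in[of r]] r t
    by (intro integral_cong_AE) auto
  also have "\<dots> = 0" by (intro Y(2) process_span_base r)
  finally show ?thesis .
qed

lemma N_orth:
  assumes t: "t \<in> {0..T}" and V: "V \<in> L2_closure M (sp t)"
  shows "(\<integral>x. (S t x - N t x) * V x \<partial>M) = 0"
  by (rule orth_clsp[OF _ _ _ V]) (use t N_orth_X lin_set_diff[OF lin_L S_in N_in] in auto)

text \<open>The increment is that of the signal, minus the residual at t, plus the residual at s;
  each of the three is orthogonal to \<open>X r\<close> when r is at most s.\<close>

lemma N_incr_orth_X:
  assumes s: "0 \<le> s" "s \<le> t" "t \<le> T" and r: "r \<in> {0..s}"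
  shows "(\<integral>x. (N t x - N s x) * X r x \<partial>M) = 0"
proof -
  have m: "s \<in> {0..T}" "t \<in> {0..T}" "r \<in> {0..t}" "r \<in> {0..T}" using s r by auto
  note i = L2_mult_integrable[OF L_L2 L_L2[OF X_in[OF m(4)]]]
  note d = lin_set_diff[OF lin_L]
  have "(\<integral>x. (N t x - N s x) * X r x \<partial>M)
      = (\<integral>x. (S t x - S s x) * X r x - (S t x - N t x) * X r x + (S s x - N s x) * X r x \<partial>M)"
    by (simp add: algebra_simps)
  also have "\<dots> = (\<integral>x. (S t x - S s x) * X r x \<partial>M) - (\<integral>x. (S t x - N t x) * X r x \<partial>M) + (\<integral>x. (S s x - N s x) * X r x \<partial>M)"
    using i[OF d[OF S_in[OF m(2)] S_in[OF m(1)]]] i[OF d[OF S_in[OF m(2)] N_in[OF m(2)]]]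
      i[OF d[OF S_in[OF m(1)] N_in[OF m(1)]]]
    by (simp only: Bochner_Integration.integral_add Bochner_Integration.integral_diff Bochner_Integration.integrable_diff)
  also have "\<dots> = 0"
    using orth[of r s t] N_orth_X[OF m(2,3)] N_orth_X[OF m(1) r] s r by simp
  finally show ?thesis .
qed

section \<open>Martingale property, bracket and exponential moments\<close>

lemma N_incr_in: "s \<in> {0..T} \<Longrightarrow> t \<in> {0..T} \<Longrightarrow> (\<lambda>x. N t x - N s x) \<in> L"
  by (intro lin_set_diff lin_L N_in)

lemma N_cond_exp:
  assumes s: "0 \<le> s" "s \<le> t" "t \<le> T"
  shows "AE x in M. real_cond_exp M (F s) (N t) x = N s x"
proof -
  have m: "s \<in> {0..T}" "t \<in> {0..T}" using s by auto
  interpret F: finite_measure_subalgebra M "F s" by (rule fms) (use m in auto)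
  note i = L2_integrable[OF L_L2]
  have "AE x in M. real_cond_exp M (F s) (\<lambda>x. N t x - N s x) x = 0"
    by (rule cond_exp_orth[OF _ N_incr_in[OF m]]) (use m N_incr_orth_X[OF s] in auto)
  moreover have "AE x in M. real_cond_exp M (F s) (N s) x = N s x"
    by (rule F.real_cond_exp_F_meas[OF i[OF N_in[OF m(1)]] N_meas(2)])
  ultimately show ?thesis
    using F.real_cond_exp_diff[OF i[OF N_in[OF m(2)]] i[OF N_in[OF m(1)]]] by eventually_elim simp
qed

text \<open>Pythagoras for the orthogonal increment. It yields the monotonicity of the bracket and
  the constant in the conditional second moment.\<close>

lemma N_sq_incr:
  assumes s: "0 \<le> s" "s \<le> t" "t \<le> T"
  shows "(\<integral>x. (N t x)\<^sup>2 \<partial>M) = (\<integral>x. (N s x)\<^sup>2 \<partial>M) + (\<integral>x. (N t x - N s x)\<^sup>2 \<partial>M)"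
proof -
  have m: "s \<in> {0..T}" "t \<in> {0..T}" using s by auto
  have o: "(\<integral>x. (N t x - N s x) * N s x \<partial>M) = 0"
    by (rule orth_clsp[OF _ N_incr_in[OF m] _ N_closure[OF m(1)]]) (use m N_incr_orth_X[OF s] in auto)
  show ?thesis
    using integral_sq_lin[OF L_L2[OF N_incr_in[OF m]] L_L2[OF N_in[OF m(1)]], of 1 1] o by simp
qed

text \<open>With \<open>D\<close> the increment, the square of \<open>N t\<close> expands into
  \<open>D\<^sup>2 + 2 * N s * D + (N s)\<^sup>2\<close>. Independence makes the conditional
  expectation of the first term deterministic, orthogonality makes that of the second zero. The
  square is therefore compensated by the nonrandom second moment, and together with
  \<open>N_sq_mono\<close> this is how the bracket is expressed.\<close>

lemma N_sq_cond_exp: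
  assumes s: "0 \<le> s" "s \<le> t" "t \<le> T"
  shows "AE x in M. real_cond_exp M (F s) (\<lambda>x. (N t x)\<^sup>2 - (\<integral>y. (N t y)\<^sup>2 \<partial>M)) x = (N s x)\<^sup>2 - (\<integral>y. (N s y)\<^sup>2 \<partial>M)"
proof -
  have m: "s \<in> {0..T}" "t \<in> {0..T}" using s by auto
  interpret F: finite_measure_subalgebra M "F s" by (rule fms) (use m in auto)
  note i = L2_integrable[OF L_L2]
  let ?E = "real_cond_exp M (F s)"
  define D where "D = (\<lambda>x. N t x - N s x)"
  have DL: "D \<in> L" unfolding D_def by (rule N_incr_in[OF m])
  have o: "(\<integral>x. D x * X r x \<partial>M) = 0" if "r \<in> {0..s}" for r
    unfolding D_def by (rule N_incr_orth_X[OF s that])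
  have iD2: "integrable M (\<lambda>x. (D x)\<^sup>2)" by (rule L2_sq_integrable[OF L_L2[OF DL]])
  have iND: "integrable M (\<lambda>x. N s x * D x)" by (rule L2_mult_integrable[OF L_L2[OF N_in[OF m(1)]] L_L2[OF DL]])
  define G where "G = (\<lambda>x. (N s x)\<^sup>2 - (\<integral>y. (N t y)\<^sup>2 \<partial>M))"
  have iG: "integrable M G" unfolding G_def using L2_sq_integrable[OF L_L2[OF N_in[OF m(1)]]] by simp
  have Gm: "G \<in> borel_measurable (F s)" unfolding G_def using N_meas(2)[of s] by measurable
  have e1: "AE x in M. ?E (\<lambda>x. (D x)\<^sup>2) x = (\<integral>x. (D x)\<^sup>2 \<partial>M)"
    by (rule cond_exp_indep[OF _ DL o, of s "\<lambda>x. x\<^sup>2"]) (use m iD2 in auto)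
  have e2: "AE x in M. ?E (\<lambda>x. N s x * D x) x = N s x * ?E D x"
    by (rule F.real_cond_exp_mult[OF N_meas(2) L_meas[OF DL] iND])
  have e3: "AE x in M. ?E D x = 0" by (rule cond_exp_orth[OF _ DL o]) (use m in auto)
  have e4: "AE x in M. ?E G x = G x" by (rule F.real_cond_exp_F_meas[OF iG Gm])
  have e5: "AE x in M. ?E (\<lambda>x. 2 * (N s x * D x)) x = 2 * ?E (\<lambda>x. N s x * D x) x"
    by (rule F.real_cond_exp_cmult[OF iND])
  have i2: "integrable M (\<lambda>x. 2 * (N s x * D x))" using iND by simp
  have i3: "integrable M (\<lambda>x. 2 * (N s x * D x) + G x)" using i2 iG by simp
  have e6: "AE x in M. ?E (\<lambda>x. 2 * (N s x * D x) + G x) x = ?E (\<lambda>x. 2 * (N s x * D x)) x + ?E G x"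
    by (rule F.real_cond_exp_add[OF i2 iG])
  have e7: "AE x in M. ?E (\<lambda>x. (D x)\<^sup>2 + (2 * (N s x * D x) + G x)) x
      = ?E (\<lambda>x. (D x)\<^sup>2) x + ?E (\<lambda>x. 2 * (N s x * D x) + G x) x"
    by (rule F.real_cond_exp_add[OF iD2 i3])
  have eq: "(\<lambda>x. (N t x)\<^sup>2 - (\<integral>y. (N t y)\<^sup>2 \<partial>M)) = (\<lambda>x. (D x)\<^sup>2 + (2 * (N s x * D x) + G x))"
    by (auto simp: D_def G_def power2_eq_square algebra_simps)
  show ?thesis unfolding eq
    using e1 e2 e3 e4 e5 e6 e7 by eventually_elim (simp add: G_def D_def N_sq_incr[OF s])
qed

lemma N_martingale: "sq_int_martingale_on M F N T"
  unfolding sq_int_martingale_on_def martingale_on_def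
  using N_meas N_cond_exp L2_integrable[OF L_L2[OF N_in]] L2_sq_integrable[OF L_L2[OF N_in]]
  by auto

lemma N_gaussian: "gaussian_process_on M N {0..T}"
  unfolding gaussian_process_on_def
proof (intro allI impI)
  fix n :: nat and \<tau> c :: "nat \<Rightarrow> real" assume \<tau>: "\<forall>i<n. \<tau> i \<in> {0..T}"
  show "gaussian_rv M (\<lambda>\<omega>. \<Sum>i<n. c i * N (\<tau> i) \<omega>)"
    by (rule gaussian_space_gaussian_rv[OF gauss], rule lin_set_sum[OF lin_L]) (use \<tau> N_in in auto)
qed

lemma N_sq_mono: "mono_on {0..T} (\<lambda>t. integral\<^sup>L M (\<lambda>\<omega>. (N t \<omega>)\<^sup>2))"
proof (rule mono_onI)
  fix r s assume "r \<in> {0..T}" "s \<in> {0..T}" "r \<le> s"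
  then show "integral\<^sup>L M (\<lambda>\<omega>. (N r \<omega>)\<^sup>2) \<le> integral\<^sup>L M (\<lambda>\<omega>. (N s \<omega>)\<^sup>2)"
    using N_sq_incr[of r s] integral_nonneg_AE[of "\<lambda>x. (N s x - N r x)\<^sup>2" M] by auto
qed

lemma N_sq_martingale: "martingale_on M F (\<lambda>t \<omega>. (N t \<omega>)\<^sup>2 - integral\<^sup>L M (\<lambda>\<omega>'. (N t \<omega>')\<^sup>2)) T"
  unfolding martingale_on_def
  using N_meas N_sq_cond_exp L2_sq_integrable[OF L_L2[OF N_in]]
  by auto

text \<open>The residual is orthogonal to \<open>N t\<close> itself. The variance thus becomes an
  inner product with the signal, which the Wiener isometry can compute.\<close>

lemma N_sq_eq:
  assumes t: "t \<in> {0..T}"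
  shows "(\<integral>x. (N t x)\<^sup>2 \<partial>M) = (\<integral>x. N t x * S t x \<partial>M)"
proof -
  have "0 = (\<integral>x. (S t x - N t x) * N t x \<partial>M)" using N_orth[OF t N_closure[OF t]] by simp
  also have "\<dots> = (\<integral>x. N t x * S t x - (N t x)\<^sup>2 \<partial>M)" by (simp add: algebra_simps power2_eq_square)
  also have "\<dots> = (\<integral>x. N t x * S t x \<partial>M) - (\<integral>x. (N t x)\<^sup>2 \<partial>M)"
    by (rule Bochner_Integration.integral_diff[OF L2_mult_integrable[OF L_L2[OF N_in[OF t]] L_L2[OF S_in[OF t]]] L2_sq_integrable[OF L_L2[OF N_in[OF t]]]])
  finally show ?thesis by simp
qed

text \<open>If \<open>N t\<close> vanished, the signal would be its own residual and hence
  orthogonal to \<open>X t\<close>.\<close>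

lemma N_sq_pos:
  assumes t: "t \<in> {0..T}" and n: "(\<integral>x. S t x * X t x \<partial>M) \<noteq> 0"
  shows "(\<integral>x. (N t x)\<^sup>2 \<partial>M) > 0"
proof -
  have False if z: "nrm M (N t) = 0"
  proof -
    have AE: "AE x in M. N t x = 0" by (rule nrm_eq_0_AE[OF L_L2[OF N_in[OF t]] z])
    have "(\<integral>x. S t x * X t x \<partial>M) = (\<integral>x. (S t x - N t x) * X t x \<partial>M)"
      using AE L_meas[OF N_in[OF t]] L_meas[OF S_in[OF t]] L_meas[OF X_in[OF t]]
      by (intro integral_cong_AE) auto
    also have "\<dots> = 0" using N_orth_X[OF t, of t] t by simp
    finally show False using n by simp
  qed
  then have "nrm M (N t) \<noteq> 0" by blast
  then have "nrm M (N t) > 0" using nrm_nonneg[of M "N t"] by linarith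
  then have "(nrm M (N t))\<^sup>2 > 0" by simp
  then show ?thesis unfolding nrm_sq .
qed

text \<open>The signal splits into \<open>N t\<close>, which is \<open>F t\<close> measurable, and a
  residual independent of \<open>F t\<close> whose variance is the difference of the two variances;
  the exponential moment of the residual is a constant factor.\<close>

lemma cond_exp_exp:
  assumes t: "t \<in> {0..T}"
  shows "AE x in M. real_cond_exp M (F t) (\<lambda>x. exp (a * S t x)) x
    = exp (a * N t x + a\<^sup>2 / 2 * ((\<integral>x. (S t x)\<^sup>2 \<partial>M) - (\<integral>x. (N t x)\<^sup>2 \<partial>M)))"
proof -
  have tT: "t \<le> T" using t by simp
  interpret F: finite_measure_subalgebra M "F t" by (rule fms[OF tT])
  let ?E = "real_cond_exp M (F t)"
  define Z where "Z = (\<lambda>x. S t x - N t x)"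
  have ZL: "Z \<in> L" unfolding Z_def by (intro lin_set_diff lin_L S_in N_in t)
  have o: "(\<integral>x. Z x * X r x \<partial>M) = 0" if "r \<in> {0..t}" for r
    unfolding Z_def by (rule N_orth_X[OF t that])
  note [measurable] = L_meas[OF ZL] N_meas(2)[of t]
  have eq: "exp (a * S t x) = exp (a * N t x) * exp (a * Z x)" for x
    unfolding exp_add[symmetric] by (simp add: Z_def algebra_simps)
  have "integrable M (\<lambda>x. exp (a * S t x))" by (rule gaussian_space_mgf[OF gauss S_in[OF t]])
  then have i: "integrable M (\<lambda>x. exp (a * N t x) * exp (a * Z x))" unfolding eq .
  have iZ: "integrable M (\<lambda>x. exp (a * Z x))" by (rule gaussian_space_mgf[OF gauss ZL])
  have e1: "AE x in M. ?E (\<lambda>x. exp (a * N t x) * exp (a * Z x)) x = exp (a * N t x) * ?E (\<lambda>x. exp (a * Z x)) x"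
    by (rule F.real_cond_exp_mult[OF _ _ i]) measurable
  have e2: "AE x in M. ?E (\<lambda>x. exp (a * Z x)) x = (\<integral>x. exp (a * Z x) \<partial>M)"
    by (rule cond_exp_indep[OF tT ZL o, of "\<lambda>z. exp (a * z)"]) (use iZ in auto)
  have v: "(nrm M Z)\<^sup>2 = (\<integral>x. (S t x)\<^sup>2 \<partial>M) - (\<integral>x. (N t x)\<^sup>2 \<partial>M)"
    using integral_sq_lin[OF L_L2[OF S_in[OF t]] L_L2[OF N_in[OF t]], of 1 "-1"] N_sq_eq[OF t]
    by (simp add: nrm_sq Z_def mult.commute)
  define c where "c = (\<integral>x. exp (a * Z x) \<partial>M)"
  have c: "exp (a * N t x) * c = exp (a * N t x + a\<^sup>2 / 2 * ((\<integral>x. (S t x)\<^sup>2 \<partial>M) - (\<integral>x. (N t x)\<^sup>2 \<partial>M)))" for x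
    unfolding c_def gaussian_space_mgf(2)[OF gauss ZL] v exp_add by simp
  have eq': "(\<lambda>x. exp (a * S t x)) = (\<lambda>x. exp (a * N t x) * exp (a * Z x))"
    by (rule ext) (rule eq)
  have "AE x in M. ?E (\<lambda>x. exp (a * N t x) * exp (a * Z x)) x = exp (a * N t x) * c"
    using e1 e2[folded c_def] by eventually_elim (simp only:)
  then show ?thesis unfolding c eq' .
qed

end

section \<open>The Wiener process\<close>

lemma L2_lincomb:
  assumes "\<And>b. b \<in> I \<Longrightarrow> v b \<in> L2 M" "snd ` set xs \<subseteq> I"
  shows "(\<lambda>x. lincomb (\<lambda>b. v b x) xs) \<in> L2 M"
  using assms(2)
proof (induction xs)
  case (Cons p xs)
  obtain c b where p: "p = (c, b)" by force
  have "(\<lambda>x. c * v b x + 1 * lincomb (\<lambda>b. v b x) xs) \<in> L2 M"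
    by (rule L2_lin) (use Cons p assms(1) in auto)
  then show ?case by (simp add: p)
qed simp

lemma integral_lincomb_mult:
  assumes v: "\<And>b. b \<in> I \<Longrightarrow> v b \<in> L2 M" and xs: "snd ` set xs \<subseteq> I" and Y: "Y \<in> L2 M"
  shows "(\<integral>x. lincomb (\<lambda>b. v b x) xs * Y x \<partial>M) = lincomb (\<lambda>b. \<integral>x. v b x * Y x \<partial>M) xs"
  using xs
proof (induction xs)
  case (Cons p xs)
  obtain c b where p: "p = (c, b)" by force
  have b: "b \<in> I" and xs: "snd ` set xs \<subseteq> I" using Cons p by auto
  have "(\<integral>x. lincomb (\<lambda>b. v b x) (p # xs) * Y x \<partial>M)
      = (\<integral>x. c * (v b x * Y x) + lincomb (\<lambda>b. v b x) xs * Y x \<partial>M)"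
    by (simp add: p algebra_simps)
  also have "\<dots> = c * (\<integral>x. v b x * Y x \<partial>M) + (\<integral>x. lincomb (\<lambda>b. v b x) xs * Y x \<partial>M)"
    using L2_mult_integrable[OF v[OF b] Y] L2_mult_integrable[OF L2_lincomb[OF v xs] Y] by simp
  finally show ?case using Cons.IH[OF xs] by (simp add: p)
qed simp

lemma lincomb_cong: "(\<And>b. b \<in> I \<Longrightarrow> f b = g b) \<Longrightarrow> snd ` set xs \<subseteq> I \<Longrightarrow> lincomb f xs = lincomb g xs"
  by (induction xs) auto

text \<open>Inner products of combinations are determined by the Gram matrix of the generators.
  Families on different measure spaces with equal Gram matrices are therefore isometric; this is the
  source of the Wiener isometry.\<close>

lemma integral_lincomb_eq_if_gram_eq:
  assumes v: "\<And>b. b \<in> I \<Longrightarrow> v b \<in> L2 M" and u: "\<And>b. b \<in> I \<Longrightarrow> u b \<in> L2 K"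
    and gram: "\<And>b c. b \<in> I \<Longrightarrow> c \<in> I \<Longrightarrow> (\<integral>x. v b x * v c x \<partial>M) = (\<integral>x. u b x * u c x \<partial>K)"
    and xs: "snd ` set xs \<subseteq> I" and ys: "snd ` set ys \<subseteq> I"
  shows "(\<integral>x. lincomb (\<lambda>b. v b x) xs * lincomb (\<lambda>b. v b x) ys \<partial>M)
    = (\<integral>x. lincomb (\<lambda>b. u b x) xs * lincomb (\<lambda>b. u b x) ys \<partial>K)"
proof -
  have "(\<integral>x. v b x * lincomb (\<lambda>b. v b x) ys \<partial>M) = (\<integral>x. u b x * lincomb (\<lambda>b. u b x) ys \<partial>K)" if b: "b \<in> I" for b
  proof -
    have "(\<integral>x. v b x * lincomb (\<lambda>b. v b x) ys \<partial>M) = lincomb (\<lambda>c. \<integral>x. v c x * v b x \<partial>M) ys"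
      using integral_lincomb_mult[OF v ys v[OF b]] by (simp add: mult.commute)
    also have "\<dots> = lincomb (\<lambda>c. \<integral>x. u c x * u b x \<partial>K) ys"
      by (rule lincomb_cong[OF _ ys]) (rule gram[OF _ b])
    also have "\<dots> = (\<integral>x. u b x * lincomb (\<lambda>b. u b x) ys \<partial>K)"
      using integral_lincomb_mult[OF u ys u[OF b]] by (simp add: mult.commute)
    finally show ?thesis .
  qed
  note eq = this
  have "(\<integral>x. lincomb (\<lambda>b. v b x) xs * lincomb (\<lambda>b. v b x) ys \<partial>M)
      = lincomb (\<lambda>b. \<integral>x. v b x * lincomb (\<lambda>b. v b x) ys \<partial>M) xs"
    by (rule integral_lincomb_mult[OF v xs L2_lincomb[OF v ys]])
  also have "\<dots> = lincomb (\<lambda>b. \<integral>x. u b x * lincomb (\<lambda>b. u b x) ys \<partial>K) xs"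
    by (rule lincomb_cong[OF _ xs]) (rule eq)
  also have "\<dots> = (\<integral>x. lincomb (\<lambda>b. u b x) xs * lincomb (\<lambda>b. u b x) ys \<partial>K)"
    by (rule integral_lincomb_mult[OF u xs L2_lincomb[OF u ys], symmetric])
  finally show ?thesis .
qed

lemma nrm_lincomb_eq_if_gram_eq:
  assumes "\<And>b. b \<in> I \<Longrightarrow> v b \<in> L2 M" "\<And>b. b \<in> I \<Longrightarrow> u b \<in> L2 K"
    and "\<And>b c. b \<in> I \<Longrightarrow> c \<in> I \<Longrightarrow> (\<integral>x. v b x * v c x \<partial>M) = (\<integral>x. u b x * u c x \<partial>K)"
    and "snd ` set xs \<subseteq> I"
  shows "nrm M (\<lambda>x. lincomb (\<lambda>b. v b x) xs) = nrm K (\<lambda>x. lincomb (\<lambda>b. u b x) xs)"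
  using integral_lincomb_eq_if_gram_eq[OF assms assms(4)] by (simp add: nrm_def power2_eq_square)

text \<open>The partition is strict, so that the increments of a Wiener process along it are independent.\<close>

lemma lincomb_as_increments:
  assumes t: "0 \<le> t" and xs: "snd ` set xs \<subseteq> {0..t}"
  obtains n :: nat and \<tau> d :: "nat \<Rightarrow> real" where "\<tau> 0 = 0" "\<tau> n = t" "\<And>i. i < n \<Longrightarrow> \<tau> i < \<tau> (Suc i)"
    "\<And>v. v 0 = 0 \<Longrightarrow> lincomb v xs = (\<Sum>i<n. d i * (v (\<tau> (Suc i)) - v (\<tau> i)))"
proof -
  \<comment> \<open>Adding 0 and t makes the partition begin and end where an elementary integral
    over the interval does.\<close>
  define A where "A = insert 0 (insert t (snd ` set xs))"
  define l where "l = sorted_list_of_set A"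
  have fin: "finite A" by (simp add: A_def)
  have A: "A \<subseteq> {0..t}" "0 \<in> A" "t \<in> A" using xs t by (auto simp: A_def)
  have sl: "set l = A" and ssl: "sorted_wrt (<) l" using fin by (simp_all add: l_def)
  define n where "n = length l - 1"
  have ln: "length l = Suc n" using A(2) sl by (cases l) (auto simp: n_def)
  define \<tau> where "\<tau> = (\<lambda>i. l ! i)"
  have mono: "\<tau> i < \<tau> j" if "i < j" "j \<le> n" for i j
    using sorted_wrt_nth_less[OF ssl that(1)] that ln by (simp add: \<tau>_def)
  have lt_iff: "\<tau> i < \<tau> j \<longleftrightarrow> i < j" if "i \<le> n" "j \<le> n" for i j
    using mono[of i j] mono[of j i] that by (cases i j rule: linorder_cases) auto
  have ex: "\<exists>k\<le>n. b = \<tau> k" if "b \<in> A" for b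
    using that sl ln unfolding \<tau>_def by (metis in_set_conv_nth less_Suc_eq_le)
  have inA: "\<tau> i \<in> A" if "i \<le> n" for i using that sl ln by (auto simp: \<tau>_def)
  obtain k0 where k0: "k0 \<le> n" "0 = \<tau> k0" using ex A by blast
  have t0: "\<tau> 0 = 0"
  proof (cases "k0 = 0")
    case False
    then have "\<tau> 0 < 0" using mono[of 0 k0] k0 by auto
    then show ?thesis using inA[of 0] A by force
  qed (use k0 in simp)
  obtain k1 where k1: "k1 \<le> n" "t = \<tau> k1" using ex A by blast
  have tn: "\<tau> n = t"
  proof (cases "k1 = n")
    case False
    then have "t < \<tau> n" using mono[of k1 n] k1 by auto
    then show ?thesis using inA[of n] A by force
  qed (use k1 in simp)
  \<comment> \<open>Summation by parts: the coefficient of the increment after \<tau> i collects all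
    coefficients of \<open>xs\<close> whose index exceeds \<tau> i.\<close>
  define d where "d = (\<lambda>i. lincomb (\<lambda>b. if \<tau> i < b then 1 else 0) xs)"
  have single: "v b = (\<Sum>i<n. (if \<tau> i < b then 1 else 0) * (v (\<tau> (Suc i)) - v (\<tau> i)))" if b: "b \<in> A" and v: "v 0 = 0"
    for b and v :: "real \<Rightarrow> real"
  proof -
    obtain k where k: "k \<le> n" "b = \<tau> k" using ex[OF b] by blast
    have "(\<Sum>i<n. (if \<tau> i < b then 1 else 0) * (v (\<tau> (Suc i)) - v (\<tau> i)))
        = (\<Sum>i<k. (if \<tau> i < b then 1 else 0) * (v (\<tau> (Suc i)) - v (\<tau> i)))"
      by (rule sum.mono_neutral_right) (use k lt_iff in auto)
    also have "\<dots> = (\<Sum>i<k. v (\<tau> (Suc i)) - v (\<tau> i))"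
      by (rule sum.cong) (use k lt_iff in auto)
    also have "\<dots> = v b" by (simp add: sum_lessThan_telescope[of "\<lambda>i. v (\<tau> i)"] k t0 v)
    finally show ?thesis by simp
  qed
  have "lincomb v xs = (\<Sum>i<n. d i * (v (\<tau> (Suc i)) - v (\<tau> i)))" if v: "v 0 = 0" for v
  proof -
    have "snd ` set xs \<subseteq> A" by (auto simp: A_def)
    then show ?thesis unfolding d_def
    proof (induction xs)
      case (Cons p xs)
      obtain c b where p: "p = (c, b)" by force
      have b: "b \<in> A" using Cons p by auto
      have "c * v b = (\<Sum>i<n. c * (if \<tau> i < b then 1 else 0) * (v (\<tau> (Suc i)) - v (\<tau> i)))"
        by (subst single[OF b, of v, OF v]) (simp add: sum_distrib_left mult.assoc)
      then show ?case using Cons unfolding p lincomb.simps by (simp add: sum.distrib distrib_right)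
    qed simp
  qed
  with t0 tn mono show ?thesis using that[of \<tau> n d] by auto
qed

text \<open>Open at 0, so that index 0 gives the zero function, matching the start of a Wiener
  process, and the inner product of two such indicators is the Wiener covariance
  \<open>min b c\<close>.\<close>

abbreviation upto_ind :: "real \<Rightarrow> real \<Rightarrow> real" where "upto_ind b \<equiv> indicator {0<..b}"

lemma upto_ind_L2: "upto_ind b \<in> L2 lborel"
proof -
  have "(\<lambda>x. (upto_ind b x)\<^sup>2) = upto_ind b" by (auto simp: indicator_def)
  moreover have "integrable lborel (upto_ind b)"
    by (rule integrable_real_indicator, simp) (cases "0 \<le> b"; simp)
  ultimately show ?thesis by (simp add: L2_def)
qed

lemma upto_ind_inner: "0 \<le> b \<Longrightarrow> 0 \<le> c \<Longrightarrow> (\<integral>x. upto_ind b x * upto_ind c x \<partial>lborel) = min b c"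
proof -
  assume "0 \<le> b" "0 \<le> c"
  have "(\<lambda>x. upto_ind b x * upto_ind c x) = upto_ind (min b c)" by (auto simp: indicator_def)
  then show ?thesis using \<open>0 \<le> b\<close> \<open>0 \<le> c\<close> by simp
qed

context prob_space
begin

lemma centered_normal_moments:
  assumes s: "s > 0" and D: "distributed M lborel Y (\<lambda>x. ennreal (normal_density 0 s x))"
  shows "Y \<in> L2 M" "(\<integral>x. (Y x)\<^sup>2 \<partial>M) = s\<^sup>2" "(\<integral>x. Y x \<partial>M) = 0"
    "(\<integral>x. iexp (Y x) \<partial>M) = complex_of_real (exp (- (nrm M Y)\<^sup>2 / 2))"
proof -
  have Ym [measurable]: "Y \<in> borel_measurable M" using D by (auto simp: distributed_def)
  show m: "(\<integral>x. Y x \<partial>M) = 0" by (rule normal_distributed_expectation[OF s D])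
  show v: "(\<integral>x. (Y x)\<^sup>2 \<partial>M) = s\<^sup>2" using normal_distributed_variance[OF s D] m by simp
  have "integrable lborel (\<lambda>x. normal_density 0 s x * x\<^sup>2)"
    using integrable_normal_moment[OF s, of 0 2] by simp
  then have "integrable M (\<lambda>x. (Y x)\<^sup>2)"
    by (subst distributed_integrable[OF D, symmetric]) auto
  then show "Y \<in> L2 M" by (simp add: L2_def)
  have "distributed M lborel (\<lambda>x. (Y x - 0) / s) (\<lambda>x. ennreal (std_normal_density x))"
    using D normal_standard_normal_convert[OF s] by blast
  then have "distr M borel (\<lambda>x. Y x / s) = std_normal_distribution"
    unfolding distributed_def by (simp add: distr_cong[OF refl sets_lborel refl])
  then have "char (distr M borel (\<lambda>x. Y x / s)) s = complex_of_real (exp (- s\<^sup>2 / 2))"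
    by (simp add: char_std_normal_distribution)
  also have "char (distr M borel (\<lambda>x. Y x / s)) s = (\<integral>x. iexp (s * (Y x / s)) \<partial>M)"
    unfolding char_def by (rule integral_distr) simp_all
  finally show "(\<integral>x. iexp (Y x) \<partial>M) = complex_of_real (exp (- (nrm M Y)\<^sup>2 / 2))"
    using s by (simp add: nrm_sq v)
qed

context
  fixes W :: "real \<Rightarrow> 'a \<Rightarrow> real"
  assumes W: "wiener_process M W"
begin

lemma wiener_0: "\<omega> \<in> space M \<Longrightarrow> W 0 \<omega> = 0"
  using W by (auto simp: wiener_process_def)

lemma wiener_incr:
  assumes "0 \<le> s" "s < t"
  shows "(\<lambda>\<omega>. W t \<omega> - W s \<omega>) \<in> L2 M" "(\<integral>\<omega>. (W t \<omega> - W s \<omega>)\<^sup>2 \<partial>M) = t - s"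
    "distributed M lborel (\<lambda>\<omega>. W t \<omega> - W s \<omega>) (\<lambda>x. ennreal (normal_density 0 (sqrt (t - s)) x))"
proof -
  show D: "distributed M lborel (\<lambda>\<omega>. W t \<omega> - W s \<omega>) (\<lambda>x. ennreal (normal_density 0 (sqrt (t - s)) x))"
    using W assms by (auto simp: wiener_process_def)
  show "(\<lambda>\<omega>. W t \<omega> - W s \<omega>) \<in> L2 M" "(\<integral>\<omega>. (W t \<omega> - W s \<omega>)\<^sup>2 \<partial>M) = t - s"
    using centered_normal_moments(1,2)[OF _ D] assms by auto
qed

lemma wiener_L2: "0 \<le> t \<Longrightarrow> W t \<in> L2 M"
proof (cases "t = 0")
  case True
  have "W 0 \<in> borel_measurable M" using W by (auto simp: wiener_process_def)
  then have "W 0 \<in> L2 M" by (intro L2_cong_AE[OF _ L2_zero]) (auto simp: wiener_0)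
  then show ?thesis using True by simp
next
  case False
  assume "0 \<le> t"
  have "W t \<in> borel_measurable M" using W \<open>0 \<le> t\<close> by (auto simp: wiener_process_def)
  then show ?thesis
    using False \<open>0 \<le> t\<close> by (intro L2_cong_AE[OF _ wiener_incr(1)[of 0 t]]) (auto simp: wiener_0)
qed

lemma wiener_sq: "0 \<le> t \<Longrightarrow> (\<integral>\<omega>. (W t \<omega>)\<^sup>2 \<partial>M) = t"
proof -
  assume t: "0 \<le> t"
  have eq: "(\<integral>\<omega>. (W t \<omega>)\<^sup>2 \<partial>M) = (\<integral>\<omega>. (W t \<omega> - W 0 \<omega>)\<^sup>2 \<partial>M)"
    by (rule Bochner_Integration.integral_cong) (simp_all add: wiener_0)
  show ?thesis
  proof (cases "t = 0")
    case False
    then show ?thesis using eq wiener_incr(2)[of 0 t] t by simp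
  qed (use eq in simp)
qed

lemma wiener_cov:
  assumes "0 \<le> s" "0 \<le> t"
  shows "(\<integral>\<omega>. W s \<omega> * W t \<omega> \<partial>M) = min s t"
proof -
  have *: "(\<integral>\<omega>. W s \<omega> * W t \<omega> \<partial>M) = s" if "0 \<le> s" "s \<le> t" for s t
  proof (cases "s = t")
    case True
    then show ?thesis using wiener_sq[of t] that by (simp add: power2_eq_square)
  next
    case False
    then have "t - s = (\<integral>\<omega>. (1 * W t \<omega> + (-1) * W s \<omega>)\<^sup>2 \<partial>M)" using wiener_incr(2)[of s t] that by simp
    also have "\<dots> = t - 2 * (\<integral>\<omega>. W t \<omega> * W s \<omega> \<partial>M) + s"
      using that by (subst integral_sq_lin) (auto simp: wiener_L2 wiener_sq)
    finally show ?thesis by (simp add: mult.commute)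
  qed
  show ?thesis
    using *[of s t] *[of t s] assms by (cases "s \<le> t") (auto simp: mult.commute)
qed

text \<open>Over disjoint increments the combination is a sum of independent normal variables, hence
  normal with the variance given by its norm.\<close>

lemma wiener_lincomb_char:
  assumes xs: "snd ` set xs \<subseteq> {0..}"
  shows "(\<integral>\<omega>. iexp (lincomb (\<lambda>b. W b \<omega>) xs) \<partial>M)
    = complex_of_real (exp (- (nrm M (\<lambda>\<omega>. lincomb (\<lambda>b. W b \<omega>) xs))\<^sup>2 / 2))"
proof -
  define t where "t = Max (insert 0 (snd ` set xs))"
  have t: "0 \<le> t" by (simp add: t_def)
  have tx: "snd ` set xs \<subseteq> {0..t}"
  proof
    fix y assume "y \<in> snd ` set xs"
    then show "y \<in> {0..t}" using xs unfolding t_def by (auto simp only: atLeastAtMost_iff atLeast_iff subset_iff intro!: Max_ge)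
  qed
  obtain n \<tau> d where \<tau>: "\<tau> 0 = 0" "\<tau> n = t" "\<And>i. i < n \<Longrightarrow> \<tau> i < \<tau> (Suc i)"
    and eq: "\<And>v. v 0 = 0 \<Longrightarrow> lincomb v xs = (\<Sum>i<n. d i * (v (\<tau> (Suc i)) - v (\<tau> i)))"
    using lincomb_as_increments[OF t tx] by blast
  define Y where "Y = (\<lambda>\<omega>. lincomb (\<lambda>b. W b \<omega>) xs)"
  define D where "D = (\<lambda>i \<omega>. W (\<tau> (Suc i)) \<omega> - W (\<tau> i) \<omega>)"
  have YL: "Y \<in> L2 M" unfolding Y_def by (rule L2_lincomb[OF _ xs]) (simp add: wiener_L2)
  \<comment> \<open>Zero coefficients are removed because a normal density requires a positive
    standard deviation; if none is left, the combination is the constant 0.\<close>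
  define I where "I = {i. i < n \<and> d i \<noteq> 0}"
  have YS: "Y \<omega> = (\<Sum>i\<in>I. d i * D i \<omega>)" if "\<omega> \<in> space M" for \<omega>
  proof -
    have "Y \<omega> = (\<Sum>i<n. d i * D i \<omega>)" unfolding Y_def D_def
      by (rule eq) (rule wiener_0[OF that])
    also have "\<dots> = (\<Sum>i\<in>I. d i * D i \<omega>)"
      by (rule sum.mono_neutral_right) (auto simp: I_def)
    finally show ?thesis .
  qed
  have pos: "0 \<le> \<tau> i" if "i \<le> n" for i
    using that
  proof (induction i)
    case (Suc i)
    then show ?case using \<tau>(3)[of i] by simp
  qed (simp add: \<tau>)
  show ?thesis
  proof (cases "I = {}")
    case True
    have "(\<integral>\<omega>. iexp (Y \<omega>) \<partial>M) = (\<integral>\<omega>. 1 \<partial>M)"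
      by (rule Bochner_Integration.integral_cong) (use YS True in auto)
    moreover have "nrm M Y = nrm M (\<lambda>\<omega>. 0)"
      by (rule nrm_cong_AE) (use YS True L2_meas[OF YL] in auto)
    ultimately show ?thesis by (simp add: Y_def prob_space)
  next
    case False
    have "indep_vars (\<lambda>_. borel) D {..<n}"
      using W \<tau> unfolding wiener_process_def D_def by auto
    then have "indep_vars (\<lambda>_. borel) D I" by (rule indep_vars_subset) (auto simp: I_def)
    then have ind: "indep_vars (\<lambda>_. borel) (\<lambda>i \<omega>. d i * D i \<omega>) I"
      by (rule indep_vars_compose2[where Y = "\<lambda>i x. d i * x"]) simp
    define \<sigma> where "\<sigma> = (\<lambda>i. \<bar>d i\<bar> * sqrt (\<tau> (Suc i) - \<tau> i))"
    have \<sigma>: "\<sigma> i > 0" if "i \<in> I" for i using that \<tau>(3)[of i] by (auto simp: I_def \<sigma>_def)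
    have dist: "distributed M lborel (\<lambda>\<omega>. d i * D i \<omega>) (\<lambda>x. ennreal (normal_density 0 (\<sigma> i) x))" if i: "i \<in> I" for i
    proof -
      have "distributed M lborel (\<lambda>\<omega>. 0 + d i * (W (\<tau> (Suc i)) \<omega> - W (\<tau> i) \<omega>))
        (\<lambda>x. ennreal (normal_density (0 + d i * 0) (\<bar>d i\<bar> * sqrt (\<tau> (Suc i) - \<tau> i)) x))"
        by (rule normal_density_affine[OF wiener_incr(3)]) (use i \<tau>(3)[of i] pos[of i] in \<open>auto simp: I_def\<close>)
      then show ?thesis by (simp add: D_def \<sigma>_def)
    qed
    have s: "sqrt (\<Sum>i\<in>I. (\<sigma> i)\<^sup>2) > 0"
    proof -
      have "finite I" by (simp add: I_def)
      then have "0 < (\<Sum>i\<in>I. (\<sigma> i)\<^sup>2)" using False by (intro sum_pos zero_less_power \<sigma>)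
      then show ?thesis by simp
    qed
    have "distributed M lborel (\<lambda>\<omega>. \<Sum>i\<in>I. d i * D i \<omega>) (\<lambda>x. ennreal (normal_density (\<Sum>i\<in>I. 0) (sqrt (\<Sum>i\<in>I. (\<sigma> i)\<^sup>2)) x))"
      by (rule sum_indep_normal[OF _ False ind \<sigma> dist]) (simp_all add: I_def)
    then have "distributed M lborel (\<lambda>\<omega>. \<Sum>i\<in>I. d i * D i \<omega>) (\<lambda>x. ennreal (normal_density 0 (sqrt (\<Sum>i\<in>I. (\<sigma> i)\<^sup>2)) x))"
      by simp
    note m = centered_normal_moments(1,4)[OF s this]
    have "(\<integral>\<omega>. iexp (Y \<omega>) \<partial>M) = (\<integral>\<omega>. iexp (\<Sum>i\<in>I. d i * D i \<omega>) \<partial>M)"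
      by (rule Bochner_Integration.integral_cong) (simp_all add: YS)
    moreover have "nrm M Y = nrm M (\<lambda>\<omega>. \<Sum>i\<in>I. d i * D i \<omega>)"
      by (rule nrm_cong_AE) (use YS L2_meas[OF YL] L2_meas[OF m(1)] in auto)
    ultimately show ?thesis using m(2) by (simp add: Y_def)
  qed
qed

text \<open>The isometry for elementary integrands: both Gram matrices are
  \<open>min b c\<close>.\<close>

lemma wiener_nrm_lincomb:
  assumes "snd ` set xs \<subseteq> {0..}"
  shows "nrm M (\<lambda>\<omega>. lincomb (\<lambda>b. W b \<omega>) xs) = nrm lborel (\<lambda>s. lincomb (\<lambda>b. upto_ind b s) xs)"
  by (rule nrm_lincomb_eq_if_gram_eq[OF _ _ _ assms])
    (auto simp: wiener_L2 upto_ind_L2 wiener_cov upto_ind_inner)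

lemma wiener_mean: "0 \<le> t \<Longrightarrow> (\<integral>\<omega>. W t \<omega> \<partial>M) = 0"
proof -
  assume t: "0 \<le> t"
  have eq: "(\<integral>\<omega>. W t \<omega> \<partial>M) = (\<integral>\<omega>. W t \<omega> - W 0 \<omega> \<partial>M)"
    by (rule Bochner_Integration.integral_cong) (simp_all add: wiener_0)
  show ?thesis
  proof (cases "t = 0")
    case False
    then show ?thesis using eq centered_normal_moments(3)[OF _ wiener_incr(3)[of 0 t]] t by simp
  qed (use eq in simp)
qed

lemma wiener_lincomb_mean:
  assumes "snd ` set xs \<subseteq> {0..}"
  shows "(\<integral>\<omega>. lincomb (\<lambda>b. W b \<omega>) xs \<partial>M) = 0"
proof -
  have "(\<lambda>x. 1) \<in> L2 M" by (simp add: L2_def)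
  from integral_lincomb_mult[OF _ assms this, of W]
  have "(\<integral>\<omega>. lincomb (\<lambda>b. W b \<omega>) xs \<partial>M) = lincomb (\<lambda>b. \<integral>\<omega>. W b \<omega> \<partial>M) xs" by (simp add: wiener_L2)
  also have "\<dots> = lincomb (\<lambda>b. 0) xs" by (rule lincomb_cong[OF _ assms]) (simp add: wiener_mean)
  also have "\<dots> = 0" by (induction xs) auto
  finally show ?thesis .
qed

end

text \<open>A finite combination is a measurable functional of the whole path, so the independence
  of the two path maps descends to it.\<close>

lemma indep_wiener_lincomb:
  assumes ind: "indep_processes M V W"
    and xs: "snd ` set xs \<subseteq> {0..}" and ys: "snd ` set ys \<subseteq> {0..}"
  shows "indep_var borel (\<lambda>\<omega>. lincomb (\<lambda>b. V b \<omega>) xs) borel (\<lambda>\<omega>. lincomb (\<lambda>b. W b \<omega>) ys)"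
proof -
  have meas: "(\<lambda>f. lincomb f zs) \<in> borel_measurable (Pi\<^sub>M {0..} (\<lambda>_. borel))" if "snd ` set zs \<subseteq> {0..}" for zs
    using that
  proof (induction zs)
    case (Cons p zs)
    obtain c b where p: "p = (c, b)" by force
    have [measurable]: "(\<lambda>f. f b) \<in> borel_measurable (Pi\<^sub>M {0..} (\<lambda>_. borel :: real measure))"
      by (rule measurable_component_singleton) (use Cons p in auto)
    have [measurable]: "(\<lambda>f. lincomb f zs) \<in> borel_measurable (Pi\<^sub>M {0..} (\<lambda>_. borel))" using Cons by simp
    show ?case unfolding p lincomb.simps by measurable
  qed simp
  have e: "lincomb (\<lambda>t\<in>{0..}. U t \<omega>) zs = lincomb (\<lambda>b. U b \<omega>) zs" if "snd ` set zs \<subseteq> {0..}" for U :: "real \<Rightarrow> 'a \<Rightarrow> real" and \<omega> zs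
    by (rule lincomb_cong[OF _ that]) simp
  show ?thesis
    using indep_var_compose[OF ind[unfolded indep_processes_def] meas[OF xs] meas[OF ys]]
    by (simp add: comp_def e[OF xs] e[OF ys])
qed

text \<open>Independence factors the characteristic function and also kills the cross term, so the
  variances add and the exponents match.\<close>

lemma gaussian_space_two_wiener:
  assumes V: "wiener_process M V" and W: "wiener_process M W" and ind: "indep_processes M V W"
  shows "gaussian_space M {\<lambda>\<omega>. X \<omega> + Y \<omega> | X Y. X \<in> process_span V {0..} \<and> Y \<in> process_span W {0..}}" (is "gaussian_space M ?L")
    and "X \<in> process_span V {0..} \<Longrightarrow> Y \<in> process_span W {0..} \<Longrightarrow> (\<integral>\<omega>. X \<omega> * Y \<omega> \<partial>M) = 0"
proof -
  have VL: "process_span V {0..} \<subseteq> L2 M" and WL: "process_span W {0..} \<subseteq> L2 M"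
    unfolding process_span_def
    using L2_lincomb[of "{0..}" V, OF wiener_L2[OF V]] L2_lincomb[of "{0..}" W, OF wiener_L2[OF W]] by auto
  have o: "(\<integral>\<omega>. X \<omega> * Y \<omega> \<partial>M) = 0"
    and c: "(\<integral>\<omega>. iexp (X \<omega> + Y \<omega>) \<partial>M) = complex_of_real (exp (- (nrm M X)\<^sup>2 / 2)) * complex_of_real (exp (- (nrm M Y)\<^sup>2 / 2))"
    if X: "X \<in> process_span V {0..}" and Y: "Y \<in> process_span W {0..}" for X Y
  proof -
    obtain xs ys where X': "X = (\<lambda>\<omega>. lincomb (\<lambda>b. V b \<omega>) xs)" and xs: "snd ` set xs \<subseteq> {0..}"
      and Y': "Y = (\<lambda>\<omega>. lincomb (\<lambda>b. W b \<omega>) ys)" and ys: "snd ` set ys \<subseteq> {0..}"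
      using X Y unfolding process_span_def by blast
    have i: "indep_var borel X borel Y" unfolding X' Y' by (rule indep_wiener_lincomb[OF ind xs ys])
    have XL: "X \<in> L2 M" and YL: "Y \<in> L2 M" using X Y VL WL by auto
    note [measurable] = L2_meas[OF XL] L2_meas[OF YL]
    show "(\<integral>\<omega>. X \<omega> * Y \<omega> \<partial>M) = 0"
      using indep_var_lebesgue_integral[OF i L2_integrable[OF XL] L2_integrable[OF YL]]
        wiener_lincomb_mean[OF V xs] by (simp add: X')
    have i': "indep_var borel (iexp \<circ> X) borel (iexp \<circ> Y)"
      by (rule indep_var_compose[OF i]) auto
    have "(\<integral>\<omega>. iexp (X \<omega> + Y \<omega>) \<partial>M) = (\<integral>\<omega>. (iexp \<circ> X) \<omega> * (iexp \<circ> Y) \<omega> \<partial>M)"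
      by (simp add: distrib_left exp_add)
    also have "\<dots> = (\<integral>\<omega>. (iexp \<circ> X) \<omega> \<partial>M) * (\<integral>\<omega>. (iexp \<circ> Y) \<omega> \<partial>M)"
      by (rule indep_var_lebesgue_integral[OF i'])
        (auto intro!: integrable_const_bound[of _ 1])
    finally show "(\<integral>\<omega>. iexp (X \<omega> + Y \<omega>) \<partial>M) = complex_of_real (exp (- (nrm M X)\<^sup>2 / 2)) * complex_of_real (exp (- (nrm M Y)\<^sup>2 / 2))"
      using wiener_lincomb_char[OF V xs] wiener_lincomb_char[OF W ys] by (simp add: X' Y')
  qed
  show "X \<in> process_span V {0..} \<Longrightarrow> Y \<in> process_span W {0..} \<Longrightarrow> (\<integral>\<omega>. X \<omega> * Y \<omega> \<partial>M) = 0" by (rule o)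
  have "lin_set ?L"
    unfolding lin_set_def
  proof (intro conjI ballI allI)
    show "(\<lambda>x. 0) \<in> ?L"
      using lin_set_zero[OF lin_set_process_span, of V "{0..}"] lin_set_zero[OF lin_set_process_span, of W "{0..}"]
      by (intro CollectI exI[of _ "\<lambda>x. 0"]) auto
    fix f g a b assume "f \<in> ?L" "g \<in> ?L"
    then obtain X Y X' Y' where XY: "X \<in> process_span V {0..}" "Y \<in> process_span W {0..}" "f = (\<lambda>\<omega>. X \<omega> + Y \<omega>)"
      "X' \<in> process_span V {0..}" "Y' \<in> process_span W {0..}" "g = (\<lambda>\<omega>. X' \<omega> + Y' \<omega>)" by blast
    have "(\<lambda>x. a * f x + b * g x) = (\<lambda>x. (a * X x + b * X' x) + (a * Y x + b * Y' x))"
      by (simp add: XY algebra_simps)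
    then show "(\<lambda>x. a * f x + b * g x) \<in> ?L"
      using lin_setD[OF lin_set_process_span XY(1,4), of a b] lin_setD[OF lin_set_process_span XY(2,5), of a b]
      by (intro CollectI exI conjI)
  qed
  moreover have "?L \<subseteq> L2 M" using VL WL by (auto intro!: L2_add)
  moreover have "(\<integral>x. iexp (Z x) \<partial>M) = complex_of_real (exp (- (nrm M Z)\<^sup>2 / 2))" if "Z \<in> ?L" for Z
  proof -
    obtain X Y where XY: "X \<in> process_span V {0..}" "Y \<in> process_span W {0..}" and Z: "Z = (\<lambda>\<omega>. X \<omega> + Y \<omega>)"
      using \<open>Z \<in> ?L\<close> by blast
    have XL: "X \<in> L2 M" and YL: "Y \<in> L2 M" using XY VL WL by auto
    have n: "(nrm M Z)\<^sup>2 = (nrm M X)\<^sup>2 + (nrm M Y)\<^sup>2"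
      using integral_sq_lin[OF XL YL, of 1 1] o[OF XY] by (simp add: nrm_sq Z)
    have "- (nrm M Z)\<^sup>2 / 2 = - (nrm M X)\<^sup>2 / 2 + - (nrm M Y)\<^sup>2 / 2" by (simp add: n field_simps)
    then have "complex_of_real (exp (- (nrm M Z)\<^sup>2 / 2))
        = complex_of_real (exp (- (nrm M X)\<^sup>2 / 2)) * complex_of_real (exp (- (nrm M Y)\<^sup>2 / 2))"
      by (simp only: exp_add of_real_mult)
    then show ?thesis using c[OF XY] by (simp only: Z)
  qed
  ultimately show "gaussian_space M ?L" unfolding gaussian_space_def by (intro conjI ballI)
qed

end

section \<open>Wiener integrals\<close>

text \<open>A function orthogonal to all the indicators integrates to zero over every half line, so
  its positive and negative parts are densities of the same measure and it vanishes. The measure is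
  general because the result serves twice: for Lebesgue measure on a time interval and for the
  weight \<open>s powr (1 - 2 * H1)\<close>.\<close>

lemma upto_ind_dense:
  fixes \<mu> :: "real measure"
  assumes fin: "finite_measure \<mu>" and sets [simp, measurable_cong]: "sets \<mu> = sets borel" and t: "0 \<le> t"
    and conc: "AE x in \<mu>. x \<in> {0<..t}" and f: "f \<in> L2 \<mu>"
  shows "f \<in> L2_closure \<mu> (process_span upto_ind {0..t})"
proof -
  interpret finite_measure \<mu> by (rule fin)
  let ?S = "process_span upto_ind {0..t}"
  have uL: "upto_ind b \<in> L2 \<mu>" for b
  proof -
    have "(\<lambda>x. (upto_ind b x)\<^sup>2) = upto_ind b" by (auto simp: indicator_def)
    moreover have "integrable \<mu> (upto_ind b)"
      by (rule integrable_real_indicator) (simp_all add: less_top[symmetric])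
    ultimately show ?thesis by (simp add: L2_def)
  qed
  have SL: "?S \<subseteq> L2 \<mu>"
    unfolding process_span_def using L2_lincomb[of "{0..t}" upto_ind, OF uL] by auto
  obtain Y where Y: "Y \<in> L2_closure \<mu> ?S" and o: "\<And>V. V \<in> ?S \<Longrightarrow> (\<integral>x. (f x - Y x) * V x \<partial>\<mu>) = 0"
    using L2_projection[OF SL lin_set_process_span f] by blast
  note YL = L2_closure_L2[OF Y]
  define g where "g = (\<lambda>x. f x - Y x)"
  have gL: "g \<in> L2 \<mu>" unfolding g_def by (rule L2_diff[OF f YL])
  have gi: "integrable \<mu> g" by (rule L2_integrable[OF gL])
  note [measurable] = L2_meas[OF gL]
  have zero: "(\<integral>y. g y * indicator {x<..} y \<partial>\<mu>) = 0" for x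
  proof -
    \<comment> \<open>On the support of \<mu> the half line above x is the interval from the clipped
      point \<open>c\<close> to t, a difference of two spanning indicators.\<close>
    define c where "c = min t (max 0 x)"
    have c: "c \<in> {0..t}" using t by (auto simp: c_def)
    have "(\<integral>y. g y * indicator {x<..} y \<partial>\<mu>) = (\<integral>y. g y * upto_ind t y - g y * upto_ind c y \<partial>\<mu>)"
    proof (rule integral_cong_AE)
      show "AE y in \<mu>. g y * indicator {x<..} y = g y * upto_ind t y - g y * upto_ind c y"
        using conc by eventually_elim (auto simp: c_def indicator_def)
    qed measurable
    also have "\<dots> = (\<integral>y. g y * upto_ind t y \<partial>\<mu>) - (\<integral>y. g y * upto_ind c y \<partial>\<mu>)"
      by (rule Bochner_Integration.integral_diff[OF L2_mult_integrable[OF gL uL] L2_mult_integrable[OF gL uL]])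
    also have "\<dots> = 0"
      using o[OF process_span_base[of t "{0..t}" upto_ind]] o[OF process_span_base[OF c, of upto_ind]] t
      by (simp add: g_def)
    finally show ?thesis .
  qed
  have fe: "(\<integral>\<^sup>+y. ennreal (h y) * indicator {x<..} y \<partial>\<mu>) < \<infinity>" if "integrable \<mu> h" for x and h :: "real \<Rightarrow> real"
  proof -
    have "(\<integral>\<^sup>+y. ennreal (h y) * indicator {x<..} y \<partial>\<mu>) \<le> (\<integral>\<^sup>+y. ennreal (norm (h y)) \<partial>\<mu>)"
      by (rule nn_integral_mono) (auto simp: indicator_def intro: ennreal_leI)
    also have "\<dots> < \<infinity>" using that by (simp add: integrable_iff_bounded)
    finally show ?thesis .
  qed
  have gi': "integrable \<mu> (\<lambda>y. - g y)" using gi by simp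
  have "density \<mu> (\<lambda>x. ennreal (g x)) = density \<mu> (\<lambda>x. ennreal (- g x))"
  proof (rule measure_eqI_lessThan)
    fix x
    have e: "emeasure (density \<mu> (\<lambda>x. ennreal (h x))) {x<..} = (\<integral>\<^sup>+y. ennreal (h y) * indicator {x<..} y \<partial>\<mu>)"
      if "h \<in> borel_measurable \<mu>" for h
      by (rule emeasure_density) (use that in auto)
    show "emeasure (density \<mu> (\<lambda>x. ennreal (g x))) {x<..} < \<infinity>"
      using e[of g] fe[OF gi, of x] by simp
    have hi: "integrable \<mu> (\<lambda>y. g y * indicator {x<..} y)"
      by (rule integrable_real_mult_indicator[OF _ gi]) simp
    have a: "(\<integral>\<^sup>+y. ennreal (g y * indicator {x<..} y) \<partial>\<mu>) = (\<integral>\<^sup>+y. ennreal (g y) * indicator {x<..} y \<partial>\<mu>)"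
      and b: "(\<integral>\<^sup>+y. ennreal (- (g y * indicator {x<..} y)) \<partial>\<mu>) = (\<integral>\<^sup>+y. ennreal (- g y) * indicator {x<..} y \<partial>\<mu>)"
      by (auto intro!: nn_integral_cong simp: indicator_def)
    have "enn2real (\<integral>\<^sup>+y. ennreal (g y) * indicator {x<..} y \<partial>\<mu>) = enn2real (\<integral>\<^sup>+y. ennreal (- g y) * indicator {x<..} y \<partial>\<mu>)"
      using real_lebesgue_integral_def[OF hi] zero[of x] unfolding a b by simp
    moreover have "ennreal (enn2real (\<integral>\<^sup>+y. ennreal (g y) * indicator {x<..} y \<partial>\<mu>)) = (\<integral>\<^sup>+y. ennreal (g y) * indicator {x<..} y \<partial>\<mu>)"
      by (rule ennreal_enn2real) (use fe[OF gi, of x] in simp)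
    moreover have "ennreal (enn2real (\<integral>\<^sup>+y. ennreal (- g y) * indicator {x<..} y \<partial>\<mu>)) = (\<integral>\<^sup>+y. ennreal (- g y) * indicator {x<..} y \<partial>\<mu>)"
      by (rule ennreal_enn2real) (use fe[OF gi', of x] in simp)
    ultimately have "(\<integral>\<^sup>+y. ennreal (g y) * indicator {x<..} y \<partial>\<mu>) = (\<integral>\<^sup>+y. ennreal (- g y) * indicator {x<..} y \<partial>\<mu>)"
      by metis
    then show "emeasure (density \<mu> (\<lambda>x. ennreal (g x))) {x<..} = emeasure (density \<mu> (\<lambda>x. ennreal (- g x))) {x<..}"
      using e[of g] e[of "\<lambda>y. - g y"] by simp
  qed simp_all
  moreover have "integral\<^sup>N \<mu> (\<lambda>x. ennreal (g x)) \<noteq> \<infinity>"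
  proof -
    have "(\<integral>\<^sup>+y. ennreal (g y) \<partial>\<mu>) \<le> (\<integral>\<^sup>+y. ennreal (norm (g y)) \<partial>\<mu>)"
      by (rule nn_integral_mono) (auto intro: ennreal_leI)
    also have "\<dots> < \<infinity>" using gi by (simp add: integrable_iff_bounded)
    finally show ?thesis by simp
  qed
  ultimately have "AE x in \<mu>. ennreal (g x) = ennreal (- g x)"
    using finite_density_unique[of "\<lambda>x. ennreal (g x)" \<mu> "\<lambda>x. ennreal (- g x)"] by simp
  then have AE: "AE x in \<mu>. Y x = f x"
  proof eventually_elim
    case (elim x)
    have "g x = 0"
    proof (cases "g x \<ge> 0")
      case True
      then have "ennreal (- g x) = 0" by (simp add: ennreal_neg)
      then show ?thesis using elim True by simp
    next
      case False
      then have "ennreal (g x) = 0" by (simp add: ennreal_neg)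
      then have "ennreal (- g x) = 0" using elim by simp
      then show ?thesis using False by (simp add: ennreal_eq_0_iff)
    qed
    then show ?case by (simp add: g_def)
  qed
  have "\<exists>V\<in>?S. nrm \<mu> (\<lambda>x. f x - V x) < e" if e: "e > 0" for e
  proof -
    obtain V where V: "V \<in> ?S" "nrm \<mu> (\<lambda>x. Y x - V x) < e" using L2_closureD[OF Y e] by blast
    have VL: "V \<in> L2 \<mu>" using V SL by auto
    have "nrm \<mu> (\<lambda>x. Y x - V x) = nrm \<mu> (\<lambda>x. f x - V x)"
      by (rule nrm_cong_AE) (use AE L2_meas[OF VL] L2_meas[OF YL] L2_meas[OF f] in auto)
    then show ?thesis using V by (intro bexI[of _ V]) auto
  qed
  then show ?thesis using f by (simp add: L2_closure_def)
qed

text \<open>Both components are approximated by the same list, so that the isometry of elementary integrals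
carries over to the closure.\<close>

definition wiener_pair :: "'a measure \<Rightarrow> (real \<Rightarrow> 'a \<Rightarrow> real) \<Rightarrow> (real \<Rightarrow> real) \<Rightarrow> ('a \<Rightarrow> real) \<Rightarrow> bool" where
  "wiener_pair M W g Y \<longleftrightarrow> g \<in> L2 lborel \<and> Y \<in> L2 M \<and>
     (\<forall>e>0. \<exists>xs. snd ` set xs \<subseteq> {0..} \<and> nrm lborel (\<lambda>s. g s - lincomb (\<lambda>b. upto_ind b s) xs) < e
        \<and> nrm M (\<lambda>\<omega>. Y \<omega> - lincomb (\<lambda>b. W b \<omega>) xs) < e)"

lemma wiener_pairD:
  assumes "wiener_pair M W g Y"
  shows "g \<in> L2 lborel" "Y \<in> L2 M"
    "e > 0 \<Longrightarrow> \<exists>xs. snd ` set xs \<subseteq> {0..} \<and> nrm lborel (\<lambda>s. g s - lincomb (\<lambda>b. upto_ind b s) xs) < e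
        \<and> nrm M (\<lambda>\<omega>. Y \<omega> - lincomb (\<lambda>b. W b \<omega>) xs) < e"
  using assms by (simp_all add: wiener_pair_def)

lemma upto_lincomb_L2: "(\<lambda>s. lincomb (\<lambda>b. upto_ind b s) xs) \<in> L2 lborel"
  by (rule L2_lincomb[of UNIV, OF upto_ind_L2]) simp

lemma nrm_lin_less:
  assumes L: "f \<in> L2 M" "f' \<in> L2 M" "g \<in> L2 M" "g' \<in> L2 M"
    and d: "nrm M (\<lambda>x. f x - f' x) < e / (\<bar>a\<bar> + \<bar>b\<bar> + 1)" "nrm M (\<lambda>x. g x - g' x) < e / (\<bar>a\<bar> + \<bar>b\<bar> + 1)" and e: "e > 0"
  shows "nrm M (\<lambda>x. (a * f x + b * g x) - (a * f' x + b * g' x)) < e"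
proof -
  define d where "d = e / (\<bar>a\<bar> + \<bar>b\<bar> + 1)"
  have d0: "d > 0" using e by (simp add: d_def)
  have "nrm M (\<lambda>x. (a * f x + b * g x) - (a * f' x + b * g' x))
      = nrm M (\<lambda>x. a * (f x - f' x) + b * (g x - g' x))"
    by (simp add: algebra_simps)
  also have "\<dots> \<le> \<bar>a\<bar> * nrm M (\<lambda>x. f x - f' x) + \<bar>b\<bar> * nrm M (\<lambda>x. g x - g' x)"
    using nrm_triangle[OF L2_scale[OF L2_diff[OF L(1,2)]] L2_scale[OF L2_diff[OF L(3,4)]], of a b]
    by (simp add: nrm_scale)
  also have "\<dots> \<le> \<bar>a\<bar> * d + \<bar>b\<bar> * d"
    using d by (intro add_mono mult_left_mono) (auto simp: d_def)
  also have "\<dots> < (\<bar>a\<bar> + \<bar>b\<bar> + 1) * d" using d0 by (simp add: algebra_simps)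
  also have "\<dots> = e" by (simp add: d_def)
  finally show ?thesis .
qed

context prob_space
begin

context
  fixes W :: "real \<Rightarrow> 'a \<Rightarrow> real"
  assumes W: "wiener_process M W"
begin

lemma wiener_lincomb_L2: "snd ` set xs \<subseteq> {0..} \<Longrightarrow> (\<lambda>\<omega>. lincomb (\<lambda>b. W b \<omega>) xs) \<in> L2 M"
  by (rule L2_lincomb[of "{0..}"]) (auto simp: wiener_L2[OF W])

lemma wiener_pair_lin:
  assumes "wiener_pair M W g Y" "wiener_pair M W g' Y'"
  shows "wiener_pair M W (\<lambda>s. a * g s + b * g' s) (\<lambda>\<omega>. a * Y \<omega> + b * Y' \<omega>)"
  unfolding wiener_pair_def
proof (intro conjI allI impI)
  note 1 = wiener_pairD[OF assms(1)] and 2 = wiener_pairD[OF assms(2)]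
  show "(\<lambda>s. a * g s + b * g' s) \<in> L2 lborel" "(\<lambda>\<omega>. a * Y \<omega> + b * Y' \<omega>) \<in> L2 M"
    by (intro L2_lin 1 2)+
  fix e :: real assume e: "e > 0"
  define d where "d = e / (\<bar>a\<bar> + \<bar>b\<bar> + 1)"
  have d: "d > 0" using e by (simp add: d_def)
  obtain xs where xs: "snd ` set xs \<subseteq> {0..}" "nrm lborel (\<lambda>s. g s - lincomb (\<lambda>b. upto_ind b s) xs) < d"
    "nrm M (\<lambda>\<omega>. Y \<omega> - lincomb (\<lambda>b. W b \<omega>) xs) < d" using 1(3)[OF d] by blast
  obtain ys where ys: "snd ` set ys \<subseteq> {0..}" "nrm lborel (\<lambda>s. g' s - lincomb (\<lambda>b. upto_ind b s) ys) < d"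
    "nrm M (\<lambda>\<omega>. Y' \<omega> - lincomb (\<lambda>b. W b \<omega>) ys) < d" using 2(3)[OF d] by blast
  define zs where "zs = map (\<lambda>(c, i). (a * c, i)) xs @ map (\<lambda>(c, i). (b * c, i)) ys"
  have z: "snd ` set zs \<subseteq> {0..}" using xs(1) ys(1) by (auto simp: zs_def image_iff)
  have l: "lincomb v zs = a * lincomb v xs + b * lincomb v ys" for v
    by (simp add: zs_def lincomb_append lincomb_scale)
  show "\<exists>xs. snd ` set xs \<subseteq> {0..} \<and> nrm lborel (\<lambda>s. a * g s + b * g' s - lincomb (\<lambda>b. upto_ind b s) xs) < e
        \<and> nrm M (\<lambda>\<omega>. a * Y \<omega> + b * Y' \<omega> - lincomb (\<lambda>b. W b \<omega>) xs) < e"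
    using nrm_lin_less[OF 1(1) upto_lincomb_L2 2(1) upto_lincomb_L2 xs(2)[unfolded d_def] ys(2)[unfolded d_def] e]
      nrm_lin_less[OF 1(2) wiener_lincomb_L2[OF xs(1)] 2(2) wiener_lincomb_L2[OF ys(1)] xs(3)[unfolded d_def] ys(3)[unfolded d_def] e] z
    by (intro exI[of _ zs]) (simp add: l)
qed

lemma wiener_pair_nrm:
  assumes "wiener_pair M W g Y"
  shows "nrm M Y = nrm lborel g"
proof -
  note 1 = wiener_pairD[OF assms]
  have "\<bar>nrm M Y - nrm lborel g\<bar> \<le> 0 + e" if e: "e > 0" for e
  proof -
    obtain xs where xs: "snd ` set xs \<subseteq> {0..}" "nrm lborel (\<lambda>s. g s - lincomb (\<lambda>b. upto_ind b s) xs) < e / 2"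
      "nrm M (\<lambda>\<omega>. Y \<omega> - lincomb (\<lambda>b. W b \<omega>) xs) < e / 2" using 1(3)[of "e / 2"] e by auto
    show ?thesis
      using nrm_diff_abs[OF 1(1) upto_lincomb_L2, of xs] nrm_diff_abs[OF 1(2) wiener_lincomb_L2[OF xs(1)]]
        wiener_nrm_lincomb[OF W xs(1)] xs(2,3) by linarith
  qed
  then have "\<bar>nrm M Y - nrm lborel g\<bar> \<le> 0" by (rule field_le_epsilon)
  then show ?thesis by simp
qed

text \<open>Polarisation: applying the isometry to the sum and to each summand isolates the mixed
  term.\<close>

lemma wiener_pair_inner:
  assumes 1: "wiener_pair M W g Y" and 2: "wiener_pair M W g' Y'"
  shows "(\<integral>\<omega>. Y \<omega> * Y' \<omega> \<partial>M) = (\<integral>s. g s * g' s \<partial>lborel)"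
proof -
  have "(\<integral>x. (1 * Y x + 1 * Y' x)\<^sup>2 \<partial>M) = (\<integral>x. (1 * g x + 1 * g' x)\<^sup>2 \<partial>lborel)"
    using wiener_pair_nrm[OF wiener_pair_lin[OF 1 2, of 1 1]] unfolding nrm_sq[symmetric] by simp
  moreover have "(\<integral>x. (Y x)\<^sup>2 \<partial>M) = (\<integral>x. (g x)\<^sup>2 \<partial>lborel)" "(\<integral>x. (Y' x)\<^sup>2 \<partial>M) = (\<integral>x. (g' x)\<^sup>2 \<partial>lborel)"
    using wiener_pair_nrm[OF 1] wiener_pair_nrm[OF 2] by (simp_all add: nrm_sq[symmetric])
  ultimately show ?thesis
    unfolding integral_sq_lin[OF wiener_pairD(2)[OF 1] wiener_pairD(2)[OF 2]]
      integral_sq_lin[OF wiener_pairD(1)[OF 1] wiener_pairD(1)[OF 2]] by simp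
qed

lemma wiener_pair_closure:
  assumes "wiener_pair M W g Y"
  shows "Y \<in> L2_closure M (process_span W {0..})"
  unfolding L2_closure_def
proof (intro CollectI conjI allI impI wiener_pairD(2)[OF assms])
  fix e :: real assume "e > 0"
  then obtain xs where "snd ` set xs \<subseteq> {0..}" "nrm M (\<lambda>\<omega>. Y \<omega> - lincomb (\<lambda>b. W b \<omega>) xs) < e"
    using wiener_pairD(3)[OF assms] by blast
  then show "\<exists>V\<in>process_span W {0..}. nrm M (\<lambda>x. Y x - V x) < e"
    by (intro bexI[of _ "\<lambda>\<omega>. lincomb (\<lambda>b. W b \<omega>) xs"] process_spanI)
qed

end

end

section \<open>Elementary integrals and existence of the Wiener integral\<close>

definition step_list :: "(nat \<Rightarrow> real) \<Rightarrow> (nat \<Rightarrow> real) \<Rightarrow> nat \<Rightarrow> (real \<times> real) list" where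
  "step_list c \<tau> n = concat (map (\<lambda>i. [(c i, \<tau> (Suc i)), (- c i, \<tau> i)]) [0..<n])"

lemma lincomb_step_list: "lincomb v (step_list c \<tau> n) = (\<Sum>i<n. c i * (v (\<tau> (Suc i)) - v (\<tau> i)))"
  by (induction n) (auto simp: step_list_def lincomb_append algebra_simps)

lemma partition_mono:
  fixes \<tau> :: "nat \<Rightarrow> real"
  assumes "\<And>i. i < n \<Longrightarrow> \<tau> i \<le> \<tau> (Suc i)" "i \<le> j" "j \<le> n"
  shows "\<tau> i \<le> \<tau> j"
  using assms(2,3)
proof (induction j)
  case (Suc j)
  show ?case
  proof (cases "i = Suc j")
    case False
    then have "\<tau> i \<le> \<tau> j" using Suc by simp
    also have "\<dots> \<le> \<tau> (Suc j)" using Suc.prems by (intro assms(1)) simp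
    finally show ?thesis .
  qed simp
qed simp

lemma step_fun_eq_lincomb:
  assumes "\<And>i. i < n \<Longrightarrow> \<tau> i \<le> \<tau> (Suc i)" "\<tau> 0 = 0"
  shows "step_fun c \<tau> n s = lincomb (\<lambda>b. upto_ind b s) (step_list c \<tau> n)"
  unfolding step_fun_def lincomb_step_list
proof (rule sum.cong)
  fix i assume i: "i \<in> {..<n}"
  have "0 \<le> \<tau> i" "\<tau> i \<le> \<tau> (Suc i)" using partition_mono[of n \<tau> 0 i] assms i by auto
  then show "c i * indicator {\<tau> i<..\<tau> (Suc i)} s = c i * (upto_ind (\<tau> (Suc i)) s - upto_ind (\<tau> i) s)"
    by (auto simp: indicator_def)
qed simp

lemma step_fun_eq_0:
  assumes "\<And>i. i < n \<Longrightarrow> \<tau> i \<le> \<tau> (Suc i)" "\<tau> 0 = a" "\<tau> n = b" "s \<notin> {a..b}"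
  shows "step_fun c \<tau> n s = 0"
  unfolding step_fun_def
proof (rule sum.neutral, rule ballI)
  fix i assume i: "i \<in> {..<n}"
  have "a \<le> \<tau> i" "\<tau> (Suc i) \<le> b" using partition_mono[of n \<tau> 0 i] partition_mono[of n \<tau> "Suc i" n] assms i by auto
  then show "c i * indicator {\<tau> i<..\<tau> (Suc i)} s = 0" using assms(4) by (auto simp: indicator_def)
qed

lemma step_list_subset:
  assumes "\<And>i. i < n \<Longrightarrow> \<tau> i \<le> \<tau> (Suc i)" "\<tau> 0 = 0" "\<tau> n = t"
  shows "snd ` set (step_list c \<tau> n) \<subseteq> {0..t}"
proof -
  have "\<tau> i \<in> {0..t}" if "i \<le> n" for i
    using partition_mono[of n \<tau> 0 i] partition_mono[of n \<tau> i n] assms that by auto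
  then show ?thesis by (auto simp: step_list_def)
qed

lemma step_int_eq_lincomb: "step_int W c \<tau> n \<omega> = lincomb (\<lambda>b. W b \<omega>) (step_list c \<tau> n)"
  by (simp add: step_int_def lincomb_step_list)

lemma nrm_less_if_nn_integral_less:
  assumes "f \<in> borel_measurable M" "(\<integral>\<^sup>+x. ennreal ((f x)\<^sup>2) \<partial>M) < ennreal (e\<^sup>2)" "e > 0"
  shows "f \<in> L2 M" "nrm M f < e"
proof -
  have "(\<integral>\<^sup>+x. ennreal ((f x)\<^sup>2) \<partial>M) < \<infinity>" by (rule less_trans[OF assms(2)]) simp
  then show L: "f \<in> L2 M" by (rule L2_I_nn[OF assms(1)])
  have "ennreal ((nrm M f)\<^sup>2) < ennreal (e\<^sup>2)" using assms(2) nn_integral_sq_L2[OF L] by simp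
  then have "(nrm M f)\<^sup>2 < e\<^sup>2" by (simp add: ennreal_less_iff)
  then show "nrm M f < e" by (rule power2_less_imp_less) (use assms(3) in simp)
qed

context prob_space
begin

context
  fixes W :: "real \<Rightarrow> 'a \<Rightarrow> real"
  assumes W: "wiener_process M W"
begin

text \<open>Any \<open>Y\<close> that meets the specification is tied to its integrand by
  \<open>wiener_pair\<close>; the arbitrary choice in \<open>wiener_int\<close> is thereby
  controlled up to almost everywhere equality.\<close>

lemma wiener_pair_if_is_wiener_int:
  assumes t: "0 \<le> t" and f [measurable]: "f \<in> borel_measurable borel" and Y: "is_wiener_int M W 0 t f Y"
  shows "wiener_pair M W (\<lambda>s. indicator {0..t} s * f s) Y"
proof -
  have Ym [measurable]: "Y \<in> borel_measurable M"
    using Y unfolding is_wiener_int_def by (rule conjunct1)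
  obtain c \<tau> n where \<tau>: "\<forall>k. \<tau> k 0 = 0 \<and> \<tau> k (n k) = t \<and> (\<forall>i<n k. \<tau> k i \<le> \<tau> k (Suc i))"
    and l1: "(\<lambda>k. \<integral>\<^sup>+ s. ennreal ((f s - step_fun (c k) (\<tau> k) (n k) s)\<^sup>2) * indicator {0..t} s \<partial>lborel) \<longlonglongrightarrow> 0"
    and l2: "(\<lambda>k. \<integral>\<^sup>+ \<omega>. ennreal ((Y \<omega> - step_int W (c k) (\<tau> k) (n k) \<omega>)\<^sup>2) \<partial>M) \<longlonglongrightarrow> 0"
    using conjunct2[OF Y[unfolded is_wiener_int_def]] by (elim exE conjE)
  have \<tau>: "\<tau> k 0 = 0" "\<tau> k (n k) = t" "i < n k \<Longrightarrow> \<tau> k i \<le> \<tau> k (Suc i)" for k i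
    using \<tau> by auto
  define x where "x = (\<lambda>k. step_list (c k) (\<tau> k) (n k))"
  have x: "snd ` set (x k) \<subseteq> {0..}" for k
    using step_list_subset[of "n k" "\<tau> k" t "c k", OF \<tau>(3,1,2)] by (auto simp: x_def)
  have sf: "step_fun (c k) (\<tau> k) (n k) s = lincomb (\<lambda>b. upto_ind b s) (x k)" for k s
    unfolding x_def by (rule step_fun_eq_lincomb) (use \<tau> in auto)
  have si: "step_int W (c k) (\<tau> k) (n k) \<omega> = lincomb (\<lambda>b. W b \<omega>) (x k)" for k \<omega>
    unfolding x_def by (rule step_int_eq_lincomb)
  define g where "g = (\<lambda>s. indicator {0..t} s * f s)"
  have [measurable]: "g \<in> borel_measurable borel" unfolding g_def by measurable
  \<comment> \<open>Step functions on a partition of the interval vanish outside it, so the integral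
    over \<open>{0..t}\<close> is a full L2 distance to the truncated function
    \<open>g\<close>.\<close>
  have eq: "ennreal ((f s - step_fun (c k) (\<tau> k) (n k) s)\<^sup>2) * indicator {0..t} s
      = ennreal ((g s - lincomb (\<lambda>b. upto_ind b s) (x k))\<^sup>2)" for k s
    using step_fun_eq_0[of "n k" "\<tau> k" 0 t s "c k", OF \<tau>(3,1,2)] unfolding sf
    by (cases "s \<in> {0..t}") (auto simp: g_def)
  have l1': "(\<lambda>k. \<integral>\<^sup>+ s. ennreal ((g s - lincomb (\<lambda>b. upto_ind b s) (x k))\<^sup>2) \<partial>lborel) \<longlonglongrightarrow> 0"
    using l1 unfolding eq .
  have l2': "(\<lambda>k. \<integral>\<^sup>+ \<omega>. ennreal ((Y \<omega> - lincomb (\<lambda>b. W b \<omega>) (x k))\<^sup>2) \<partial>M) \<longlonglongrightarrow> 0"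
    using l2 by (simp add: si)
  have m1: "(\<lambda>s. g s - lincomb (\<lambda>b. upto_ind b s) (x k)) \<in> borel_measurable lborel" for k
    using L2_meas[OF upto_lincomb_L2[of "x k"]] by simp
  have m2: "(\<lambda>\<omega>. Y \<omega> - lincomb (\<lambda>b. W b \<omega>) (x k)) \<in> borel_measurable M" for k
    using L2_meas[OF wiener_lincomb_L2[OF W x[of k]]] by simp
  have key: "\<exists>k. (\<lambda>s. g s - lincomb (\<lambda>b. upto_ind b s) (x k)) \<in> L2 lborel \<and> nrm lborel (\<lambda>s. g s - lincomb (\<lambda>b. upto_ind b s) (x k)) < e
     \<and> (\<lambda>\<omega>. Y \<omega> - lincomb (\<lambda>b. W b \<omega>) (x k)) \<in> L2 M \<and> nrm M (\<lambda>\<omega>. Y \<omega> - lincomb (\<lambda>b. W b \<omega>) (x k)) < e" if e: "e > 0" for e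
  proof -
    have e2: "(0::ennreal) < ennreal (e\<^sup>2)" using e by simp
    have "\<forall>\<^sub>F k in sequentially. (\<integral>\<^sup>+ s. ennreal ((g s - lincomb (\<lambda>b. upto_ind b s) (x k))\<^sup>2) \<partial>lborel) < ennreal (e\<^sup>2)
       \<and> (\<integral>\<^sup>+ \<omega>. ennreal ((Y \<omega> - lincomb (\<lambda>b. W b \<omega>) (x k))\<^sup>2) \<partial>M) < ennreal (e\<^sup>2)"
      using order_tendstoD(2)[OF l1' e2] order_tendstoD(2)[OF l2' e2] by eventually_elim simp
    then obtain k where "(\<integral>\<^sup>+ s. ennreal ((g s - lincomb (\<lambda>b. upto_ind b s) (x k))\<^sup>2) \<partial>lborel) < ennreal (e\<^sup>2)"
       "(\<integral>\<^sup>+ \<omega>. ennreal ((Y \<omega> - lincomb (\<lambda>b. W b \<omega>) (x k))\<^sup>2) \<partial>M) < ennreal (e\<^sup>2)"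
      unfolding eventually_sequentially by blast
    then show ?thesis
      by (intro exI[of _ k] conjI nrm_less_if_nn_integral_less[OF m1 _ e] nrm_less_if_nn_integral_less[OF m2 _ e])
  qed
  obtain k where k: "(\<lambda>s. g s - lincomb (\<lambda>b. upto_ind b s) (x k)) \<in> L2 lborel" "(\<lambda>\<omega>. Y \<omega> - lincomb (\<lambda>b. W b \<omega>) (x k)) \<in> L2 M"
    using key[OF zero_less_one] by (elim exE conjE)
  have "g \<in> L2 lborel" using L2_add[OF k(1) upto_lincomb_L2[of "x k"]] by simp
  moreover have "Y \<in> L2 M" using L2_add[OF k(2) wiener_lincomb_L2[OF W x[of k]]] by simp
  ultimately have "wiener_pair M W g Y"
    unfolding wiener_pair_def
  proof (intro conjI allI impI)
    fix e :: real assume "e > 0"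
    from key[OF this] obtain k where k: "nrm lborel (\<lambda>s. g s - lincomb (\<lambda>b. upto_ind b s) (x k)) < e"
      "nrm M (\<lambda>\<omega>. Y \<omega> - lincomb (\<lambda>b. W b \<omega>) (x k)) < e" by (elim exE conjE)
    show "\<exists>xs. snd ` set xs \<subseteq> {0..} \<and> nrm lborel (\<lambda>s. g s - lincomb (\<lambda>b. upto_ind b s) xs) < e
        \<and> nrm M (\<lambda>\<omega>. Y \<omega> - lincomb (\<lambda>b. W b \<omega>) xs) < e"
      by (rule exI[of _ "x k"]) (rule conjI[OF x conjI[OF k]])
  qed
  then show ?thesis by (simp only: g_def)
qed

text \<open>Existence makes the choice in \<open>wiener_int\<close> meaningful. Step functions are
  dense, the isometry turns the Cauchy property of the integrands into that of the elementary
  integrals, and completeness supplies \<open>Y\<close>.\<close>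

lemma ex_is_wiener_int:
  assumes t: "0 \<le> t" and f [measurable]: "f \<in> borel_measurable borel"
    and fi: "(\<lambda>s. indicator {0..t} s * f s) \<in> L2 lborel"
  shows "\<exists>Y. is_wiener_int M W 0 t f Y"
proof -
  \<comment> \<open>Lebesgue measure restricted to the interval is finite, as the density result
    requires.\<close>
  define \<mu> where "\<mu> = density lborel (\<lambda>s. indicator {0..t} s :: ennreal)"
  have sets: "sets \<mu> = sets borel" by (simp add: \<mu>_def)
  have nnm: "(\<integral>\<^sup>+s. h s \<partial>\<mu>) = (\<integral>\<^sup>+s. h s * indicator {0..t} s \<partial>lborel)" if "h \<in> borel_measurable borel" for h
    unfolding \<mu>_def by (subst nn_integral_density) (use that in \<open>auto simp: mult.commute\<close>)
  have fin: "finite_measure \<mu>"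
    by (rule finite_measureI) (simp add: \<mu>_def emeasure_density t)
  interpret \<mu>: finite_measure \<mu> by (rule fin)
  have conc: "AE s in \<mu>. s \<in> {0<..t}"
  proof -
    have "AE s in lborel. s \<noteq> (0::real)" by (rule AE_lborel_singleton)
    then show ?thesis unfolding \<mu>_def by (subst AE_density) (auto elim!: eventually_mono simp: indicator_def split: if_splits)
  qed
  have isq: "ennreal ((h s)\<^sup>2) * indicator {0..t} s = ennreal ((indicator {0..t} s * h s)\<^sup>2)" for h s
    by (simp add: indicator_def)
  have f\<mu>: "f \<in> L2 \<mu>"
    by (rule L2_I_nn) (use nn_integral_sq_L2[OF fi] in \<open>simp_all add: nnm isq measurable_cong_sets[OF sets refl]\<close>)
  have "\<exists>xs. snd ` set xs \<subseteq> {0..t} \<and> nrm \<mu> (\<lambda>s. f s - lincomb (\<lambda>b. upto_ind b s) xs) < 1 / Suc k" for k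
    using L2_closureD[OF upto_ind_dense[OF fin sets t conc f\<mu>], of "1 / Suc k"] unfolding process_span_def by auto
  then obtain x where x: "\<And>k. snd ` set (x k) \<subseteq> {0..t}"
    and xn: "\<And>k. nrm \<mu> (\<lambda>s. f s - lincomb (\<lambda>b. upto_ind b s) (x k)) < 1 / Suc k" by metis
  have x': "snd ` set (x k) \<subseteq> {0..}" for k using x[of k] by auto
  have supp: "lincomb (\<lambda>b. upto_ind b s) ys = indicator {0..t} s * lincomb (\<lambda>b. upto_ind b s) ys" if "snd ` set ys \<subseteq> {0..t}" for ys s
  proof (cases "s \<in> {0..t}")
    case False
    from that have "lincomb (\<lambda>b. upto_ind b s) ys = 0"
    proof (induction ys)
      case (Cons p ys)
      obtain c b where p: "p = (c, b)" by force
      have "b \<le> t" using Cons p by auto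
      then have "upto_ind b s = 0" using False by (auto simp: indicator_def)
      then show ?case using Cons by (simp add: p)
    qed simp
    then show ?thesis by simp
  qed simp
  have eqn: "nrm lborel (\<lambda>s. lincomb (\<lambda>b. upto_ind b s) ys) = nrm \<mu> (\<lambda>s. lincomb (\<lambda>b. upto_ind b s) ys)"
    and ym: "(\<lambda>s. lincomb (\<lambda>b. upto_ind b s) ys) \<in> L2 \<mu>" if ys: "snd ` set ys \<subseteq> {0..t}" for ys
  proof -
    note L = upto_lincomb_L2[of ys]
    have m: "(\<lambda>s. lincomb (\<lambda>b. upto_ind b s) ys) \<in> borel_measurable borel" using L2_meas[OF L] by simp
    have e: "(\<integral>\<^sup>+s. ennreal ((lincomb (\<lambda>b. upto_ind b s) ys)\<^sup>2) \<partial>\<mu>) = (\<integral>\<^sup>+s. ennreal ((lincomb (\<lambda>b. upto_ind b s) ys)\<^sup>2) \<partial>lborel)"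
    proof -
      have "(\<integral>\<^sup>+s. ennreal ((lincomb (\<lambda>b. upto_ind b s) ys)\<^sup>2) \<partial>\<mu>)
          = (\<integral>\<^sup>+s. ennreal ((lincomb (\<lambda>b. upto_ind b s) ys)\<^sup>2) * indicator {0..t} s \<partial>lborel)"
        by (rule nnm) (use m in measurable)
      also have "\<dots> = (\<integral>\<^sup>+s. ennreal ((lincomb (\<lambda>b. upto_ind b s) ys)\<^sup>2) \<partial>lborel)"
      proof (rule nn_integral_cong)
        fix s show "ennreal ((lincomb (\<lambda>b. upto_ind b s) ys)\<^sup>2) * indicator {0..t} s = ennreal ((lincomb (\<lambda>b. upto_ind b s) ys)\<^sup>2)"
          unfolding isq[of "\<lambda>s. lincomb (\<lambda>b. upto_ind b s) ys" s] supp[OF ys, of s, symmetric] by (rule refl)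
      qed
      finally show ?thesis .
    qed
    show ym: "(\<lambda>s. lincomb (\<lambda>b. upto_ind b s) ys) \<in> L2 \<mu>"
      by (rule L2_I_nn) (use m nn_integral_sq_L2[OF L] in \<open>simp_all add: e measurable_cong_sets[OF sets refl]\<close>)
    have "ennreal ((nrm lborel (\<lambda>s. lincomb (\<lambda>b. upto_ind b s) ys))\<^sup>2) = ennreal ((nrm \<mu> (\<lambda>s. lincomb (\<lambda>b. upto_ind b s) ys))\<^sup>2)"
      using e unfolding nn_integral_sq_L2[OF L] nn_integral_sq_L2[OF ym] by simp
    then show "nrm lborel (\<lambda>s. lincomb (\<lambda>b. upto_ind b s) ys) = nrm \<mu> (\<lambda>s. lincomb (\<lambda>b. upto_ind b s) ys)"
      by simp
  qed
  define J where "J = (\<lambda>k \<omega>. lincomb (\<lambda>b. W b \<omega>) (x k))"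
  have JL: "J k \<in> L2 M" for k unfolding J_def by (rule wiener_lincomb_L2[OF W x'])
  have Jn: "nrm M (\<lambda>\<omega>. J i \<omega> - J j \<omega>) \<le> 1 / Suc i + 1 / Suc j" for i j
  proof -
    define zs where "zs = x i @ map (\<lambda>(c, b). (- 1 * c, b)) (x j)"
    have z: "snd ` set zs \<subseteq> {0..t}" using x[of i] x[of j] by (auto simp: zs_def image_iff)
    have l: "lincomb v zs = lincomb v (x i) - lincomb v (x j)" for v
      unfolding zs_def lincomb_append lincomb_scale by simp
    have "nrm M (\<lambda>\<omega>. J i \<omega> - J j \<omega>) = nrm M (\<lambda>\<omega>. lincomb (\<lambda>b. W b \<omega>) zs)" by (simp add: J_def l)
    also have "\<dots> = nrm lborel (\<lambda>s. lincomb (\<lambda>b. upto_ind b s) zs)"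
      by (rule wiener_nrm_lincomb[OF W]) (use z in auto)
    also have "\<dots> = nrm \<mu> (\<lambda>s. lincomb (\<lambda>b. upto_ind b s) zs)" by (rule eqn[OF z])
    also have "\<dots> = nrm \<mu> (\<lambda>s. lincomb (\<lambda>b. upto_ind b s) (x i) - lincomb (\<lambda>b. upto_ind b s) (x j))"
      by (simp only: l)
    also have "\<dots> \<le> nrm \<mu> (\<lambda>s. lincomb (\<lambda>b. upto_ind b s) (x i) - f s) + nrm \<mu> (\<lambda>s. f s - lincomb (\<lambda>b. upto_ind b s) (x j))"
      by (rule nrm_triangle_diff[OF ym[OF x] f\<mu> ym[OF x]])
    also have "\<dots> \<le> 1 / Suc i + 1 / Suc j"
      using xn[of i] xn[of j] nrm_minus_commute[of \<mu> "\<lambda>s. lincomb (\<lambda>b. upto_ind b s) (x i)" f] by simp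
    finally show ?thesis .
  qed
  obtain Y where YL: "Y \<in> L2 M" and Y: "(\<lambda>k. nrm M (\<lambda>\<omega>. J k \<omega> - Y \<omega>)) \<longlonglongrightarrow> 0"
  proof (rule bexE[OF L2_complete[OF JL]])
    fix e :: real assume e: "e > 0"
    obtain N where N: "inverse (real (Suc N)) < e / 2"
      using reals_Archimedean[of "e / 2"] e by auto
    have "nrm M (\<lambda>\<omega>. J i \<omega> - J j \<omega>) < e" if "i \<ge> N" "j \<ge> N" for i j
    proof -
      have "1 / real (Suc i) \<le> 1 / Suc N" "1 / real (Suc j) \<le> 1 / Suc N"
        using that by (auto intro!: divide_left_mono)
      then show ?thesis using Jn[of i j] N by (simp add: inverse_eq_divide)
    qed
    then show "\<exists>N. \<forall>i\<ge>N. \<forall>j\<ge>N. nrm M (\<lambda>\<omega>. J i \<omega> - J j \<omega>) < e" by blast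
  qed (use that in blast)
  note [measurable] = L2_meas[OF YL]
  \<comment> \<open>The specification asks for partitions from 0 to t, so each list is rewritten
    through increments. Bundling the conditions lets the partitions and coefficients be chosen for
    all k at once.\<close>
  define P where "P = (\<lambda>k n \<tau> d. \<tau> 0 = 0 \<and> \<tau> n = t \<and> (\<forall>i<n. \<tau> i < \<tau> (Suc i)) \<and>
      (\<forall>v. v 0 = 0 \<longrightarrow> lincomb v (x k) = (\<Sum>i<n. d i * (v (\<tau> (Suc i)) - v (\<tau> i)))))"
  have "\<exists>n \<tau> d. P k n \<tau> d" for k
  proof (rule lincomb_as_increments[OF t x[of k]])
    fix n \<tau> d
    assume "\<tau> 0 = 0" "\<tau> n = t" "\<And>i. i < n \<Longrightarrow> \<tau> i < \<tau> (Suc i)"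
      "\<And>v. v 0 = 0 \<Longrightarrow> lincomb v (x k) = (\<Sum>i<n. d i * (v (\<tau> (Suc i)) - v (\<tau> i)))"
    then have "P k n \<tau> d" unfolding P_def by simp
    then show ?thesis by blast
  qed
  then obtain n \<tau> d where nd: "\<And>k. P k (n k) (\<tau> k) (d k)"
    by metis
  have \<tau>: "\<tau> k 0 = 0" "\<tau> k (n k) = t" "i < n k \<Longrightarrow> \<tau> k i < \<tau> k (Suc i)" for k i
    using nd[of k] by (simp_all add: P_def)
  have inc: "lincomb v (x k) = (\<Sum>i<n k. d k i * (v (\<tau> k (Suc i)) - v (\<tau> k i)))" if "v 0 = 0" for k v
    using nd[of k] that by (simp add: P_def)
  have sf: "step_fun (d k) (\<tau> k) (n k) s = lincomb (\<lambda>b. upto_ind b s) (x k)" for k s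
  proof -
    have "step_fun (d k) (\<tau> k) (n k) s = lincomb (\<lambda>b. upto_ind b s) (step_list (d k) (\<tau> k) (n k))"
      by (rule step_fun_eq_lincomb) (use \<tau> in \<open>auto intro: less_imp_le\<close>)
    also have "\<dots> = lincomb (\<lambda>b. upto_ind b s) (x k)"
      unfolding lincomb_step_list by (rule inc[symmetric]) simp
    finally show ?thesis .
  qed
  have si: "step_int W (d k) (\<tau> k) (n k) \<omega> = J k \<omega>" if "\<omega> \<in> space M" for k \<omega>
    unfolding step_int_def J_def by (rule inc[symmetric]) (rule wiener_0[OF W that])
  have "is_wiener_int M W 0 t f Y"
    unfolding is_wiener_int_def
  proof (intro conjI exI allI impI)
    show "Y \<in> borel_measurable M" by measurable
    show "\<tau> k 0 = 0" "\<tau> k (n k) = t" for k by (rule \<tau>)+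
    show "\<tau> k i \<le> \<tau> k (Suc i)" if "i < n k" for k i using \<tau>(3)[OF that] by simp
    have "(\<integral>\<^sup>+ s. ennreal ((f s - step_fun (d k) (\<tau> k) (n k) s)\<^sup>2) * indicator {0..t} s \<partial>lborel)
        = ennreal ((nrm \<mu> (\<lambda>s. f s - lincomb (\<lambda>b. upto_ind b s) (x k)))\<^sup>2)" for k
    proof -
      have "(\<lambda>s. lincomb (\<lambda>b. upto_ind b s) (x k)) \<in> borel_measurable borel"
        using L2_meas[OF upto_lincomb_L2[of "x k"]] by simp
      then show ?thesis
        unfolding sf nn_integral_sq_L2[OF L2_diff[OF f\<mu> ym[OF x]], symmetric] by (simp add: nnm)
    qed
    moreover have "(\<lambda>k. ennreal ((nrm \<mu> (\<lambda>s. f s - lincomb (\<lambda>b. upto_ind b s) (x k)))\<^sup>2)) \<longlonglongrightarrow> ennreal (0\<^sup>2)"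
    proof (intro tendsto_intros)
      show "(\<lambda>k. nrm \<mu> (\<lambda>s. f s - lincomb (\<lambda>b. upto_ind b s) (x k))) \<longlonglongrightarrow> 0"
        by (rule Lim_null_comparison[OF _ LIMSEQ_Suc[OF lim_1_over_n]])
          (use xn in \<open>auto intro!: always_eventually less_imp_le\<close>)
    qed
    ultimately show "(\<lambda>k. \<integral>\<^sup>+ s. ennreal ((f s - step_fun (d k) (\<tau> k) (n k) s)\<^sup>2) * indicator {0..t} s \<partial>lborel) \<longlonglongrightarrow> 0"
      by simp
    have "(\<integral>\<^sup>+ \<omega>. ennreal ((Y \<omega> - step_int W (d k) (\<tau> k) (n k) \<omega>)\<^sup>2) \<partial>M) = ennreal ((nrm M (\<lambda>\<omega>. J k \<omega> - Y \<omega>))\<^sup>2)" for k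
      unfolding nn_integral_sq_L2[OF L2_diff[OF JL YL], symmetric]
      by (rule nn_integral_cong) (simp add: si power2_commute)
    moreover have "(\<lambda>k. ennreal ((nrm M (\<lambda>\<omega>. J k \<omega> - Y \<omega>))\<^sup>2)) \<longlonglongrightarrow> ennreal (0\<^sup>2)"
      by (intro tendsto_intros Y)
    ultimately show "(\<lambda>k. \<integral>\<^sup>+ \<omega>. ennreal ((Y \<omega> - step_int W (d k) (\<tau> k) (n k) \<omega>)\<^sup>2) \<partial>M) \<longlonglongrightarrow> 0"
      by simp
  qed
  then show ?thesis by blast
qed

lemma wiener_pair_wiener_int:
  assumes "0 \<le> t" "f \<in> borel_measurable borel" "(\<lambda>s. indicator {0..t} s * f s) \<in> L2 lborel"
  shows "wiener_pair M W (\<lambda>s. indicator {0..t} s * f s) (wiener_int M W 0 t f)"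
  unfolding wiener_int_def
  by (rule wiener_pair_if_is_wiener_int[OF assms(1,2) someI_ex[OF ex_is_wiener_int[OF assms]]])

end

end

lemma wiener_int_cong:
  assumes "\<And>s. s \<in> {a..b} \<Longrightarrow> f s = g s"
  shows "wiener_int M W a b f = wiener_int M W a b g"
proof -
  have "(\<integral>\<^sup>+ s. ennreal ((f s - h s)\<^sup>2) * indicator {a..b} s \<partial>lborel) = (\<integral>\<^sup>+ s. ennreal ((g s - h s)\<^sup>2) * indicator {a..b} s \<partial>lborel)" for h
    by (rule nn_integral_cong) (use assms in \<open>auto simp: indicator_def\<close>)
  then show ?thesis unfolding wiener_int_def is_wiener_int_def by simp
qed

section \<open>The kernel\<close>

locale fractional_kernel =
  fixes H1 H2 :: real
  assumes H: "1/2 < H1" "H1 < H2" "H2 < 1"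
begin

text \<open>The exponents \<open>p\<close> and \<open>q\<close> govern the kernel: its time
  derivative is bounded by a multiple of
  \<open>s powr (- q) * t powr p * (t - s) powr (p - 1)\<close>. Both lie strictly between 0 and
  1/2.\<close>

definition p where "p = H2 - H1"
definition q where "q = H2 - 1/2"

lemma p: "0 < p" "p < 1/2" and q: "0 < q" "q < 1/2"
  using H by (auto simp: p_def q_def)

lemma betaH_nonneg: "0 \<le> betaH H2"
proof -
  have "0 < Beta (H2 - 1/2) (2 - 2 * H2)" using H unfolding Beta_def by (intro divide_pos_pos mult_pos_pos Gamma_real_pos) auto
  then show ?thesis using H by (simp add: betaH_def)
qed

text \<open>What the two singular factors of the kernel become on the unit interval, up to a power
  of t - s. Both exponents exceed -1, so this is an integrable Beta weight.\<close>

definition wt :: "real \<Rightarrow> real" where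
  "wt x = indicator {0..1} x * (x powr (H2 - 3/2) * (1 - x) powr (1/2 - H1))"

lemma wt_nonneg: "0 \<le> wt x" by (simp add: wt_def)

lemma wt_measurable [measurable]: "wt \<in> borel_measurable borel"
  unfolding wt_def by measurable

lemma wt_integrable: "integrable lborel wt"
  using integrable_Beta[of "H2 - 1/2" "3/2 - H1"] H
  unfolding set_integrable_def wt_def by (simp add: algebra_simps)

definition B0 where "B0 = (\<integral>x. wt x \<partial>lborel)"

lemma B0_nonneg: "0 \<le> B0"
  unfolding B0_def by (rule integral_nonneg_AE) (simp add: wt_nonneg)

text \<open>The substitution \<open>u = s + (t - s) * x\<close> moves the dependence of the domain of integration on \<open>t\<close> into
the integrand, where it is smooth.\<close>

definition base :: "real \<Rightarrow> real \<Rightarrow> real \<Rightarrow> real" where "base t s x = s + (t - s) * x"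

lemma base_bounds: "0 < s \<Longrightarrow> s \<le> t \<Longrightarrow> 0 \<le> x \<Longrightarrow> x \<le> 1 \<Longrightarrow> s \<le> base t s x \<and> base t s x \<le> t"
proof -
  assume a: "0 < s" "s \<le> t" "0 \<le> x" "x \<le> 1"
  then have "(t - s) * x \<le> (t - s) * 1" by (intro mult_left_mono) auto
  moreover have "0 \<le> (t - s) * x" using a by (intro mult_nonneg_nonneg) auto
  ultimately
  show ?thesis by (simp add: base_def)
qed

definition J :: "real \<Rightarrow> real \<Rightarrow> real" where
  "J t s = (\<integral>x. wt x * base t s x powr p \<partial>lborel)"

definition J' :: "real \<Rightarrow> real \<Rightarrow> real" where
  "J' t s = (\<integral>x. wt x * (p * x * base t s x powr (p - 1)) \<partial>lborel)"

lemma wt_mult_integrable: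
  assumes [measurable]: "f \<in> borel_measurable borel" and "\<And>x. 0 \<le> x \<Longrightarrow> x \<le> 1 \<Longrightarrow> \<bar>f x\<bar> \<le> c"
  shows "integrable lborel (\<lambda>x. wt x * f x)"
proof (rule Bochner_Integration.integrable_bound)
  show "integrable lborel (\<lambda>x. c * wt x)" using wt_integrable by simp
  have "norm (wt x * f x) \<le> norm (c * wt x)" for x
  proof (cases "x \<in> {0..1}")
    case True
    then have "wt x * \<bar>f x\<bar> \<le> wt x * c" by (intro mult_left_mono assms wt_nonneg) auto
    also have "\<dots> \<le> \<bar>c * wt x\<bar>" by (simp add: mult.commute)
    finally show ?thesis by (simp add: abs_mult wt_nonneg)
  qed (simp add: wt_def)
  then show "AE x in lborel. norm (wt x * f x) \<le> norm (c * wt x)" by simp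
qed measurable

lemma base_powr_p_bounds:
  assumes "0 < s" "s \<le> t" "0 \<le> x" "x \<le> 1"
  shows "0 \<le> base t s x powr p" "base t s x powr p \<le> t powr p"
  using base_bounds[OF assms] assms p by (auto intro!: powr_mono2)

lemma base_powr_p1_bounds:
  assumes "0 < s" "s \<le> t" "0 \<le> x" "x \<le> 1"
  shows "0 \<le> p * x * base t s x powr (p - 1)" "p * x * base t s x powr (p - 1) \<le> p * s powr (p - 1)"
proof -
  have "base t s x powr (p - 1) \<le> s powr (p - 1)"
    using base_bounds[OF assms] assms p by (intro powr_mono2') auto
  then have "x * base t s x powr (p - 1) \<le> 1 * s powr (p - 1)"
    using assms by (intro mult_mono) auto
  then show "p * x * base t s x powr (p - 1) \<le> p * s powr (p - 1)"
    using p by (simp add: mult.assoc)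
  show "0 \<le> p * x * base t s x powr (p - 1)" using assms p by simp
qed

lemma J_integrable: "0 < s \<Longrightarrow> s \<le> t \<Longrightarrow> integrable lborel (\<lambda>x. wt x * base t s x powr p)"
  by (rule wt_mult_integrable[of _ "t powr p"])
    (use base_powr_p_bounds[of s t] in \<open>auto simp: base_def\<close>)

lemma J'_integrable: "0 < s \<Longrightarrow> s \<le> t \<Longrightarrow> integrable lborel (\<lambda>x. wt x * (p * x * base t s x powr (p - 1)))"
  by (rule wt_mult_integrable[of _ "p * s powr (p - 1)"])
    (use base_powr_p1_bounds[of s t] p in \<open>auto simp: base_def\<close>)

lemma J_nonneg: "0 \<le> J t s"
  unfolding J_def by (rule integral_nonneg_AE) (simp add: wt_nonneg)

lemma J'_nonneg: "0 < s \<Longrightarrow> s \<le> t \<Longrightarrow> 0 \<le> J' t s"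
proof -
  assume st: "0 < s" "s \<le> t"
  have "0 \<le> wt x * (p * x * base t s x powr (p - 1))" for x
  proof (cases "x \<in> {0..1}")
    case True
    then have "0 \<le> p * x * base t s x powr (p - 1)" by (intro base_powr_p1_bounds(1)[OF st]) auto
    then show ?thesis by (rule mult_nonneg_nonneg[OF wt_nonneg])
  qed (simp add: wt_def)
  then show ?thesis unfolding J'_def by (intro integral_nonneg_AE) simp
qed

lemma J_le: "0 < s \<Longrightarrow> s \<le> t \<Longrightarrow> J t s \<le> B0 * t powr p"
proof -
  assume st: "0 < s" "s \<le> t"
  have "J t s \<le> (\<integral>x. wt x * t powr p \<partial>lborel)"
    unfolding J_def
  proof (rule integral_mono[OF J_integrable[OF st]])
    show "integrable lborel (\<lambda>x. wt x * t powr p)" using wt_integrable by simp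
    fix x show "wt x * base t s x powr p \<le> wt x * t powr p"
    proof (cases "x \<in> {0..1}")
      case True
      then show ?thesis using base_powr_p_bounds[OF st, of x] by (intro mult_left_mono wt_nonneg) auto
    qed (simp add: wt_def)
  qed
  then show ?thesis by (simp add: B0_def)
qed

text \<open>The factor \<open>t - s\<close> is absorbed by the integrand: \<open>(t - s) * x\<close>
  is at most \<open>base t s x\<close>, which raises the exponent p - 1 to p. The bound thus avoids
  the singularity of \<open>s powr (p - 1)\<close> at s = 0.\<close>

lemma J'_le: "0 < s \<Longrightarrow> s < t \<Longrightarrow> (t - s) * J' t s \<le> p * B0 * t powr p"
proof -
  assume st: "0 < s" "s < t"
  have st': "s \<le> t" using st by simp
  have "(t - s) * J' t s = (\<integral>x. (t - s) * (wt x * (p * x * base t s x powr (p - 1))) \<partial>lborel)"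
    by (simp add: J'_def)
  also have "\<dots> \<le> (\<integral>x. wt x * (p * t powr p) \<partial>lborel)"
  proof (rule integral_mono)
    show "integrable lborel (\<lambda>x. (t - s) * (wt x * (p * x * base t s x powr (p - 1))))"
      using J'_integrable[OF st(1) st'] by simp
    show "integrable lborel (\<lambda>x. wt x * (p * t powr p))" using wt_integrable by simp
    fix x show "(t - s) * (wt x * (p * x * base t s x powr (p - 1))) \<le> wt x * (p * t powr p)"
    proof (cases "x \<in> {0..1}")
      case True
      note b = base_bounds[OF st(1) st', of x]
      have pos: "0 < base t s x" using b True st by auto
      have "(t - s) * x * base t s x powr (p - 1) \<le> base t s x * base t s x powr (p - 1)"
        using st by (intro mult_right_mono) (auto simp: base_def)
      also have "\<dots> = base t s x powr p" using pos powr_add[of "base t s x" 1 "p - 1"] by simp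
      also have "\<dots> \<le> t powr p" using base_powr_p_bounds[OF st(1) st', of x] True by simp
      finally have "wt x * (p * ((t - s) * x * base t s x powr (p - 1))) \<le> wt x * (p * t powr p)"
        using p by (intro mult_left_mono wt_nonneg) auto
      then show ?thesis by (simp add: ac_simps)
    qed (simp add: wt_def)
  qed
  finally show ?thesis by (simp add: B0_def ac_simps)
qed

lemma powr_diff_bound:
  assumes "0 < s" "s \<le> y" "s \<le> z"
  shows "\<bar>y powr p - z powr p\<bar> \<le> p * s powr (p - 1) * \<bar>y - z\<bar>"
proof -
  have "norm (y powr p - z powr p) \<le> p * s powr (p - 1) * norm (y - z)"
  proof (rule field_differentiable_bound[where S = "{s..}" and f' = "\<lambda>x. p * x powr (p - 1)"])
    fix x assume x: "x \<in> {s..}"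
    then show "((\<lambda>x. x powr p) has_field_derivative p * x powr (p - 1)) (at x within {s..})"
      using assms by (auto intro!: derivative_eq_intros)
    have "x powr (p - 1) \<le> s powr (p - 1)" using x assms p by (intro powr_mono2') auto
    then show "norm (p * x powr (p - 1)) \<le> p * s powr (p - 1)" using p by simp
  qed (use assms in auto)
  then show ?thesis by simp
qed

text \<open>Differentiation under the integral sign along sequences. The approach is kept inside
  \<open>{s<..}\<close>, where \<open>base\<close> stays at or above s for x in the unit interval
  and the mean value theorem gives the majorant \<open>wt x * (p * s powr (p - 1))\<close>.\<close>

lemma J_deriv:
  assumes st: "0 < s" "s < t"
  shows "((\<lambda>t. J t s) has_real_derivative J' t s) (at t)"
proof -
  have "((\<lambda>y. (J y s - J t s) / (y - t)) \<longlongrightarrow> J' t s) (at t within {s<..})"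
    unfolding tendsto_at_iff_sequentially
  proof (intro allI impI)
    fix X assume X: "\<forall>i. X i \<in> {s<..} - {t}" and lim: "X \<longlonglongrightarrow> t"
    have Xs: "s < X i" "X i \<noteq> t" for i using X by auto
    have eq: "(J (X i) s - J t s) / (X i - t)
        = (\<integral>x. wt x * ((base (X i) s x powr p - base t s x powr p) / (X i - t)) \<partial>lborel)" for i
    proof -
      have "J (X i) s - J t s = (\<integral>x. wt x * base (X i) s x powr p - wt x * base t s x powr p \<partial>lborel)"
        unfolding J_def
        by (rule Bochner_Integration.integral_diff[symmetric]; rule J_integrable) (use Xs[of i] st in auto)
      then have "(J (X i) s - J t s) / (X i - t)
          = (\<integral>x. (wt x * base (X i) s x powr p - wt x * base t s x powr p) / (X i - t) \<partial>lborel)" by simp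
      also have "\<dots> = (\<integral>x. wt x * ((base (X i) s x powr p - base t s x powr p) / (X i - t)) \<partial>lborel)"
        by (rule Bochner_Integration.integral_cong) (auto simp: right_diff_distrib)
      finally show ?thesis .
    qed
    have "(\<lambda>i. \<integral>x. wt x * ((base (X i) s x powr p - base t s x powr p) / (X i - t)) \<partial>lborel) \<longlonglongrightarrow> J' t s"
      unfolding J'_def
    proof (rule integral_dominated_convergence[where w = "\<lambda>x. wt x * (p * s powr (p - 1))"])
      show "integrable lborel (\<lambda>x. wt x * (p * s powr (p - 1)))" using wt_integrable by simp
      show "AE x in lborel. (\<lambda>i. wt x * ((base (X i) s x powr p - base t s x powr p) / (X i - t)))
          \<longlonglongrightarrow> wt x * (p * x * base t s x powr (p - 1))"
      proof (rule AE_I2)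
        fix x
        show "(\<lambda>i. wt x * ((base (X i) s x powr p - base t s x powr p) / (X i - t)))
          \<longlonglongrightarrow> wt x * (p * x * base t s x powr (p - 1))"
        proof (cases "x \<in> {0..1}")
          case True
          have pos: "0 < base t s x" using base_bounds[of s t x] True st by auto
          have "((\<lambda>y. base y s x powr p) has_real_derivative p * x * base t s x powr (p - 1)) (at t)"
            using pos unfolding base_def by (auto intro!: derivative_eq_intros)
          then have "((\<lambda>y. (base y s x powr p - base t s x powr p) / (y - t)) \<longlongrightarrow> p * x * base t s x powr (p - 1)) (at t)"
            by (simp add: has_field_derivative_iff)
          then have "(\<lambda>i. (base (X i) s x powr p - base t s x powr p) / (X i - t)) \<longlonglongrightarrow> p * x * base t s x powr (p - 1)"
            using lim Xs by (auto simp: tendsto_at_iff_sequentially comp_def)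
          then show ?thesis by (intro tendsto_mult tendsto_const)
        qed (simp add: wt_def)
      qed
      show "AE x in lborel. norm (wt x * ((base (X i) s x powr p - base t s x powr p) / (X i - t))) \<le> wt x * (p * s powr (p - 1))" for i
      proof (rule AE_I2)
        fix x
        show "norm (wt x * ((base (X i) s x powr p - base t s x powr p) / (X i - t))) \<le> wt x * (p * s powr (p - 1))"
        proof (cases "x \<in> {0..1}")
          case True
          have "\<bar>base (X i) s x powr p - base t s x powr p\<bar> \<le> p * s powr (p - 1) * \<bar>base (X i) s x - base t s x\<bar>"
            by (rule powr_diff_bound) (use base_bounds[of s t x] base_bounds[of s "X i" x] True st Xs[of i] in auto)
          also have "base (X i) s x - base t s x = (X i - t) * x" by (simp add: base_def algebra_simps)
          also have "p * s powr (p - 1) * \<bar>(X i - t) * x\<bar> \<le> p * s powr (p - 1) * (\<bar>X i - t\<bar> * 1)"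
            unfolding abs_mult using True p by (intro mult_left_mono) auto
          finally have "\<bar>(base (X i) s x powr p - base t s x powr p) / (X i - t)\<bar> \<le> p * s powr (p - 1)"
            using Xs[of i] by (simp add: divide_simps)
          then show ?thesis unfolding real_norm_def abs_mult[of "wt x"] abs_of_nonneg[OF wt_nonneg]
            by (rule mult_left_mono[OF _ wt_nonneg])
        qed (simp add: wt_def)
      qed
    qed (auto simp: base_def)
    then show "((\<lambda>y. (J y s - J t s) / (y - t)) \<circ> X) \<longlonglongrightarrow> J' t s"
      by (simp add: comp_def eq)
  qed
  then have "((\<lambda>y. (J y s - J t s) / (y - t)) \<longlongrightarrow> J' t s) (at t)"
    using st by (simp add: at_within_open[of t "{s<..}"])
  then show ?thesis by (simp add: has_field_derivative_iff)
qed

text \<open>Powers of t - s under the substitution: the two singular factors contribute (1/2 - H1) +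
  (H2 - 3/2) = p - 1, and the Jacobian one more.\<close>

lemma K12_eq:
  assumes st: "0 < s" "s < t"
  shows "K12 H1 H2 t s = betaH H2 * s powr (- q) * ((t - s) powr p * J t s)"
proof -
  let ?G = "\<lambda>u. indicator {s..t} u * ((t - u) powr (1/2 - H1) * u powr (H2 - H1) * (u - s) powr (H2 - 3/2))"
  have "(\<integral>u. ?G u \<partial>lborel) = \<bar>t - s\<bar> *\<^sub>R (\<integral>x. ?G (s + (t - s) * x) \<partial>lborel)"
    by (rule lborel_integral_real_affine) (use st in simp)
  also have "(\<integral>x. ?G (s + (t - s) * x) \<partial>lborel) = (\<integral>x. (t - s) powr (p - 1) * (wt x * base t s x powr p) \<partial>lborel)"
  proof (rule Bochner_Integration.integral_cong)
    fix x
    show "?G (s + (t - s) * x) = (t - s) powr (p - 1) * (wt x * base t s x powr p)"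
    proof (cases "x \<in> {0..1}")
      case True
      then have x: "0 \<le> x" "x \<le> 1" by auto
      have ind: "s + (t - s) * x \<in> {s..t}" using base_bounds[of s t x] st x by (auto simp: base_def)
      have 1: "t - (s + (t - s) * x) = (t - s) * (1 - x)" by (simp add: algebra_simps)
      have 2: "s + (t - s) * x - s = (t - s) * x" by simp
      have "(t - s) powr (1/2 - H1) * (t - s) powr (H2 - 3/2) = (t - s) powr (p - 1)"
        by (simp add: p_def algebra_simps flip: powr_add)
      moreover have "((t - s) * (1 - x)) powr (1/2 - H1) = (t - s) powr (1/2 - H1) * (1 - x) powr (1/2 - H1)"
        by (rule powr_mult)
      moreover have "((t - s) * x) powr (H2 - 3/2) = (t - s) powr (H2 - 3/2) * x powr (H2 - 3/2)"
        by (rule powr_mult)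
      ultimately show ?thesis
        using ind True unfolding 1 2 wt_def p_def[symmetric] base_def
        by (simp add: ac_simps)
    next
      case False
      have "s + (t - s) * x \<notin> {s..t}"
      proof (cases "x < 0")
        case True
        then show ?thesis using mult_pos_neg[of "t - s" x] st by auto
      next
        case F: False
        then have "(t - s) * 1 < (t - s) * x" using False st by (intro mult_strict_left_mono) auto
        then show ?thesis by auto
      qed
      then show ?thesis using False by (simp add: wt_def)
    qed
  qed simp
  also have "\<dots> = (t - s) powr (p - 1) * J t s" by (simp add: J_def)
  also have "\<bar>t - s\<bar> *\<^sub>R ((t - s) powr (p - 1) * J t s) = (t - s) powr p * J t s"
    using st powr_add[of "t - s" 1 "p - 1"] by simp
  finally have "(LINT u:{s..t}|lborel. (t - u) powr (1/2 - H1) * u powr (H2 - H1) * (u - s) powr (H2 - 3/2)) = (t - s) powr p * J t s"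
    by (simp add: set_lebesgue_integral_def)
  then show ?thesis using st by (simp add: K12_def q_def)
qed

section \<open>The time derivative of the kernel\<close>

definition D :: "real \<Rightarrow> real \<Rightarrow> real" where
  "D t s = (if 0 < s \<and> s < t then
     betaH H2 * s powr (- q) * (p * (t - s) powr (p - 1) * J t s + (t - s) powr p * J' t s) else 0)"

lemma K12_deriv:
  assumes st: "0 < s" "s < t"
  shows "((\<lambda>t. K12 H1 H2 t s) has_real_derivative D t s) (at t)"
proof (rule has_field_derivative_transform_within_open[where S = "{s<..}"])
  show "((\<lambda>t. betaH H2 * s powr (- q) * ((t - s) powr p * J t s)) has_real_derivative D t s) (at t)"
    using st by (auto intro!: derivative_eq_intros J_deriv simp: D_def algebra_simps)
qed (use st K12_eq in auto)

text \<open>\<open>D\<close> is set to 0 off the region 0 < s < t. On the diagonal the value of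
  \<open>deriv\<close> is left uncontrolled, so t = s is excluded here and integrals containing
  \<open>dK12\<close> are later compared off one point.\<close>

lemma dK12_eq: "0 < s \<Longrightarrow> t \<noteq> s \<Longrightarrow> dK12 H1 H2 t s = D t s"
proof (cases "s < t")
  case True
  assume "0 < s"
  then show ?thesis using K12_deriv[OF _ True] by (simp add: dK12_def DERIV_imp_deriv)
next
  case False
  assume "0 < s" "t \<noteq> s"
  with False have ts: "t < s" by simp
  have "((\<lambda>t. K12 H1 H2 t s) has_real_derivative 0) (at t)"
    by (rule has_field_derivative_transform_within_open[of "\<lambda>_. 0" _ _ "{..<s}"])
      (use ts in \<open>auto simp: K12_def\<close>)
  then show ?thesis using ts by (simp add: dK12_def DERIV_imp_deriv D_def)
qed

lemma dK12_nonpos: "s \<le> 0 \<Longrightarrow> dK12 H1 H2 t s = 0"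
  by (simp add: dK12_def K12_def)

lemma D_nonneg: "0 \<le> D t s"
  using betaH_nonneg p J_nonneg[of t s] J'_nonneg[of s t] by (auto simp: D_def)

text \<open>The product rule has two terms, and each contributes \<open>p * B0\<close>.\<close>

definition CD where "CD = betaH H2 * (2 * p * B0)"

lemma CD_nonneg: "0 \<le> CD"
  using betaH_nonneg p B0_nonneg by (simp add: CD_def)

lemma D_le:
  assumes st: "0 < s" "s < t"
  shows "D t s \<le> CD * (s powr (- q) * t powr p * (t - s) powr (p - 1))"
proof -
  have e: "(t - s) powr p = (t - s) powr (p - 1) * (t - s)"
    using st powr_add[of "t - s" "p - 1" 1] by simp
  have "p * (t - s) powr (p - 1) * J t s + (t - s) powr p * J' t s
      = (t - s) powr (p - 1) * (p * J t s + (t - s) * J' t s)"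
    unfolding e by (simp add: algebra_simps)
  also have "\<dots> \<le> (t - s) powr (p - 1) * (p * (B0 * t powr p) + p * B0 * t powr p)"
    using J_le[of s t] J'_le[of s t] st p by (intro mult_left_mono add_mono) auto
  finally have "betaH H2 * s powr (- q) * (p * (t - s) powr (p - 1) * J t s + (t - s) powr p * J' t s)
     \<le> betaH H2 * s powr (- q) * ((t - s) powr (p - 1) * (p * (B0 * t powr p) + p * B0 * t powr p))"
    using betaH_nonneg by (intro mult_left_mono) auto
  also have "\<dots> = CD * (s powr (- q) * t powr p * (t - s) powr (p - 1))"
    by (simp add: CD_def algebra_simps)
  finally show ?thesis using st by (simp add: D_def)
qed

lemma D_measurable [measurable]: "(\<lambda>x. D (fst x) (snd x)) \<in> borel_measurable (borel \<Otimes>\<^sub>M borel)"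
proof -
  have [measurable]: "(\<lambda>x. J (fst x) (snd x)) \<in> borel_measurable (borel \<Otimes>\<^sub>M borel)"
    "(\<lambda>x. J' (fst x) (snd x)) \<in> borel_measurable (borel \<Otimes>\<^sub>M borel)"
    unfolding J_def J'_def base_def by measurable
  show ?thesis unfolding D_def by measurable
qed

lemma D_measurable' [measurable (raw)]:
  assumes [measurable]: "f \<in> borel_measurable M" "g \<in> borel_measurable M"
  shows "(\<lambda>x. D (f x) (g x)) \<in> borel_measurable M"
  using measurable_compose[OF measurable_Pair[OF assms] D_measurable] by simp

text \<open>The derivative is singular at t = s, so the fundamental theorem is applied on the
  interior, together with continuity at the left endpoint, where \<open>K12\<close> is bounded by a
  multiple of \<open>(y - s) powr p\<close>.\<close>

lemma D_has_integral:
  assumes s: "0 < s" and su: "s \<le> u"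
  shows "((\<lambda>t. D t s) has_integral K12 H1 H2 u s) {s..u}"
proof -
  have "((\<lambda>t. D t s) has_integral (K12 H1 H2 u s - K12 H1 H2 s s)) {s..u}"
  proof (rule fundamental_theorem_of_calculus_interior[OF su])
    show "((\<lambda>t. K12 H1 H2 t s) has_vector_derivative D t s) (at t)" if "t \<in> {s<..<u}" for t
      using K12_deriv[OF s, of t] that by (simp add: has_real_derivative_iff_has_vector_derivative)
    show "continuous_on {s..u} (\<lambda>t. K12 H1 H2 t s)"
      unfolding continuous_on_eq_continuous_within
    proof
      fix t assume t: "t \<in> {s..u}"
      show "continuous (at t within {s..u}) (\<lambda>t. K12 H1 H2 t s)"
      proof (cases "t = s")
        case False
        then show ?thesis
          using t by (intro continuous_at_imp_continuous_at_within[OF DERIV_isCont[OF K12_deriv[OF s]]]) auto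
      next
        case True
        define c where "c = betaH H2 * s powr (- q) * (B0 * u powr p)"
        have "((\<lambda>y. K12 H1 H2 y s) \<longlongrightarrow> 0) (at s within {s..u})"
        proof (rule Lim_null_comparison)
          have "\<bar>K12 H1 H2 y s\<bar> \<le> c * (y - s) powr p" if y: "y \<in> {s..u}" for y
          proof (cases "y = s")
            case False
            then have sy: "s < y" "y \<le> u" using y by auto
            have "J y s \<le> B0 * y powr p" using J_le[of s y] s sy by simp
            also have "\<dots> \<le> B0 * u powr p" using sy s p B0_nonneg by (intro mult_left_mono powr_mono2) auto
            finally have "betaH H2 * s powr (- q) * ((y - s) powr p * J y s)
                \<le> betaH H2 * s powr (- q) * ((y - s) powr p * (B0 * u powr p))"
              using betaH_nonneg by (intro mult_left_mono) auto
            then show ?thesis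
              using K12_eq[OF s sy(1)] betaH_nonneg J_nonneg[of y s] by (simp add: c_def ac_simps abs_mult)
          qed (simp add: K12_def)
          then show "\<forall>\<^sub>F y in at s within {s..u}. norm (K12 H1 H2 y s) \<le> c * (y - s) powr p"
            by (auto simp: eventually_at_filter)
          have "((\<lambda>y. (y - s) powr p) \<longlongrightarrow> 0) (at s within {s..u})"
          proof (rule tendsto_zero_powrI[where b = p])
            have "((\<lambda>y. y - s) \<longlongrightarrow> s - s) (at s within {s..u})"
              by (intro tendsto_diff tendsto_ident_at tendsto_const)
            then show "((\<lambda>y. y - s) \<longlongrightarrow> 0) (at s within {s..u})" by simp
            show "\<forall>\<^sub>F y in at s within {s..u}. 0 \<le> y - s"
              by (simp add: eventually_at_filter)
          qed (use p in auto)
          then show "((\<lambda>y. c * (y - s) powr p) \<longlongrightarrow> 0) (at s within {s..u})"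
            by (rule tendsto_mult_right_zero)
        qed
        then show ?thesis using True by (simp add: continuous_within K12_def)
      qed
    qed
  qed
  then show ?thesis by (simp add: K12_def)
qed

lemma nn_integral_D:
  assumes "0 \<le> s" "0 \<le> u"
  shows "(\<integral>\<^sup>+t. ennreal (upto_ind u t * D t s) \<partial>lborel) = ennreal (K12 H1 H2 u s)"
proof (cases "0 < s \<and> s \<le> u")
  case True
  have "(\<integral>\<^sup>+t. ennreal (upto_ind u t * D t s) \<partial>lborel) = (\<integral>\<^sup>+t. ennreal (D t s) * indicator {s..u} t \<partial>lborel)"
    using True by (intro nn_integral_cong) (auto simp: indicator_def D_def)
  also have "\<dots> = ennreal (K12 H1 H2 u s)"
    by (rule nn_integral_has_integral_lebesgue'[OF D_nonneg D_has_integral]) (use True in auto)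
  finally show ?thesis .
next
  case False
  then have "K12 H1 H2 u s = 0" and z: "\<And>t. ennreal (upto_ind u t * D t s) = 0"
    using assms by (auto simp: K12_def D_def indicator_def)
  then show ?thesis unfolding z by simp
qed

lemma K12_nonneg: "0 \<le> K12 H1 H2 u s"
proof (cases "0 < s \<and> s < u")
  case True
  then show ?thesis using K12_eq[of s u] betaH_nonneg J_nonneg[of u s] by simp
next
  case False
  show ?thesis by (simp only: K12_def False if_False order_refl)
qed

lemma K12_measurable [measurable]: "K12 H1 H2 u \<in> borel_measurable borel"
proof -
  have "K12 H1 H2 u = (\<lambda>s. if 0 < s \<and> s < u then betaH H2 * s powr (- q) * ((u - s) powr p * J u s) else 0)"
    by (rule ext) (use K12_eq in \<open>auto simp: K12_def\<close>)
  moreover have [measurable]: "(\<lambda>s. J u s) \<in> borel_measurable borel"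
    unfolding J_def base_def by measurable
  have "(\<lambda>s. if 0 < s \<and> s < u then betaH H2 * s powr (- q) * ((u - s) powr p * J u s) else 0) \<in> borel_measurable borel"
    by measurable
  ultimately show ?thesis by simp
qed


section \<open>Schur's test for the derivative kernel\<close>

definition c1 where "c1 T = T powr p / p"
definition c2 where "c2 T = T powr p * Beta (1 - 2 * q) p"

text \<open>The majorant of \<open>D\<close>, up to a constant, for use with the weighted function
  \<open>h t * t powr (1/2 - H1)\<close>. Since p = q + (1/2 - H1), passing to the weight turns
  \<open>t powr p\<close> into \<open>t powr q\<close>, and the test can be run in unweighted
  L2.\<close>

definition kernel :: "real \<Rightarrow> real \<Rightarrow> real \<Rightarrow> real" where
  "kernel T t s = (if 0 < s \<and> s < t \<and> t \<le> T then s powr (- q) * t powr q * (t - s) powr (p - 1) else 0)"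

lemma kernel_nonneg: "0 \<le> kernel T t s"
  by (simp add: kernel_def)

lemma kernel_measurable [measurable (raw)]:
  assumes [measurable]: "f \<in> borel_measurable M" "g \<in> borel_measurable M"
  shows "(\<lambda>x. kernel T (f x) (g x)) \<in> borel_measurable M"
  unfolding kernel_def by measurable

lemma Beta_pos: "0 < a \<Longrightarrow> 0 < b \<Longrightarrow> 0 < Beta a (b::real)"
  unfolding Beta_def by (intro divide_pos_pos mult_pos_pos Gamma_real_pos) auto

lemma c_nonneg: "0 \<le> c1 T" "0 \<le> c2 T"
  using p q Beta_pos[of "1 - 2 * q" p] by (simp_all add: c1_def c2_def)

text \<open>The test function cancels \<open>t powr q\<close>. What remains is the integral of
  \<open>x powr (p - 1)\<close> over an interval of length at most T, the origin of
  \<open>c1\<close>.\<close>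

lemma schur_row:
  assumes s: "0 < s"
  shows "(\<integral>\<^sup>+t. ennreal (kernel T t s * t powr (- q)) \<partial>lborel) \<le> ennreal (c1 T * s powr (- q))"
proof (cases "s < T")
  case False
  then have z: "ennreal (kernel T t s * t powr (- q)) = 0" for t by (simp add: kernel_def)
  show ?thesis unfolding z by simp
next
  case True
  have "(\<integral>\<^sup>+t. ennreal (kernel T t s * t powr (- q)) \<partial>lborel)
      = ennreal \<bar>1\<bar> * (\<integral>\<^sup>+x. ennreal (kernel T (s + 1 * x) s * (s + 1 * x) powr (- q)) \<partial>lborel)"
    by (rule nn_integral_real_affine) auto
  also have "\<dots> = (\<integral>\<^sup>+x. ennreal (kernel T (s + 1 * x) s * (s + 1 * x) powr (- q)) \<partial>lborel)" by simp
  also have "\<dots> \<le> (\<integral>\<^sup>+x. ennreal (s powr (- q)) * (ennreal (x powr (p - 1)) * indicator {0..T - s} x) \<partial>lborel)"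
  proof (rule nn_integral_mono)
    fix x
    show "ennreal (kernel T (s + 1 * x) s * (s + 1 * x) powr (- q))
        \<le> ennreal (s powr (- q)) * (ennreal (x powr (p - 1)) * indicator {0..T - s} x)"
    proof (cases "0 < x \<and> x \<le> T - s")
      case True
      then have "(s + x) powr q * (s + x) powr (- q) = 1" using s by (simp flip: powr_add)
      then have "kernel T (s + 1 * x) s * (s + 1 * x) powr (- q) = s powr (- q) * x powr (p - 1)"
        using True s unfolding kernel_def by (simp add: ac_simps)
      then show ?thesis using True by (simp add: ennreal_mult)
    next
      case False
      then have "kernel T (s + 1 * x) s = 0" by (auto simp: kernel_def)
      then show ?thesis by simp
    qed
  qed
  also have "\<dots> = ennreal (s powr (- q)) * (\<integral>\<^sup>+x. ennreal (x powr (p - 1)) * indicator {0..T - s} x \<partial>lborel)"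
    by (rule nn_integral_cmult) measurable
  also have "(\<integral>\<^sup>+x. ennreal (x powr (p - 1)) * indicator {0..T - s} x \<partial>lborel)
      = ennreal ((T - s) powr (p - 1 + 1) / (p - 1 + 1))"
    by (rule nn_integral_has_integral_lebesgue'[OF _ has_integral_powr_from_0]) (use p True in auto)
  also have "ennreal (s powr (- q)) * \<dots> = ennreal (s powr (- q) * ((T - s) powr p / p))"
    using p by (simp flip: ennreal_mult)
  also have "\<dots> \<le> ennreal (s powr (- q) * c1 T)"
    unfolding c1_def using p s True
    by (intro ennreal_leI mult_left_mono divide_right_mono powr_mono2) auto
  finally show ?thesis by (simp add: mult.commute)
qed

text \<open>Scaling s = t x leaves a Beta integral with parameters 1 - 2 q and p, the origin of
  \<open>c2\<close>; it converges at 0 because H2 < 1.\<close>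

lemma schur_col:
  assumes t: "0 < t" "t \<le> T"
  shows "(\<integral>\<^sup>+s. ennreal (kernel T t s * s powr (- q)) \<partial>lborel) \<le> ennreal (c2 T * t powr (- q))"
proof -
  have "(\<integral>\<^sup>+s. ennreal (kernel T t s * s powr (- q)) \<partial>lborel)
      = ennreal \<bar>t\<bar> * (\<integral>\<^sup>+x. ennreal (kernel T t (0 + t * x) * (0 + t * x) powr (- q)) \<partial>lborel)"
    by (rule nn_integral_real_affine) (use t in auto)
  also have "\<dots> \<le> ennreal t * (\<integral>\<^sup>+x. ennreal (t powr (p - 1 - q)) *
      (ennreal (x powr (1 - 2 * q - 1) * (1 - x) powr (p - 1)) * indicator {0..1} x) \<partial>lborel)"
    unfolding abs_of_pos[OF t(1)]
  proof (rule mult_left_mono[OF nn_integral_mono])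
    fix x
    show "ennreal (kernel T t (0 + t * x) * (0 + t * x) powr (- q))
       \<le> ennreal (t powr (p - 1 - q)) * (ennreal (x powr (1 - 2 * q - 1) * (1 - x) powr (p - 1)) * indicator {0..1} x)"
    proof (cases "0 < x \<and> x < 1")
      case True
      have d: "t - t * x = t * (1 - x)" by (simp add: algebra_simps)
      have e1: "t powr (- q) * t powr (- q) * t powr q * t powr (p - 1) = t powr (p - 1 - q)"
        by (simp add: algebra_simps flip: powr_add)
      have e2: "x powr (- q) * x powr (- q) = x powr (1 - 2 * q - 1)"
        by (simp add: algebra_simps flip: powr_add)
      have "kernel T t (0 + t * x) * (0 + t * x) powr (- q)
          = (t powr (- q) * x powr (- q)) * t powr q * (t powr (p - 1) * (1 - x) powr (p - 1)) * (t powr (- q) * x powr (- q))"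
        using True t unfolding kernel_def by (simp add: d powr_mult)
      also have "\<dots> = (t powr (- q) * t powr (- q) * t powr q * t powr (p - 1)) * (x powr (- q) * x powr (- q) * (1 - x) powr (p - 1))"
        by (simp only: ac_simps)
      also have "\<dots> = t powr (p - 1 - q) * (x powr (1 - 2 * q - 1) * (1 - x) powr (p - 1))"
        unfolding e1 e2 by simp
      finally show ?thesis using True by (simp add: ennreal_mult)
    next
      case False
      then have "kernel T t (0 + t * x) = 0" using t by (auto simp: kernel_def zero_less_mult_iff)
      then show ?thesis by simp
    qed
  qed simp
  also have "\<dots> = ennreal t * (ennreal (t powr (p - 1 - q)) *
      (\<integral>\<^sup>+x. ennreal (x powr (1 - 2 * q - 1) * (1 - x) powr (p - 1)) * indicator {0..1} x \<partial>lborel))"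
    by (subst nn_integral_cmult) auto
  also have "(\<integral>\<^sup>+x. ennreal (x powr (1 - 2 * q - 1) * (1 - x) powr (p - 1)) * indicator {0..1} x \<partial>lborel) = ennreal (Beta (1 - 2 * q) p)"
    by (rule nn_integral_has_integral_lebesgue'[OF _ has_integral_Beta_real]) (use p q in auto)
  also have "ennreal t * (ennreal (t powr (p - 1 - q)) * ennreal (Beta (1 - 2 * q) p)) = ennreal (t * t powr (p - 1 - q) * Beta (1 - 2 * q) p)"
    using t Beta_pos[of "1 - 2 * q" p] p q by (simp add: ennreal_mult mult.assoc)
  also have "t * t powr (p - 1 - q) = t powr p * t powr (- q)"
  proof -
    have "t * t powr (p - 1 - q) = t powr (1 + (p - 1 - q))" using t by (simp only: powr_add powr_one)
    also have "1 + (p - 1 - q) = p + - q" by simp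
    finally show ?thesis by (simp only: powr_add)
  qed
  also have "ennreal (t powr p * t powr (- q) * Beta (1 - 2 * q) p) \<le> ennreal (c2 T * t powr (- q))"
  proof (rule ennreal_leI)
    have "t powr p * (t powr (- q) * Beta (1 - 2 * q) p) \<le> T powr p * (t powr (- q) * Beta (1 - 2 * q) p)"
      using t p q Beta_pos[of "1 - 2 * q" p] by (intro mult_right_mono powr_mono2) auto
    then show "t powr p * t powr (- q) * Beta (1 - 2 * q) p \<le> c2 T * t powr (- q)"
      by (simp add: c2_def ac_simps)
  qed
  finally show ?thesis .
qed

text \<open>Schur's test for the kernel with the test function \<open>s powr (- q)\<close> in both variables.\<close>

lemma schur_test:
  assumes [measurable]: "g \<in> borel_measurable borel"
  shows "(\<integral>\<^sup>+s. (\<integral>\<^sup>+t. ennreal (kernel T t s * \<bar>g t\<bar>) \<partial>lborel)\<^sup>2 \<partial>lborel)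
    \<le> ennreal (c1 T * c2 T) * (\<integral>\<^sup>+t. ennreal ((g t)\<^sup>2) * indicator {0..T} t \<partial>lborel)"
proof -
  have row: "(\<integral>\<^sup>+t. ennreal (kernel T t s * \<bar>g t\<bar>) \<partial>lborel)\<^sup>2
      \<le> (\<integral>\<^sup>+t. ennreal (c1 T * s powr (- q)) * ennreal (kernel T t s * (t powr q * (g t)\<^sup>2)) \<partial>lborel)" for s
  proof (cases "0 < s")
    case False
    then have z: "ennreal (kernel T t s * \<bar>g t\<bar>) = 0" for t by (simp add: kernel_def)
    show ?thesis unfolding z by simp
  next
    case True
    \<comment> \<open>The kernel is split into square roots, with the test function in one factor
      and its reciprocal in the other; Cauchy-Schwarz then turns the first factor into the row
      integral.\<close>
    let ?f = "\<lambda>t. ennreal (sqrt (kernel T t s * t powr (- q)))"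
    let ?h = "\<lambda>t. ennreal (sqrt (kernel T t s * t powr q) * \<bar>g t\<bar>)"
    have "ennreal (kernel T t s * \<bar>g t\<bar>) = ?f t * ?h t" for t
    proof (cases "0 < t")
      case False
      then have "kernel T t s = 0" using True by (simp add: kernel_def)
      then show ?thesis by simp
    next
      case t: True
      have "t powr (- q) * t powr q = 1" using t by (simp flip: powr_add)
      then have "(kernel T t s * t powr (- q)) * (kernel T t s * t powr q) = (kernel T t s)\<^sup>2"
        by (simp add: power2_eq_square ac_simps)
      then have "sqrt (kernel T t s * t powr (- q)) * sqrt (kernel T t s * t powr q) = kernel T t s"
        by (simp add: kernel_nonneg flip: real_sqrt_mult)
      then show ?thesis by (simp add: kernel_nonneg flip: ennreal_mult mult.assoc)
    qed
    then have "(\<integral>\<^sup>+t. ennreal (kernel T t s * \<bar>g t\<bar>) \<partial>lborel)\<^sup>2 = (\<integral>\<^sup>+t. ?f t * ?h t \<partial>lborel)\<^sup>2" by simp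
    also have "\<dots> \<le> (\<integral>\<^sup>+t. (?f t)\<^sup>2 \<partial>lborel) * (\<integral>\<^sup>+t. (?h t)\<^sup>2 \<partial>lborel)"
      by (rule Cauchy_Schwarz_nn_integral) auto
    also have "(\<integral>\<^sup>+t. (?f t)\<^sup>2 \<partial>lborel) = (\<integral>\<^sup>+t. ennreal (kernel T t s * t powr (- q)) \<partial>lborel)"
      by (simp add: ennreal_power kernel_nonneg)
    also have "(\<integral>\<^sup>+t. (?h t)\<^sup>2 \<partial>lborel) = (\<integral>\<^sup>+t. ennreal (kernel T t s * (t powr q * (g t)\<^sup>2)) \<partial>lborel)"
      by (simp add: ennreal_power kernel_nonneg power_mult_distrib mult.assoc)
    also have "(\<integral>\<^sup>+t. ennreal (kernel T t s * t powr (- q)) \<partial>lborel) * (\<integral>\<^sup>+t. ennreal (kernel T t s * (t powr q * (g t)\<^sup>2)) \<partial>lborel)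
       \<le> ennreal (c1 T * s powr (- q)) * (\<integral>\<^sup>+t. ennreal (kernel T t s * (t powr q * (g t)\<^sup>2)) \<partial>lborel)"
      by (rule mult_right_mono[OF schur_row[OF True]]) simp
    also have "\<dots> = (\<integral>\<^sup>+t. ennreal (c1 T * s powr (- q)) * ennreal (kernel T t s * (t powr q * (g t)\<^sup>2)) \<partial>lborel)"
      by (rule nn_integral_cmult[symmetric]) measurable
    finally show ?thesis .
  qed
  have "(\<integral>\<^sup>+s. (\<integral>\<^sup>+t. ennreal (kernel T t s * \<bar>g t\<bar>) \<partial>lborel)\<^sup>2 \<partial>lborel)
      \<le> (\<integral>\<^sup>+s. \<integral>\<^sup>+t. ennreal (c1 T * s powr (- q)) * ennreal (kernel T t s * (t powr q * (g t)\<^sup>2)) \<partial>lborel \<partial>lborel)"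
    by (rule nn_integral_mono) (rule row)
  also have "\<dots> = (\<integral>\<^sup>+t. \<integral>\<^sup>+s. ennreal (c1 T * s powr (- q)) * ennreal (kernel T t s * (t powr q * (g t)\<^sup>2)) \<partial>lborel \<partial>lborel)"
    by (rule lborel_pair.Fubini'[symmetric]) measurable
  also have "\<dots> \<le> (\<integral>\<^sup>+t. ennreal (c1 T * c2 T) * (ennreal ((g t)\<^sup>2) * indicator {0..T} t) \<partial>lborel)"
  proof (rule nn_integral_mono)
    fix t
    show "(\<integral>\<^sup>+s. ennreal (c1 T * s powr (- q)) * ennreal (kernel T t s * (t powr q * (g t)\<^sup>2)) \<partial>lborel)
       \<le> ennreal (c1 T * c2 T) * (ennreal ((g t)\<^sup>2) * indicator {0..T} t)"
    proof (cases "0 < t \<and> t \<le> T")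
      case False
      have "kernel T t s = 0" for s using False by (auto simp: kernel_def)
      then show ?thesis by simp
    next
      case True
      have "(\<integral>\<^sup>+s. ennreal (c1 T * s powr (- q)) * ennreal (kernel T t s * (t powr q * (g t)\<^sup>2)) \<partial>lborel)
          = (\<integral>\<^sup>+s. ennreal (c1 T * (t powr q * (g t)\<^sup>2)) * ennreal (kernel T t s * s powr (- q)) \<partial>lborel)"
        by (rule nn_integral_cong) (simp add: c_nonneg kernel_nonneg ac_simps flip: ennreal_mult)
      also have "\<dots> = ennreal (c1 T * (t powr q * (g t)\<^sup>2)) * (\<integral>\<^sup>+s. ennreal (kernel T t s * s powr (- q)) \<partial>lborel)"
        by (rule nn_integral_cmult) measurable
      also have "\<dots> \<le> ennreal (c1 T * (t powr q * (g t)\<^sup>2)) * ennreal (c2 T * t powr (- q))"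
        by (rule mult_left_mono[OF schur_col]) (use True in auto)
      also have "\<dots> = ennreal (c1 T * c2 T * (g t)\<^sup>2 * (t powr q * t powr (- q)))"
        by (simp add: c_nonneg ac_simps flip: ennreal_mult)
      also have "t powr q * t powr (- q) = 1" using True by (simp flip: powr_add)
      finally show ?thesis using True by (simp add: c_nonneg ennreal_mult)
    qed
  qed
  also have "\<dots> = ennreal (c1 T * c2 T) * (\<integral>\<^sup>+t. ennreal ((g t)\<^sup>2) * indicator {0..T} t \<partial>lborel)"
    by (rule nn_integral_cmult) measurable
  finally show ?thesis .
qed

definition CS where "CS T = CD\<^sup>2 * (c1 T * c2 T)"

lemma CS_nonneg: "0 \<le> CS T"
  by (simp add: CS_def c_nonneg)

text \<open>Absolute values stand inside the inner integral, so one estimate yields the L2 bound on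
  \<open>Q\<close>, the existence of its inner integral almost everywhere and the integrability for
  Fubini.\<close>

lemma D_operator_bound:
  assumes [measurable]: "h \<in> borel_measurable borel"
  shows "(\<integral>\<^sup>+s. (\<integral>\<^sup>+t. ennreal (upto_ind T t * (\<bar>h t\<bar> * D t s)) \<partial>lborel)\<^sup>2 \<partial>lborel)
    \<le> ennreal (CS T) * (\<integral>\<^sup>+t. ennreal ((h t * t powr (1/2 - H1))\<^sup>2) * indicator {0..T} t \<partial>lborel)"
proof -
  define g where "g = (\<lambda>t. h t * t powr (1/2 - H1))"
  have [measurable]: "g \<in> borel_measurable borel" unfolding g_def by measurable
  have le: "upto_ind T t * (\<bar>h t\<bar> * D t s) \<le> CD * (kernel T t s * \<bar>g t\<bar>)" for t s
  proof (cases "0 < s \<and> s < t \<and> t \<le> T")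
    case True
    have "t powr p = t powr q * t powr (1/2 - H1)" by (simp add: p_def q_def flip: powr_add)
    have "\<bar>h t\<bar> * D t s \<le> \<bar>h t\<bar> * (CD * (s powr (- q) * t powr p * (t - s) powr (p - 1)))"
      using D_le[of s t] True by (intro mult_left_mono) auto
    also have "\<dots> = CD * (kernel T t s * \<bar>g t\<bar>)"
      using True \<open>t powr p = _\<close> by (simp add: kernel_def g_def abs_mult)
    finally show ?thesis using True by simp
  next
    case False
    then have z: "upto_ind T t * (\<bar>h t\<bar> * D t s) = 0" by (auto simp: D_def indicator_def)
    show ?thesis unfolding z by (intro mult_nonneg_nonneg CD_nonneg kernel_nonneg) simp
  qed
  have "(\<integral>\<^sup>+s. (\<integral>\<^sup>+t. ennreal (upto_ind T t * (\<bar>h t\<bar> * D t s)) \<partial>lborel)\<^sup>2 \<partial>lborel)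
     \<le> (\<integral>\<^sup>+s. (ennreal CD * (\<integral>\<^sup>+t. ennreal (kernel T t s * \<bar>g t\<bar>) \<partial>lborel))\<^sup>2 \<partial>lborel)"
  proof (rule nn_integral_mono, rule power_mono)
    fix s
    have "(\<integral>\<^sup>+t. ennreal (upto_ind T t * (\<bar>h t\<bar> * D t s)) \<partial>lborel) \<le> (\<integral>\<^sup>+t. ennreal CD * ennreal (kernel T t s * \<bar>g t\<bar>) \<partial>lborel)"
      by (rule nn_integral_mono) (use le CD_nonneg kernel_nonneg in \<open>simp add: ennreal_leI flip: ennreal_mult\<close>)
    also have "\<dots> = ennreal CD * (\<integral>\<^sup>+t. ennreal (kernel T t s * \<bar>g t\<bar>) \<partial>lborel)"
      by (rule nn_integral_cmult) measurable
    finally show "(\<integral>\<^sup>+t. ennreal (upto_ind T t * (\<bar>h t\<bar> * D t s)) \<partial>lborel) \<le> ennreal CD * (\<integral>\<^sup>+t. ennreal (kernel T t s * \<bar>g t\<bar>) \<partial>lborel)" .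
  qed simp
  also have "\<dots> = ennreal (CD\<^sup>2) * (\<integral>\<^sup>+s. (\<integral>\<^sup>+t. ennreal (kernel T t s * \<bar>g t\<bar>) \<partial>lborel)\<^sup>2 \<partial>lborel)"
    unfolding power_mult_distrib ennreal_power[OF CD_nonneg] by (rule nn_integral_cmult) measurable
  also have "\<dots> \<le> ennreal (CD\<^sup>2) * (ennreal (c1 T * c2 T) * (\<integral>\<^sup>+t. ennreal ((g t)\<^sup>2) * indicator {0..T} t \<partial>lborel))"
    by (rule mult_left_mono[OF schur_test]) measurable
  also have "\<dots> = ennreal (CS T) * (\<integral>\<^sup>+t. ennreal ((g t)\<^sup>2) * indicator {0..T} t \<partial>lborel)"
    by (simp add: CS_def c_nonneg ennreal_mult mult.assoc)
  finally show ?thesis by (simp add: g_def)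
qed

end

section \<open>The observed process\<close>

text \<open>Measurability is asked only of \<open>g\<close>; an integrand built from
  \<open>dK12\<close> inherits it, since it differs from \<open>g\<close> in one value at
  most.\<close>

lemma integral_cong_except_point:
  fixes f g :: "real \<Rightarrow> real"
  assumes g: "g \<in> borel_measurable borel" and eq: "\<And>x. x \<noteq> a \<Longrightarrow> f x = g x"
  shows "(\<integral>x. f x \<partial>lborel) = (\<integral>x. g x \<partial>lborel)"
proof (rule integral_cong_AE)
  have "f = (\<lambda>x. if x = a then f a else g x)" using eq by auto
  moreover have "(\<lambda>x. if x = a then f a else g x) \<in> borel_measurable borel" using g by measurable
  ultimately show "f \<in> borel_measurable lborel" by simp
  show "AE x in lborel. f x = g x" using AE_lborel_singleton[of a] by eventually_elim (rule eq)
qed (use g in simp)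

context fractional_kernel
begin

text \<open>The product vanishes beyond \<open>min t u\<close>, so the domain can be extended to the
  whole line. In this form \<open>kk\<close> is the Gram kernel of the functions
  \<open>D t\<close>.\<close>

lemma kk_eq: "kk H1 H2 t u = (\<integral>v. D t v * D u v \<partial>lborel)"
proof -
  let ?f = "\<lambda>v. indicator {0..min t u} v * (dK12 H1 H2 t v * dK12 H1 H2 u v)"
  have "(\<integral>v. ?f v \<partial>lborel) = (\<integral>v. D t v * D u v \<partial>lborel)"
  proof (rule integral_cong_except_point[where a = "min t u"])
    fix v assume v: "v \<noteq> min t u"
    show "?f v = D t v * D u v"
    proof (cases "0 < v \<and> v < min t u")
      case True
      then show ?thesis using dK12_eq[of v t] dK12_eq[of v u] by simp
    next
      case False
      then have a: "D t v * D u v = 0" by (auto simp: D_def)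
      have "?f v = 0" using False v by (auto simp: indicator_def dK12_nonpos)
      then show ?thesis using a by (rule trans[OF _ sym])
    qed
  qed measurable
  then show ?thesis by (simp add: kk_def set_lebesgue_integral_def)
qed

lemma D_upto_integrable:
  assumes "0 \<le> u" shows "integrable lborel (\<lambda>t. upto_ind u t * D t s)"
proof (cases "0 \<le> s")
  case True
  show ?thesis
    by (rule integrableI_nonneg) (use nn_integral_D[OF True assms] D_nonneg in auto)
next
  case False
  then have "(\<lambda>t. upto_ind u t * D t s) = (\<lambda>t. 0)" by (auto simp: D_def)
  then show ?thesis by simp
qed

lemma integral_D_upto:
  assumes "0 \<le> u" shows "(\<integral>t. upto_ind u t * D t s \<partial>lborel) = K12 H1 H2 u s"
proof (cases "0 \<le> s")
  case True
  show ?thesis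
    by (rule integral_eq_nn_integral[THEN trans])
      (use nn_integral_D[OF True assms] D_nonneg K12_nonneg in auto)
next
  case False
  then have "(\<lambda>t. upto_ind u t * D t s) = (\<lambda>t. 0)" by (auto simp: D_def)
  then show ?thesis using False by (simp add: K12_def)
qed

lemma gammaH_pos: "0 < gammaH H1"
proof -
  have "0 < betaH H1" using H Beta_pos[of "H1 - 1/2" "2 - 2 * H1"] by (simp add: betaH_def)
  moreover have "0 < Beta (3/2 - H1) (H1 - 1/2)" using H by (intro Beta_pos) auto
  ultimately show ?thesis by (simp add: gammaH_def)
qed

lemma kappaH_pos: "0 < kappaH H1"
  using gammaH_pos H Beta_pos[of "3/2 - H1" "3/2 - H1"] by (simp add: kappaH_def BH_def)

end

section \<open>Integrands of integrals against the observation\<close>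

locale filtering_model = fractional_kernel H1 H2 + prob_space M
  for H1 H2 :: real and M :: "'a measure" +
  fixes W1 W2 :: "real \<Rightarrow> 'a \<Rightarrow> real" and T :: real
  assumes T: "0 < T" and W1: "wiener_process M W1" and W2: "wiener_process M W2"
    and W12: "indep_processes M W1 W2"
begin

abbreviation "\<gamma> \<equiv> gammaH H1"
definition al where "al = 1/2 - H1"

definition wtd :: "(real \<Rightarrow> real) \<Rightarrow> real \<Rightarrow> real" where
  "wtd h = (\<lambda>s. upto_ind T s * (h s * s powr al))"

definition adm :: "(real \<Rightarrow> real) \<Rightarrow> bool" where
  "adm h \<longleftrightarrow> h \<in> borel_measurable borel \<and> wtd h \<in> L2 lborel"

text \<open>The integrand against \<open>W2\<close> of the integral of h with respect to X. Where
  the inner integrand is not integrable the default value 0 is taken; \<open>Q_integrable\<close>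
  confines this to a null set.\<close>

definition Q :: "(real \<Rightarrow> real) \<Rightarrow> real \<Rightarrow> real" where
  "Q h s = (\<integral>t. upto_ind T t * (h t * D t s) \<partial>lborel)"

lemma powr_al_sq: "(s powr al)\<^sup>2 = s powr (1 - 2 * H1)"
proof -
  have "(s powr al)\<^sup>2 = s powr (al + al)" by (simp only: power2_eq_square powr_add)
  then show ?thesis by (simp add: al_def)
qed

lemma nn_integral_powr_al:
  assumes u: "0 \<le> u"
  shows "(\<integral>\<^sup>+s. ennreal ((upto_ind u s * s powr al)\<^sup>2) \<partial>lborel) = ennreal (u powr (2 - 2 * H1) / (2 - 2 * H1))"
proof -
  have "(\<integral>\<^sup>+s. ennreal ((upto_ind u s * s powr al)\<^sup>2) \<partial>lborel)
      = (\<integral>\<^sup>+s. ennreal (s powr (1 - 2 * H1)) * indicator {0..u} s \<partial>lborel)"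
    by (rule nn_integral_cong) (auto simp: indicator_def powr_al_sq)
  also have "\<dots> = ennreal (u powr (1 - 2 * H1 + 1) / (1 - 2 * H1 + 1))"
    by (rule nn_integral_has_integral_lebesgue'[OF _ has_integral_powr_from_0]) (use H u in auto)
  finally show ?thesis by simp
qed

lemma powr_al_L2: "0 \<le> u \<Longrightarrow> (\<lambda>s. upto_ind u s * s powr al) \<in> L2 lborel"
  by (rule L2_I_nn) (simp_all add: nn_integral_powr_al)

lemma integral_powr_al: "0 \<le> u \<Longrightarrow> (\<integral>s. (upto_ind u s * s powr al)\<^sup>2 \<partial>lborel) = u powr (2 - 2 * H1) / (2 - 2 * H1)"
  by (rule integral_eq_nn_integral[THEN trans]) (use H in \<open>simp_all add: nn_integral_powr_al\<close>)

lemma wtd_upto: "u \<le> T \<Longrightarrow> wtd (upto_ind u) = (\<lambda>s. upto_ind u s * s powr al)"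
  unfolding wtd_def by (auto simp: indicator_def)

lemma adm_upto: "0 \<le> u \<Longrightarrow> u \<le> T \<Longrightarrow> adm (upto_ind u)"
  by (simp add: adm_def wtd_upto powr_al_L2)

lemma adm_lin: "adm h \<Longrightarrow> adm h' \<Longrightarrow> adm (\<lambda>s. a * h s + b * h' s)"
proof -
  assume "adm h" "adm h'"
  then have "(\<lambda>s. a * wtd h s + b * wtd h' s) \<in> L2 lborel" by (intro L2_lin) (auto simp: adm_def)
  moreover have "(\<lambda>s. a * wtd h s + b * wtd h' s) = wtd (\<lambda>s. a * h s + b * h' s)"
    by (auto simp: wtd_def algebra_simps)
  moreover have [measurable]: "h \<in> borel_measurable borel" "h' \<in> borel_measurable borel"
    using \<open>adm h\<close> \<open>adm h'\<close> by (auto simp: adm_def)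
  have "(\<lambda>s. a * h s + b * h' s) \<in> borel_measurable borel" by measurable
  ultimately show ?thesis by (simp add: adm_def)
qed

lemma Q_abs_bound:
  assumes h: "adm h"
  shows "(\<integral>\<^sup>+s. (\<integral>\<^sup>+t. ennreal (upto_ind T t * (\<bar>h t\<bar> * D t s)) \<partial>lborel)\<^sup>2 \<partial>lborel)
    \<le> ennreal (CS T * (nrm lborel (wtd h))\<^sup>2)"
proof -
  have hm: "h \<in> borel_measurable borel" and hL: "wtd h \<in> L2 lborel" using h by (auto simp: adm_def)
  have "(\<integral>\<^sup>+t. ennreal ((h t * t powr (1/2 - H1))\<^sup>2) * indicator {0..T} t \<partial>lborel) = (\<integral>\<^sup>+t. ennreal ((wtd h t)\<^sup>2) \<partial>lborel)"
    by (rule nn_integral_cong) (auto simp: wtd_def al_def indicator_def)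
  also have "\<dots> = ennreal ((nrm lborel (wtd h))\<^sup>2)" by (rule nn_integral_sq_L2[OF hL])
  finally show ?thesis
    using D_operator_bound[OF hm, of T] by (simp add: CS_nonneg ennreal_mult)
qed

lemma Q_measurable [measurable]: "h \<in> borel_measurable borel \<Longrightarrow> Q h \<in> borel_measurable borel"
proof -
  assume [measurable]: "h \<in> borel_measurable borel"
  show ?thesis unfolding Q_def by measurable
qed

lemma Q_L2:
  assumes h: "adm h"
  shows "Q h \<in> L2 lborel" "(nrm lborel (Q h))\<^sup>2 \<le> CS T * (nrm lborel (wtd h))\<^sup>2"
proof -
  have hm [measurable]: "h \<in> borel_measurable borel" using h by (auto simp: adm_def)
  have le: "ennreal ((Q h s)\<^sup>2) \<le> (\<integral>\<^sup>+t. ennreal (upto_ind T t * (\<bar>h t\<bar> * D t s)) \<partial>lborel)\<^sup>2" for s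
  proof -
    \<comment> \<open>If the inner integrand is not integrable, the left side is 0 by the default
      value of the integral.\<close>
    have "ennreal \<bar>Q h s\<bar> \<le> (\<integral>\<^sup>+t. ennreal (norm (upto_ind T t * (h t * D t s))) \<partial>lborel)"
      using integral_norm_bound_ennreal[of lborel "\<lambda>t. upto_ind T t * (h t * D t s)"] not_integrable_integral_eq[of lborel "\<lambda>t. upto_ind T t * (h t * D t s)"]
      unfolding Q_def by (cases "integrable lborel (\<lambda>t. upto_ind T t * (h t * D t s))") auto
    also have "\<dots> = (\<integral>\<^sup>+t. ennreal (upto_ind T t * (\<bar>h t\<bar> * D t s)) \<partial>lborel)"
      by (rule nn_integral_cong) (simp add: abs_mult D_nonneg)
    finally have "(ennreal \<bar>Q h s\<bar>)\<^sup>2 \<le> (\<integral>\<^sup>+t. ennreal (upto_ind T t * (\<bar>h t\<bar> * D t s)) \<partial>lborel)\<^sup>2"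
      by (intro power_mono) auto
    then show ?thesis by (simp add: ennreal_power)
  qed
  have b: "(\<integral>\<^sup>+s. ennreal ((Q h s)\<^sup>2) \<partial>lborel) \<le> ennreal (CS T * (nrm lborel (wtd h))\<^sup>2)"
    by (rule order_trans[OF nn_integral_mono Q_abs_bound[OF h]]) (rule le)
  have m: "Q h \<in> borel_measurable lborel" using Q_measurable[OF hm] by simp
  have "(\<integral>\<^sup>+s. ennreal ((Q h s)\<^sup>2) \<partial>lborel) < \<infinity>" by (rule le_less_trans[OF b]) simp
  then show L: "Q h \<in> L2 lborel" by (rule L2_I_nn[OF m])
  show "(nrm lborel (Q h))\<^sup>2 \<le> CS T * (nrm lborel (wtd h))\<^sup>2"
    using b unfolding nn_integral_sq_L2[OF L] by (subst (asm) ennreal_le_iff) (auto simp: CS_nonneg)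
qed

lemma Q_integrable:
  assumes h: "adm h"
  shows "AE s in lborel. integrable lborel (\<lambda>t. upto_ind T t * (h t * D t s))"
proof -
  have hm [measurable]: "h \<in> borel_measurable borel" using h by (auto simp: adm_def)
  have "AE s in lborel. (\<integral>\<^sup>+t. ennreal (upto_ind T t * (\<bar>h t\<bar> * D t s)) \<partial>lborel)\<^sup>2 \<noteq> \<infinity>"
  proof (rule nn_integral_PInf_AE)
    show "(\<integral>\<^sup>+s. (\<integral>\<^sup>+t. ennreal (upto_ind T t * (\<bar>h t\<bar> * D t s)) \<partial>lborel)\<^sup>2 \<partial>lborel) \<noteq> \<infinity>"
      using le_less_trans[OF Q_abs_bound[OF h] ennreal_less_top] by simp
  qed measurable
  then show ?thesis
  proof eventually_elim
    case (elim s)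
    have sq: "x < \<infinity>" if "x\<^sup>2 \<noteq> \<infinity>" for x :: ennreal
      using that by (cases x) (auto simp: power2_eq_square)
    have "(\<integral>\<^sup>+t. ennreal (upto_ind T t * (\<bar>h t\<bar> * D t s)) \<partial>lborel) < \<infinity>"
      by (rule sq[OF elim])
    moreover have "(\<integral>\<^sup>+t. ennreal (norm (upto_ind T t * (h t * D t s))) \<partial>lborel)
        = (\<integral>\<^sup>+t. ennreal (upto_ind T t * (\<bar>h t\<bar> * D t s)) \<partial>lborel)"
      by (rule nn_integral_cong) (simp add: abs_mult D_nonneg)
    ultimately show ?case by (intro integrableI_bounded) auto
  qed
qed

text \<open>Linearity is claimed almost everywhere, namely where both inner integrals exist.\<close>

lemma Q_diff:
  assumes h: "adm h" and h': "adm h'"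
  shows "AE s in lborel. Q (\<lambda>s. 1 * h s + (-1) * h' s) s = Q h s - Q h' s"
  using Q_integrable[OF h] Q_integrable[OF h']
proof eventually_elim
  case (elim s)
  have "Q (\<lambda>s. 1 * h s + (-1) * h' s) s
      = (\<integral>t. upto_ind T t * (h t * D t s) - upto_ind T t * (h' t * D t s) \<partial>lborel)"
    unfolding Q_def by (simp add: algebra_simps)
  then show ?case unfolding Q_def using elim by simp
qed

text \<open>Integrating the derivative of the kernel returns the kernel, so that the indicator of
  (0, u] represents the observation at u.\<close>

lemma Q_upto:
  assumes u: "0 \<le> u" "u \<le> T" shows "Q (upto_ind u) s = K12 H1 H2 u s"
proof -
  have "(\<lambda>t. upto_ind T t * (upto_ind u t * D t s)) = (\<lambda>t. upto_ind u t * D t s)"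
    using u by (auto simp: indicator_def)
  then show ?thesis using integral_D_upto[OF u(1), of s] by (simp add: Q_def)
qed

lemma Q_lincomb:
  assumes "snd ` set xs \<subseteq> {0..T}"
  shows "Q (\<lambda>t. lincomb (\<lambda>b. upto_ind b t) xs) s = lincomb (\<lambda>b. K12 H1 H2 b s) xs"
proof -
  from assms have "integrable lborel (\<lambda>t. upto_ind T t * (lincomb (\<lambda>b. upto_ind b t) xs * D t s)) \<and>
    (\<integral>t. upto_ind T t * (lincomb (\<lambda>b. upto_ind b t) xs * D t s) \<partial>lborel) = lincomb (\<lambda>b. K12 H1 H2 b s) xs"
  proof (induction xs)
    case (Cons z xs)
    obtain c b where z: "z = (c, b)" by force
    have b: "0 \<le> b" "b \<le> T" using Cons z by auto
    have e: "upto_ind T t * (lincomb (\<lambda>b. upto_ind b t) (z # xs) * D t s)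
        = c * (upto_ind b t * D t s) + upto_ind T t * (lincomb (\<lambda>b. upto_ind b t) xs * D t s)" for t
      using b by (auto simp: z indicator_def algebra_simps)
    show ?case unfolding e using Cons D_upto_integrable[OF b(1), of s] integral_D_upto[OF b(1), of s]
      by (simp add: z)
  qed simp
  then show ?thesis by (simp add: Q_def)
qed

lemma adm_lincomb: "snd ` set xs \<subseteq> {0..T} \<Longrightarrow> adm (\<lambda>t. lincomb (\<lambda>b. upto_ind b t) xs)"
proof (induction xs)
  case Nil
  then show ?case by (simp add: adm_def wtd_def)
next
  case (Cons z xs)
  obtain c b where z: "z = (c, b)" by force
  have "adm (\<lambda>t. c * upto_ind b t + 1 * lincomb (\<lambda>b. upto_ind b t) xs)"
    by (rule adm_lin) (use Cons z in \<open>auto intro: adm_upto\<close>)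
  then show ?case by (simp add: z)
qed

text \<open>\<open>rep h Y\<close> says that \<open>Y\<close> is a version of the integral of \<open>h\<close> with respect to the observed process.\<close>

definition rep1 :: "(real \<Rightarrow> real) \<Rightarrow> ('a \<Rightarrow> real) \<Rightarrow> bool" where
  "rep1 h Y \<longleftrightarrow> wiener_pair M W1 (\<lambda>s. \<gamma> * wtd h s) Y"

definition rep :: "(real \<Rightarrow> real) \<Rightarrow> ('a \<Rightarrow> real) \<Rightarrow> bool" where
  "rep h Y \<longleftrightarrow> (\<exists>Y1 Y2. Y = (\<lambda>\<omega>. Y1 \<omega> + Y2 \<omega>) \<and> rep1 h Y1 \<and> wiener_pair M W2 (Q h) Y2)"

section \<open>The Gaussian space of the two Wiener processes\<close>

definition L0 where "L0 = {\<lambda>\<omega>. X \<omega> + Y \<omega> | X Y. X \<in> process_span W1 {0..} \<and> Y \<in> process_span W2 {0..}}"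
definition L where "L = L2_closure M L0"

lemma L0: "gaussian_space M L0" "X \<in> process_span W1 {0..} \<Longrightarrow> Y \<in> process_span W2 {0..} \<Longrightarrow> (\<integral>\<omega>. X \<omega> * Y \<omega> \<partial>M) = 0"
  using gaussian_space_two_wiener[OF W1 W2 W12] unfolding L0_def by auto

lemma L0_L2: "L0 \<subseteq> L2 M"
  using L0(1) unfolding gaussian_space_def by (elim conjE)

lemma L_gaussian: "gaussian_space M L"
  unfolding L_def by (rule gaussian_space_closure[OF L0(1)])

lemma L_closed: "L2_closure M L \<subseteq> L"
proof
  fix f assume f: "f \<in> L2_closure M L"
  show "f \<in> L" unfolding L_def
    by (rule L2_closure_closed[OF L0_L2 L2_closure_L2[OF f]]) (rule L2_closureD[OF f[unfolded L_def]])
qed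

lemma span_L0: "process_span W1 {0..} \<subseteq> L0" "process_span W2 {0..} \<subseteq> L0"
proof -
  have z: "(\<lambda>x. 0) \<in> process_span W1 {0..}" "(\<lambda>x. 0) \<in> process_span W2 {0..}"
    by (rule lin_set_zero[OF lin_set_process_span])+
  show "process_span W1 {0..} \<subseteq> L0"
  proof
    fix X assume "X \<in> process_span W1 {0..}"
    then show "X \<in> L0" unfolding L0_def using z(2) by (intro CollectI exI[of _ X] exI[of _ "\<lambda>x. 0"]) auto
  qed
  show "process_span W2 {0..} \<subseteq> L0"
  proof
    fix X assume "X \<in> process_span W2 {0..}"
    then show "X \<in> L0" unfolding L0_def using z(1) by (intro CollectI exI[of _ "\<lambda>x. 0"] exI[of _ X]) auto
  qed
qed

lemma pair_in_L: "wiener_pair M W1 g Y \<Longrightarrow> Y \<in> L" "wiener_pair M W2 g Y \<Longrightarrow> Y \<in> L"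
  using wiener_pair_closure[OF W1] wiener_pair_closure[OF W2] L2_closure_mono[OF span_L0(1), of M] L2_closure_mono[OF span_L0(2), of M]
  unfolding L_def by blast+

lemma rep_in_L: "rep h Y \<Longrightarrow> Y \<in> L"
  unfolding rep_def rep1_def using lin_set_add[OF gaussian_space_lin[OF L_gaussian]] pair_in_L by blast

lemma L_L2: "Y \<in> L \<Longrightarrow> Y \<in> L2 M"
  by (rule gaussian_space_L2[OF L_gaussian])

text \<open>Orthogonality of the two spans, extended to their closures in one argument at a
  time.\<close>

lemma pair_cross:
  assumes 1: "wiener_pair M W1 g X" and 2: "wiener_pair M W2 g' Y"
  shows "(\<integral>\<omega>. X \<omega> * Y \<omega> \<partial>M) = 0"
proof (rule L2_closure_orth[OF _ wiener_pairD(2)[OF 1] _ wiener_pair_closure[OF W2 2]])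
  show "process_span W2 {0..} \<subseteq> L2 M" using span_L0 L0_L2 by auto
  fix V assume V: "V \<in> process_span W2 {0..}"
  then have VL: "V \<in> L2 M" using span_L0 L0_L2 by auto
  have "(\<integral>\<omega>. V \<omega> * X \<omega> \<partial>M) = 0"
  proof (rule L2_closure_orth[OF _ VL _ wiener_pair_closure[OF W1 1]])
    show "process_span W1 {0..} \<subseteq> L2 M" using span_L0 L0_L2 by auto
    fix U assume "U \<in> process_span W1 {0..}"
    then show "(\<integral>\<omega>. V \<omega> * U \<omega> \<partial>M) = 0" using L0(2)[OF _ V, of U] by (simp add: mult.commute)
  qed
  then show "(\<integral>\<omega>. X \<omega> * V \<omega> \<partial>M) = 0" by (simp add: mult.commute)
qed

lemma rep1_rep_inner:
  assumes 1: "rep1 h X" and 2: "rep h' Y"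
  shows "(\<integral>\<omega>. X \<omega> * Y \<omega> \<partial>M) = \<gamma>\<^sup>2 * (\<integral>s. wtd h s * wtd h' s \<partial>lborel)"
proof -
  from 2 obtain Y1 Y2 where Y: "Y = (\<lambda>\<omega>. Y1 \<omega> + Y2 \<omega>)" and Y1: "rep1 h' Y1" and Y2: "wiener_pair M W2 (Q h') Y2"
    unfolding rep_def by blast
  note p = 1[unfolded rep1_def] Y1[unfolded rep1_def]
  have "(\<integral>\<omega>. X \<omega> * Y \<omega> \<partial>M) = (\<integral>\<omega>. X \<omega> * Y1 \<omega> + X \<omega> * Y2 \<omega> \<partial>M)" by (simp add: Y distrib_left)
  also have "\<dots> = (\<integral>\<omega>. X \<omega> * Y1 \<omega> \<partial>M) + (\<integral>\<omega>. X \<omega> * Y2 \<omega> \<partial>M)"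
    by (rule Bochner_Integration.integral_add; rule L2_mult_integrable) (use p Y2 wiener_pairD(2) in auto)
  also have "\<dots> = (\<integral>s. (\<gamma> * wtd h s) * (\<gamma> * wtd h' s) \<partial>lborel)"
    using pair_cross[OF p(1) Y2] wiener_pair_inner[OF W1 p(1) p(2)] by simp
  also have "\<dots> = (\<integral>s. \<gamma>\<^sup>2 * (wtd h s * wtd h' s) \<partial>lborel)"
    by (simp add: power2_eq_square ac_simps)
  finally show ?thesis by simp
qed

lemma rep_rep_inner:
  assumes 1: "rep h X" and 2: "rep h' Y"
  shows "(\<integral>\<omega>. X \<omega> * Y \<omega> \<partial>M) = \<gamma>\<^sup>2 * (\<integral>s. wtd h s * wtd h' s \<partial>lborel) + (\<integral>s. Q h s * Q h' s \<partial>lborel)"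
proof -
  from 1 obtain X1 X2 where X: "X = (\<lambda>\<omega>. X1 \<omega> + X2 \<omega>)" and X1: "rep1 h X1" and X2: "wiener_pair M W2 (Q h) X2"
    unfolding rep_def by blast
  from 2 obtain Y1 Y2 where Y: "Y = (\<lambda>\<omega>. Y1 \<omega> + Y2 \<omega>)" and Y1: "rep1 h' Y1" and Y2: "wiener_pair M W2 (Q h') Y2"
    unfolding rep_def by blast
  have L2s: "X1 \<in> L2 M" "X2 \<in> L2 M" "Y1 \<in> L2 M" "Y2 \<in> L2 M" "Y \<in> L2 M"
    using wiener_pairD(2)[OF X1[unfolded rep1_def]] wiener_pairD(2)[OF X2] wiener_pairD(2)[OF Y1[unfolded rep1_def]] wiener_pairD(2)[OF Y2]
      L_L2[OF rep_in_L[OF 2]] by auto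
  have "(\<integral>\<omega>. X2 \<omega> * Y \<omega> \<partial>M) = (\<integral>\<omega>. Y1 \<omega> * X2 \<omega> + X2 \<omega> * Y2 \<omega> \<partial>M)" by (simp add: Y algebra_simps)
  also have "\<dots> = (\<integral>\<omega>. Y1 \<omega> * X2 \<omega> \<partial>M) + (\<integral>\<omega>. X2 \<omega> * Y2 \<omega> \<partial>M)"
    by (rule Bochner_Integration.integral_add; rule L2_mult_integrable) (use L2s in auto)
  also have "\<dots> = (\<integral>s. Q h s * Q h' s \<partial>lborel)"
    using pair_cross[OF Y1[unfolded rep1_def] X2] wiener_pair_inner[OF W2 X2 Y2] by simp
  finally have b: "(\<integral>\<omega>. X2 \<omega> * Y \<omega> \<partial>M) = (\<integral>s. Q h s * Q h' s \<partial>lborel)" .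
  have "(\<integral>\<omega>. X \<omega> * Y \<omega> \<partial>M) = (\<integral>\<omega>. X1 \<omega> * Y \<omega> + X2 \<omega> * Y \<omega> \<partial>M)" by (simp add: X distrib_right)
  also have "\<dots> = (\<integral>\<omega>. X1 \<omega> * Y \<omega> \<partial>M) + (\<integral>\<omega>. X2 \<omega> * Y \<omega> \<partial>M)"
    by (rule Bochner_Integration.integral_add; rule L2_mult_integrable) (use L2s in auto)
  finally show ?thesis using rep1_rep_inner[OF X1 2] b by simp
qed

lemma pair_zero: "wiener_pair M W (\<lambda>s. 0) (\<lambda>\<omega>. 0)"
  unfolding wiener_pair_def
proof (intro conjI allI impI)
  fix e :: real assume "0 < e"
  then show "\<exists>xs. snd ` set xs \<subseteq> {0..} \<and> nrm lborel (\<lambda>s. 0 - lincomb (\<lambda>b. upto_ind b s) xs) < e \<and>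
      nrm M (\<lambda>\<omega>. 0 - lincomb (\<lambda>b. W b \<omega>) xs) < e"
    by (intro exI[of _ "[]"]) simp
qed simp_all

abbreviation "X1t \<equiv> X1 M W1 H1"
abbreviation "X2t \<equiv> X2 M W2 H1 H2"
abbreviation "Xt \<equiv> Xobs M W1 W2 H1 H2"

lemma rep1_if_wiener_int:
  assumes h: "adm h" and f: "\<And>s. s \<in> {0..T} \<Longrightarrow> f s = h s * s powr al"
  shows "rep1 h (\<lambda>\<omega>. \<gamma> * wiener_int M W1 0 T f \<omega>)"
proof -
  have [measurable]: "h \<in> borel_measurable borel" using h by (simp add: adm_def)
  have e: "(\<lambda>s. indicator {0..T} s * (h s * s powr al)) = wtd h"
  proof
    fix s show "indicator {0..T} s * (h s * s powr al) = wtd h s"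
      by (cases "s = 0") (auto simp: wtd_def indicator_def)
  qed
  have "wiener_pair M W1 (\<lambda>s. indicator {0..T} s * (h s * s powr al)) (wiener_int M W1 0 T (\<lambda>s. h s * s powr al))"
    by (rule wiener_pair_wiener_int[OF W1]) (use T h in \<open>auto simp: e adm_def\<close>)
  moreover have "wiener_int M W1 0 T (\<lambda>s. h s * s powr al) = wiener_int M W1 0 T f"
    by (rule wiener_int_cong) (simp add: f)
  ultimately have "wiener_pair M W1 (wtd h) (wiener_int M W1 0 T f)" by (simp add: e)
  from wiener_pair_lin[OF W1 this pair_zero, of \<gamma> 0] show ?thesis by (simp add: rep1_def)
qed

lemma rep1_X1:
  assumes u: "0 \<le> u" "u \<le> T"
  shows "rep1 (upto_ind u) (X1t u)"
proof -
  have e: "(\<lambda>s. indicator {0..u} s * s powr al) = wtd (upto_ind u)"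
  proof
    fix s show "indicator {0..u} s * s powr al = wtd (upto_ind u) s"
      unfolding wtd_upto[OF u(2)] by (cases "s = 0") (auto simp: indicator_def)
  qed
  have "wiener_pair M W1 (\<lambda>s. indicator {0..u} s * s powr al) (wiener_int M W1 0 u (\<lambda>s. s powr al))"
    by (rule wiener_pair_wiener_int[OF W1]) (use u adm_upto[OF u] in \<open>auto simp: e adm_def\<close>)
  then have "wiener_pair M W1 (wtd (upto_ind u)) (wiener_int M W1 0 u (\<lambda>s. s powr al))" by (simp add: e)
  from wiener_pair_lin[OF W1 this pair_zero, of \<gamma> 0] show ?thesis by (simp add: rep1_def X1_def al_def)
qed

lemma pair_X2:
  assumes u: "0 \<le> u" "u \<le> T"
  shows "wiener_pair M W2 (Q (upto_ind u)) (X2t u)"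
proof -
  have e: "(\<lambda>s. indicator {0..u} s * K12 H1 H2 u s) = Q (upto_ind u)"
    by (rule ext) (auto simp: Q_upto[OF u] indicator_def K12_def)
  have "wiener_pair M W2 (\<lambda>s. indicator {0..u} s * K12 H1 H2 u s) (wiener_int M W2 0 u (K12 H1 H2 u))"
    by (rule wiener_pair_wiener_int[OF W2]) (use u Q_L2(1)[OF adm_upto[OF u]] in \<open>auto simp: e\<close>)
  then show ?thesis by (simp add: e X2_def)
qed

lemma rep_X: "0 \<le> u \<Longrightarrow> u \<le> T \<Longrightarrow> rep (upto_ind u) (Xt u)"
  unfolding rep_def Xobs_def using rep1_X1 pair_X2 by blast

lemma X1_in_L: "0 \<le> u \<Longrightarrow> u \<le> T \<Longrightarrow> X1t u \<in> L"
  using rep1_X1 pair_in_L(1) unfolding rep1_def by blast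

text \<open>The covariance of the signal at t with \<open>Xt r\<close> sees only \<open>W1\<close>:
  it is \<open>\<gamma>\<^sup>2\<close> times the integral of \<open>s powr (1 - 2 * H1)\<close>
  over (0, min t r], the same for all t beyond r. Hence later increments of the signal are
  orthogonal to \<open>Xt r\<close>.\<close>

sublocale gaussian_filtering M L Xt X1t T
proof unfold_locales
  show "gaussian_space M L" by (rule L_gaussian)
  show "L2_closure M L \<subseteq> L" by (rule L_closed)
  show "0 \<le> T" using T by simp
  show "Xt t \<in> L" if "t \<in> {0..T}" for t using that rep_in_L[OF rep_X] by auto
  show "X1t t \<in> L" if "t \<in> {0..T}" for t using that X1_in_L by auto
  fix r s t assume a: "0 \<le> r" "r \<le> s" "s \<le> t" "t \<le> T"
  have R: "rep (upto_ind r) (Xt r)" using a by (intro rep_X) auto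
  note L = L_L2[OF X1_in_L] L_L2[OF rep_in_L[OF R]]
  have "(\<integral>x. (X1t t x - X1t s x) * Xt r x \<partial>M) = (\<integral>x. X1t t x * Xt r x - X1t s x * Xt r x \<partial>M)"
    by (simp add: left_diff_distrib)
  also have "\<dots> = (\<integral>x. X1t t x * Xt r x \<partial>M) - (\<integral>x. X1t s x * Xt r x \<partial>M)"
    by (rule Bochner_Integration.integral_diff; rule L2_mult_integrable) (use L a in auto)
  also have "\<dots> = \<gamma>\<^sup>2 * (\<integral>y. wtd (upto_ind t) y * wtd (upto_ind r) y \<partial>lborel) - \<gamma>\<^sup>2 * (\<integral>y. wtd (upto_ind s) y * wtd (upto_ind r) y \<partial>lborel)"
    using a by (simp add: rep1_rep_inner[OF rep1_X1 R])
  also have "(\<lambda>y. wtd (upto_ind t) y * wtd (upto_ind r) y) = (\<lambda>y. wtd (upto_ind s) y * wtd (upto_ind r) y)"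
    using a by (auto simp: wtd_def indicator_def)
  finally show "(\<integral>x. (X1t t x - X1t s x) * Xt r x \<partial>M) = 0" by simp
qed

lemma rep_lincomb:
  assumes "snd ` set xs \<subseteq> {0..T}"
  shows "rep (\<lambda>t. lincomb (\<lambda>b. upto_ind b t) xs) (\<lambda>\<omega>. lincomb (\<lambda>b. Xt b \<omega>) xs)"
proof -
  from assms have "wiener_pair M W1 (\<lambda>s. \<gamma> * wtd (\<lambda>t. lincomb (\<lambda>b. upto_ind b t) xs) s) (\<lambda>\<omega>. lincomb (\<lambda>b. X1t b \<omega>) xs)
    \<and> wiener_pair M W2 (\<lambda>s. lincomb (\<lambda>b. K12 H1 H2 b s) xs) (\<lambda>\<omega>. lincomb (\<lambda>b. X2t b \<omega>) xs)"
  proof (induction xs)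
    case Nil
    then show ?case by (simp add: wtd_def pair_zero)
  next
    case (Cons z xs)
    obtain c b where z: "z = (c, b)" by force
    have b: "0 \<le> b" "b \<le> T" and xs: "snd ` set xs \<subseteq> {0..T}" using Cons z by auto
    have "wiener_pair M W1 (\<lambda>s. c * (\<gamma> * wtd (upto_ind b) s) + 1 * (\<gamma> * wtd (\<lambda>t. lincomb (\<lambda>b. upto_ind b t) xs) s))
      (\<lambda>\<omega>. c * X1t b \<omega> + 1 * lincomb (\<lambda>b. X1t b \<omega>) xs)"
      by (rule wiener_pair_lin[OF W1 rep1_X1[OF b, unfolded rep1_def]]) (use Cons.IH[OF xs] in simp)
    moreover have "(\<lambda>s. c * (\<gamma> * wtd (upto_ind b) s) + 1 * (\<gamma> * wtd (\<lambda>t. lincomb (\<lambda>b. upto_ind b t) xs) s))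
        = (\<lambda>s. \<gamma> * wtd (\<lambda>t. lincomb (\<lambda>b. upto_ind b t) (z # xs)) s)"
      by (auto simp: wtd_def z algebra_simps)
    moreover have "wiener_pair M W2 (\<lambda>s. c * K12 H1 H2 b s + 1 * lincomb (\<lambda>b. K12 H1 H2 b s) xs)
      (\<lambda>\<omega>. c * X2t b \<omega> + 1 * lincomb (\<lambda>b. X2t b \<omega>) xs)"
      by (rule wiener_pair_lin[OF W2]) (use Cons.IH[OF xs] pair_X2[OF b] in \<open>simp_all add: Q_upto[OF b, abs_def]\<close>)
    ultimately show ?case by (simp add: z)
  qed
  moreover have "Q (\<lambda>t. lincomb (\<lambda>b. upto_ind b t) xs) = (\<lambda>s. lincomb (\<lambda>b. K12 H1 H2 b s) xs)"
    by (rule ext) (rule Q_lincomb[OF assms])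
  moreover have "lincomb (\<lambda>b. Xt b \<omega>) ys = lincomb (\<lambda>b. X1t b \<omega>) ys + lincomb (\<lambda>b. X2t b \<omega>) ys" for \<omega> ys
    by (induction ys) (auto simp: Xobs_def algebra_simps)
  ultimately show ?thesis unfolding rep_def rep1_def by (intro exI conjI) auto
qed

lemma rep_in_closure:
  assumes h: "adm h" and Y: "rep h Y"
  shows "Y \<in> L2_closure M (sp T)"
  unfolding L2_closure_def
proof (intro CollectI conjI allI impI)
  show YL: "Y \<in> L2 M" by (rule L_L2[OF rep_in_L[OF Y]])
  fix e :: real assume e: "0 < e"
  have hm [measurable]: "h \<in> borel_measurable borel" and hL: "wtd h \<in> L2 lborel" using h by (auto simp: adm_def)
  \<comment> \<open>The density is the square of the weight, so the norm in L2 of \<mu> is that of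
    \<open>wtd\<close>, and step functions are dense for it.\<close>
  define d where "d = (\<lambda>s. ennreal ((upto_ind T s * s powr al)\<^sup>2))"
  define \<mu> where "\<mu> = density lborel d"
  have [measurable]: "d \<in> borel_measurable borel" unfolding d_def by measurable
  have sets: "sets \<mu> = sets borel" by (simp add: \<mu>_def)
  have fin: "finite_measure \<mu>"
    by (rule finite_measureI) (use T in \<open>simp add: \<mu>_def emeasure_density d_def nn_integral_powr_al\<close>)
  have conc: "AE x in \<mu>. x \<in> {0<..T}"
    unfolding \<mu>_def by (subst AE_density) (auto simp: d_def indicator_def)
  have nn: "(\<integral>\<^sup>+s. ennreal ((f s)\<^sup>2) \<partial>\<mu>) = (\<integral>\<^sup>+s. ennreal ((wtd f s)\<^sup>2) \<partial>lborel)" if [measurable]: "f \<in> borel_measurable borel" for f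
  proof -
    have "(\<integral>\<^sup>+s. ennreal ((f s)\<^sup>2) \<partial>\<mu>) = (\<integral>\<^sup>+s. d s * ennreal ((f s)\<^sup>2) \<partial>lborel)"
      unfolding \<mu>_def by (rule nn_integral_density) auto
    also have "\<dots> = (\<integral>\<^sup>+s. ennreal ((wtd f s)\<^sup>2) \<partial>lborel)"
      by (rule nn_integral_cong) (simp add: d_def wtd_def power_mult_distrib ac_simps flip: ennreal_mult)
    finally show ?thesis .
  qed
  have L2\<mu>: "f \<in> L2 \<mu>" "nrm \<mu> f = nrm lborel (wtd f)" if f: "adm f" for f
  proof -
    have fm: "f \<in> borel_measurable borel" and fL: "wtd f \<in> L2 lborel" using f by (auto simp: adm_def)
    have fm': "f \<in> borel_measurable \<mu>" using fm by (simp add: measurable_cong_sets[OF sets refl])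
    show L: "f \<in> L2 \<mu>" by (rule L2_I_nn[OF fm']) (simp add: nn[OF fm] nn_integral_sq_L2[OF fL])
    have "ennreal ((nrm \<mu> f)\<^sup>2) = ennreal ((nrm lborel (wtd f))\<^sup>2)"
      unfolding nn_integral_sq_L2[OF L, symmetric] nn_integral_sq_L2[OF fL, symmetric] by (rule nn[OF fm])
    then show "nrm \<mu> f = nrm lborel (wtd f)" by simp
  qed
  \<comment> \<open>The squared norm of an integral gains the factor \<open>\<gamma>\<^sup>2\<close>
    from \<open>W1\<close> and at most \<open>CS T\<close> from \<open>W2\<close>, relative to the
    squared norm of \<open>wtd\<close>. The summand 1 makes the divisor visibly positive.\<close>
  define c where "c = sqrt (\<gamma>\<^sup>2 + CS T) + 1"
  have c: "0 < c" using CS_nonneg[of T] by (simp add: c_def add_nonneg_pos)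
  obtain V where V: "V \<in> process_span upto_ind {0..T}" "nrm \<mu> (\<lambda>x. h x - V x) < e / c"
    using L2_closureD[OF upto_ind_dense[OF fin sets _ conc L2\<mu>(1)[OF h]], of "e / c"] T e c by auto
  then obtain xs where xs: "snd ` set xs \<subseteq> {0..T}" and Vx: "V = (\<lambda>t. lincomb (\<lambda>b. upto_ind b t) xs)"
    unfolding process_span_def by blast
  have Va: "adm V" unfolding Vx by (rule adm_lincomb[OF xs])
  define Z where "Z = (\<lambda>\<omega>. lincomb (\<lambda>b. Xt b \<omega>) xs)"
  have Z: "rep V Z" unfolding Vx Z_def by (rule rep_lincomb[OF xs])
  have ZL: "Z \<in> L2 M" by (rule L_L2[OF rep_in_L[OF Z]])
  define f where "f = (\<lambda>s. 1 * h s + (-1) * V s)"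
  have fa: "adm f" unfolding f_def by (rule adm_lin[OF h Va])
  have VL: "wtd V \<in> L2 lborel" using Va by (simp add: adm_def)
  have "(nrm M (\<lambda>\<omega>. Y \<omega> - Z \<omega>))\<^sup>2 = (\<integral>\<omega>. (1 * Y \<omega> + (-1) * Z \<omega>)\<^sup>2 \<partial>M)" by (simp add: nrm_sq)
  also have "\<dots> = (\<integral>\<omega>. Y \<omega> * Y \<omega> \<partial>M) - 2 * (\<integral>\<omega>. Y \<omega> * Z \<omega> \<partial>M) + (\<integral>\<omega>. Z \<omega> * Z \<omega> \<partial>M)"
    by (subst integral_sq_lin[OF YL ZL]) (simp add: power2_eq_square)
  also have "\<dots> = \<gamma>\<^sup>2 * ((\<integral>s. (wtd h s)\<^sup>2 \<partial>lborel) - 2 * (\<integral>s. wtd h s * wtd V s \<partial>lborel) + (\<integral>s. (wtd V s)\<^sup>2 \<partial>lborel))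
      + ((\<integral>s. (Q h s)\<^sup>2 \<partial>lborel) - 2 * (\<integral>s. Q h s * Q V s \<partial>lborel) + (\<integral>s. (Q V s)\<^sup>2 \<partial>lborel))"
    unfolding rep_rep_inner[OF Y Y] rep_rep_inner[OF Y Z] rep_rep_inner[OF Z Z]
    by (simp add: power2_eq_square algebra_simps)
  also have "(\<integral>s. (wtd h s)\<^sup>2 \<partial>lborel) - 2 * (\<integral>s. wtd h s * wtd V s \<partial>lborel) + (\<integral>s. (wtd V s)\<^sup>2 \<partial>lborel) = (nrm lborel (wtd f))\<^sup>2"
  proof -
    have "wtd f = (\<lambda>s. 1 * wtd h s + (-1) * wtd V s)" by (auto simp: f_def wtd_def algebra_simps)
    then have "(nrm lborel (wtd f))\<^sup>2 = (\<integral>s. (1 * wtd h s + (-1) * wtd V s)\<^sup>2 \<partial>lborel)" by (simp only: nrm_sq)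
    then show ?thesis unfolding integral_sq_lin[OF hL VL] by simp
  qed
  also have "(\<integral>s. (Q h s)\<^sup>2 \<partial>lborel) - 2 * (\<integral>s. Q h s * Q V s \<partial>lborel) + (\<integral>s. (Q V s)\<^sup>2 \<partial>lborel) = (nrm lborel (Q f))\<^sup>2"
  proof -
    note QL = Q_L2(1)[OF h] Q_L2(1)[OF Va] Q_L2(1)[OF fa]
    have "nrm lborel (Q f) = nrm lborel (\<lambda>s. 1 * Q h s + (-1) * Q V s)"
      by (rule nrm_cong_AE) (use Q_diff[OF h Va] QL[THEN L2_meas] in \<open>auto simp: f_def\<close>)
    then have "(nrm lborel (Q f))\<^sup>2 = (\<integral>s. (1 * Q h s + (-1) * Q V s)\<^sup>2 \<partial>lborel)" by (simp only: nrm_sq)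
    then show ?thesis unfolding integral_sq_lin[OF QL(1,2)] by simp
  qed
  also have "\<gamma>\<^sup>2 * (nrm lborel (wtd f))\<^sup>2 + (nrm lborel (Q f))\<^sup>2 \<le> (\<gamma>\<^sup>2 + CS T) * (nrm lborel (wtd f))\<^sup>2"
    using Q_L2(2)[OF fa] by (simp add: algebra_simps)
  also have "\<dots> = (sqrt (\<gamma>\<^sup>2 + CS T) * nrm \<mu> f)\<^sup>2"
    using CS_nonneg[of T] by (simp add: power_mult_distrib L2\<mu>(2)[OF fa])
  finally have "nrm M (\<lambda>\<omega>. Y \<omega> - Z \<omega>) \<le> sqrt (\<gamma>\<^sup>2 + CS T) * nrm \<mu> f"
    by (rule power2_le_imp_le) (use CS_nonneg[of T] in simp)
  also have "\<dots> \<le> c * nrm \<mu> f" by (rule mult_right_mono) (simp_all add: c_def)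
  also have "\<dots> < e" using V(2) c by (simp add: f_def field_simps)
  finally have lt: "nrm M (\<lambda>\<omega>. Y \<omega> - Z \<omega>) < e" .
  have "Z \<in> sp T" unfolding Z_def by (rule process_spanI[OF xs])
  then show "\<exists>g\<in>sp T. nrm M (\<lambda>x. Y x - g x) < e"
    by (rule bexI[rotated]) (rule lt)
qed

end

section \<open>The likelihood function\<close>

context filtering_model
begin

text \<open>Fubini for the triple integral over v, u and t, in which integrating out v first
  produces \<open>kk\<close>. The left side is the \<open>W2\<close> part of the covariance of the
  integral of h with \<open>Xt r\<close>, the right side the integral term of E_T integrated over
  (0, r].\<close>

lemma integral_Q_mult:
  assumes h: "adm h" and r: "0 \<le> r" "r \<le> T"
  shows "(\<integral>v. Q h v * Q (upto_ind r) v \<partial>lborel)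
    = (\<integral>u. upto_ind r u * (\<integral>t. upto_ind T t * (h t * kk H1 H2 t u) \<partial>lborel) \<partial>lborel)"
proof -
  have hm [measurable]: "h \<in> borel_measurable borel" using h by (simp add: adm_def)
  \<comment> \<open>The pair w = (u, t) is kept together, so that a single exchange of v against w
    suffices.\<close>
  define F :: "real \<Rightarrow> real \<times> real \<Rightarrow> real" where
    "F = (\<lambda>v w. (upto_ind r (fst w) * D (fst w) v) * (upto_ind T (snd w) * (h (snd w) * D (snd w) v)))"
  have F [measurable]: "(\<lambda>x. F (fst x) (snd x)) \<in> borel_measurable (borel \<Otimes>\<^sub>M (borel \<Otimes>\<^sub>M borel))"
    unfolding F_def by measurable
  have Fm: "(\<lambda>(v, w). F v w) \<in> borel_measurable (lborel \<Otimes>\<^sub>M lborel)"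
    using F[unfolded borel_prod[where ?'a = real and ?'b = real]]
    by (subst measurable_cong_sets[OF sets_pair_measure_cong[OF sets_lborel sets_lborel] refl]) (simp add: split_beta')
  define A where "A = (\<lambda>v. \<integral>\<^sup>+u. ennreal (upto_ind T u * (\<bar>upto_ind r u\<bar> * D u v)) \<partial>lborel)"
  define B where "B = (\<lambda>v. \<integral>\<^sup>+t. ennreal (upto_ind T t * (\<bar>h t\<bar> * D t v)) \<partial>lborel)"
  have [measurable]: "A \<in> borel_measurable borel" "B \<in> borel_measurable borel"
    unfolding A_def B_def by measurable
  have inner: "(\<integral>\<^sup>+w. ennreal (norm (F v w)) \<partial>lborel) = A v * B v" for v
  proof -
    have e: "ennreal (norm (F v w)) = ennreal (upto_ind T (fst w) * (\<bar>upto_ind r (fst w)\<bar> * D (fst w) v))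
        * ennreal (upto_ind T (snd w) * (\<bar>h (snd w)\<bar> * D (snd w) v))" for w
      using r D_nonneg by (auto simp: F_def indicator_def abs_mult simp flip: ennreal_mult)
    have "(\<integral>\<^sup>+w. ennreal (norm (F v w)) \<partial>lborel)
        = (\<integral>\<^sup>+w. ennreal (upto_ind T (fst w) * (\<bar>upto_ind r (fst w)\<bar> * D (fst w) v))
        * ennreal (upto_ind T (snd w) * (\<bar>h (snd w)\<bar> * D (snd w) v)) \<partial>(lborel \<Otimes>\<^sub>M lborel))"
      unfolding e lborel_prod ..
    also have "\<dots> = (\<integral>\<^sup>+u. \<integral>\<^sup>+t. ennreal (upto_ind T u * (\<bar>upto_ind r u\<bar> * D u v))
        * ennreal (upto_ind T t * (\<bar>h t\<bar> * D t v)) \<partial>lborel \<partial>lborel)"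
      by (subst lborel.nn_integral_fst[symmetric]) auto
    also have "\<dots> = (\<integral>\<^sup>+u. ennreal (upto_ind T u * (\<bar>upto_ind r u\<bar> * D u v)) * B v \<partial>lborel)"
      unfolding B_def by (rule nn_integral_cong) (rule nn_integral_cmult, measurable)
    also have "\<dots> = A v * B v" unfolding A_def by (rule nn_integral_multc) measurable
    finally show ?thesis .
  qed
  \<comment> \<open>Absolute integrability: Cauchy-Schwarz in v, each factor being controlled by
    \<open>Q_abs_bound\<close>.\<close>
  have fin: "(\<integral>\<^sup>+v. A v * B v \<partial>lborel) < \<infinity>"
  proof -
    have "(\<integral>\<^sup>+v. A v * B v \<partial>lborel)\<^sup>2 \<le> (\<integral>\<^sup>+v. (A v)\<^sup>2 \<partial>lborel) * (\<integral>\<^sup>+v. (B v)\<^sup>2 \<partial>lborel)"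
      by (rule Cauchy_Schwarz_nn_integral) measurable
    also have "\<dots> < \<infinity>"
      using le_less_trans[OF Q_abs_bound[OF adm_upto[OF r]] ennreal_less_top] le_less_trans[OF Q_abs_bound[OF h] ennreal_less_top]
      unfolding A_def B_def by (simp add: ennreal_mult_less_top)
    finally have "(\<integral>\<^sup>+v. A v * B v \<partial>lborel)\<^sup>2 \<noteq> \<infinity>" by simp
    moreover have "x < \<infinity>" if "x\<^sup>2 \<noteq> \<infinity>" for x :: ennreal
      using that by (cases x) (auto simp: power2_eq_square)
    ultimately show ?thesis by blast
  qed
  have I: "integrable (lborel \<Otimes>\<^sub>M lborel) (\<lambda>(v, w). F v w)"
  proof (rule integrableI_bounded[OF Fm])
    have "(\<integral>\<^sup>+x. ennreal (norm (case x of (v, w) \<Rightarrow> F v w)) \<partial>(lborel \<Otimes>\<^sub>M lborel))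
        = (\<integral>\<^sup>+v. \<integral>\<^sup>+w. ennreal (norm (F v w)) \<partial>lborel \<partial>lborel)"
      using Fm by (subst lborel.nn_integral_fst[symmetric]) auto
    then show "(\<integral>\<^sup>+x. ennreal (norm (case x of (v, w) \<Rightarrow> F v w)) \<partial>(lborel \<Otimes>\<^sub>M lborel)) < \<infinity>"
      using fin by (simp only: inner)
  qed
  have "(\<integral>v. Q h v * Q (upto_ind r) v \<partial>lborel) = (\<integral>v. (\<integral>w. F v w \<partial>lborel) \<partial>lborel)"
  proof (rule integral_cong_AE)
    show "(\<lambda>v. Q h v * Q (upto_ind r) v) \<in> borel_measurable lborel" by measurable
    show "(\<lambda>v. \<integral>w. F v w \<partial>lborel) \<in> borel_measurable lborel"
      using lborel.borel_measurable_lebesgue_integral[OF Fm] .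
    have "AE v in lborel. integrable lborel (\<lambda>w. F v w)"
      using lborel_pair.AE_integrable_fst[OF I] .
    then show "AE v in lborel. Q h v * Q (upto_ind r) v = (\<integral>w. F v w \<partial>lborel)"
    proof eventually_elim
      case (elim v)
      then have i: "integrable (lborel \<Otimes>\<^sub>M lborel) (F v)" by (simp add: lborel_prod)
      have "(\<integral>w. F v w \<partial>lborel) = integral\<^sup>L (lborel \<Otimes>\<^sub>M lborel) (F v)" by (simp add: lborel_prod)
      also have "\<dots> = (\<integral>u. \<integral>t. F v (u, t) \<partial>lborel \<partial>lborel)"
        by (rule lborel_pair.integral_fst'[OF i, symmetric])
      also have "\<dots> = (\<integral>u. (upto_ind r u * D u v) * Q h v \<partial>lborel)"
        by (simp add: F_def Q_def)
      also have "\<dots> = K12 H1 H2 r v * Q h v" by (simp add: integral_D_upto[OF r(1)])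
      finally show ?case by (simp add: Q_upto[OF r])
    qed
  qed
  also have "\<dots> = (\<integral>w. (\<integral>v. F v w \<partial>lborel) \<partial>lborel)"
    by (rule lborel_pair.Fubini_integral[OF I, symmetric])
  also have "\<dots> = integral\<^sup>L (lborel \<Otimes>\<^sub>M lborel) (\<lambda>w. \<integral>v. F v w \<partial>lborel)" by (simp add: lborel_prod)
  also have "\<dots> = (\<integral>u. \<integral>t. (\<integral>v. F v (u, t) \<partial>lborel) \<partial>lborel \<partial>lborel)"
    by (rule lborel_pair.integral_fst'[symmetric])
      (use lborel_pair.integrable_snd[OF I] in \<open>simp add: lborel_prod\<close>)
  also have "\<dots> = (\<integral>u. upto_ind r u * (\<integral>t. upto_ind T t * (h t * kk H1 H2 t u) \<partial>lborel) \<partial>lborel)"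
  proof -
    have "(\<integral>v. F v (u, t) \<partial>lborel) = upto_ind r u * (upto_ind T t * (h t * kk H1 H2 t u))" for u t
    proof -
      have "(\<integral>v. F v (u, t) \<partial>lborel) = (\<integral>v. (upto_ind r u * (upto_ind T t * h t)) * (D t v * D u v) \<partial>lborel)"
        by (simp add: F_def ac_simps)
      then show ?thesis by (simp add: kk_eq)
    qed
    then show ?thesis by simp
  qed
  finally show ?thesis .
qed

text \<open>\<open>solves_ET\<close> gives measurability of the solution only on the closed interval
  from 0 to T; truncation makes it measurable on the whole line.\<close>

definition restr :: "(real \<Rightarrow> real) \<Rightarrow> real \<Rightarrow> real" where
  "restr h = (\<lambda>t. indicator {0..T} t * h t)"

context
  fixes hT assumes sol: "solves_ET H1 H2 T hT"
begin

lemma adm_sol: "adm (restr hT)"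
proof -
  have m [measurable]: "restr hT \<in> borel_measurable borel"
    using sol by (simp add: solves_ET_def set_borel_measurable_def restr_def)
  have "integrable lborel (\<lambda>t. indicator {0..T} t *\<^sub>R (hT t * t powr (1/2 - H1))\<^sup>2)"
    using sol by (simp add: solves_ET_def set_integrable_def)
  moreover have "(\<lambda>t. indicator {0..T} t *\<^sub>R (hT t * t powr (1/2 - H1))\<^sup>2) = (\<lambda>t. (wtd (restr hT) t)\<^sup>2)"
  proof
    fix t show "indicator {0..T} t *\<^sub>R (hT t * t powr (1/2 - H1))\<^sup>2 = (wtd (restr hT) t)\<^sup>2"
      by (cases "t = 0") (auto simp: wtd_def restr_def al_def indicator_def)
  qed
  ultimately have "integrable lborel (\<lambda>t. (wtd (restr hT) t)\<^sup>2)" by simp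
  moreover have "wtd (restr hT) \<in> borel_measurable borel" unfolding wtd_def by measurable
  ultimately show ?thesis by (simp add: adm_def L2_def)
qed

lemma rep_int_dX: "rep (restr hT) (int_dX M W1 W2 H1 H2 T hT)"
proof -
  note [measurable] = adm_sol[unfolded adm_def, THEN conjunct1]
  have 1: "rep1 (restr hT) (\<lambda>\<omega>. \<gamma> * wiener_int M W1 0 T (\<lambda>t. hT t * t powr (1/2 - H1)) \<omega>)"
    by (rule rep1_if_wiener_int[OF adm_sol]) (simp add: restr_def al_def)
  have e: "(\<lambda>s. indicator {0..T} s * Q (restr hT) s) = Q (restr hT)"
  proof
    fix s
    have "Q (restr hT) s = 0" if "s \<notin> {0..T}"
    proof -
      have z: "upto_ind T t * (restr hT t * D t s) = 0" for t
        using that by (auto simp: D_def indicator_def)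
      show ?thesis unfolding Q_def z by simp
    qed
    then show "indicator {0..T} s * Q (restr hT) s = Q (restr hT) s" by (cases "s \<in> {0..T}") auto
  qed
  have "wiener_pair M W2 (\<lambda>s. indicator {0..T} s * Q (restr hT) s) (wiener_int M W2 0 T (Q (restr hT)))"
    by (rule wiener_pair_wiener_int[OF W2]) (use T Q_L2(1)[OF adm_sol] in \<open>auto simp: e\<close>)
  then have 2: "wiener_pair M W2 (Q (restr hT)) (wiener_int M W2 0 T (Q (restr hT)))" by (simp add: e)
  have "wiener_int M W2 0 T (Q (restr hT)) = wiener_int M W2 0 T (\<lambda>s. LINT t:{s..T}|lborel. hT t * dK12 H1 H2 t s)"
  proof (rule wiener_int_cong)
    \<comment> \<open>\<open>wiener_int_cong\<close> asks for agreement at every s. For fixed s the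
      two inner integrands differ in t at most at the uncontrolled point t = s, and at s = 0 both
      kernels are 0.\<close>
    fix s assume s: "s \<in> {0..T}"
    have "(\<integral>t. indicator {s..T} t * (hT t * dK12 H1 H2 t s) \<partial>lborel) = (\<integral>t. upto_ind T t * (restr hT t * D t s) \<partial>lborel)"
    proof (rule integral_cong_except_point[where a = s])
      fix t assume ts: "t \<noteq> s"
      show "indicator {s..T} t * (hT t * dK12 H1 H2 t s) = upto_ind T t * (restr hT t * D t s)"
      proof (cases "s = 0")
        case True
        then show ?thesis by (simp add: dK12_nonpos D_def)
      next
        case False
        then have "dK12 H1 H2 t s = D t s" using dK12_eq[of s t] ts s by auto
        then show ?thesis using s ts by (auto simp: indicator_def restr_def D_def)
      qed
    qed measurable
    then show "Q (restr hT) s = (LINT t:{s..T}|lborel. hT t * dK12 H1 H2 t s)"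
      by (simp add: Q_def set_lebesgue_integral_def)
  qed
  with 1 2 show ?thesis unfolding rep_def int_dX_def by auto
qed

lemma int_dX_orth:
  assumes r: "r \<in> {0..T}"
  shows "(\<integral>\<omega>. (X1t T \<omega> - int_dX M W1 W2 H1 H2 T hT \<omega>) * Xt r \<omega> \<partial>M) = 0"
proof -
  have r': "0 \<le> r" "r \<le> T" using r by auto
  let ?h = "restr hT" and ?I = "int_dX M W1 W2 H1 H2 T hT"
  have hL: "wtd ?h \<in> L2 lborel" using adm_sol by (simp add: adm_def)
  have uL: "wtd (upto_ind T) \<in> L2 lborel" "wtd (upto_ind r) \<in> L2 lborel"
    using adm_upto[of T] adm_upto[OF r'] T by (auto simp: adm_def)
  \<comment> \<open>Equation E_T at u, localised to (0, r] and expressed through weighted functions.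
    Integrated in u, it relates the \<open>W2\<close> part of the covariance to the
    \<open>W1\<close> parts.\<close>
  have pt: "upto_ind r u * (\<integral>t. upto_ind T t * (?h t * kk H1 H2 t u) \<partial>lborel)
      = \<gamma>\<^sup>2 * (wtd (upto_ind T) u * wtd (upto_ind r) u - wtd ?h u * wtd (upto_ind r) u)" for u
  proof (cases "u \<in> {0<..r}")
    case False
    then have "upto_ind r u = 0" by simp
    then show ?thesis by (simp add: wtd_def)
  next
    case True
    then have u: "u \<in> {0<..T}" using r' by auto
    have "(LINT s:{0..T}|lborel. hT s * kk H1 H2 s u) = (\<integral>t. upto_ind T t * (?h t * kk H1 H2 t u) \<partial>lborel)"
      unfolding set_lebesgue_integral_def
    proof (rule Bochner_Integration.integral_cong)
      fix t
      \<comment> \<open>The equation integrates over the closed interval, whereas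
        \<open>upto_ind\<close> omits 0; the integrand vanishes there.\<close>
      have "D 0 v = 0" for v by (auto simp: D_def)
      then have "kk H1 H2 0 u = 0" by (simp add: kk_eq)
      then show "indicat_real {0..T} t *\<^sub>R (hT t * kk H1 H2 t u) = upto_ind T t * (?h t * kk H1 H2 t u)"
        by (cases "t = 0") (auto simp: restr_def indicator_def)
    qed simp
    moreover have "\<gamma>\<^sup>2 * u powr (1 - 2 * H1) = \<gamma>\<^sup>2 * hT u * u powr (1 - 2 * H1) + (LINT s:{0..T}|lborel. hT s * kk H1 H2 s u)"
      using sol u unfolding solves_ET_def by blast
    ultimately have "(\<integral>t. upto_ind T t * (?h t * kk H1 H2 t u) \<partial>lborel)
        = \<gamma>\<^sup>2 * ((u powr al)\<^sup>2 - hT u * (u powr al)\<^sup>2)"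
      unfolding powr_al_sq by (simp add: algebra_simps)
    moreover have "wtd (upto_ind T) u = u powr al" "wtd (upto_ind r) u = u powr al" "wtd ?h u = hT u * u powr al"
      using u True by (auto simp: wtd_def restr_def)
    ultimately show ?thesis using True by (simp add: power2_eq_square)
  qed
  have i: "integrable lborel (\<lambda>u. wtd (upto_ind T) u * wtd (upto_ind r) u)" "integrable lborel (\<lambda>u. wtd ?h u * wtd (upto_ind r) u)"
    using hL uL by (auto intro!: L2_mult_integrable)
  have Qeq: "(\<integral>v. Q ?h v * Q (upto_ind r) v \<partial>lborel)
      = \<gamma>\<^sup>2 * ((\<integral>u. wtd (upto_ind T) u * wtd (upto_ind r) u \<partial>lborel) - (\<integral>u. wtd ?h u * wtd (upto_ind r) u \<partial>lborel))"
    unfolding integral_Q_mult[OF adm_sol r'] pt using i by simp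
  have "(\<integral>\<omega>. (X1t T \<omega> - ?I \<omega>) * Xt r \<omega> \<partial>M) = (\<integral>\<omega>. X1t T \<omega> * Xt r \<omega> - ?I \<omega> * Xt r \<omega> \<partial>M)"
    by (simp add: left_diff_distrib)
  also have "\<dots> = (\<integral>\<omega>. X1t T \<omega> * Xt r \<omega> \<partial>M) - (\<integral>\<omega>. ?I \<omega> * Xt r \<omega> \<partial>M)"
    by (rule Bochner_Integration.integral_diff; rule L2_mult_integrable)
      (use L_L2 X1_in_L[of T] rep_in_L[OF rep_int_dX] rep_in_L[OF rep_X[OF r']] T in auto)
  also have "\<dots> = 0"
    using rep1_rep_inner[OF rep1_X1[of T] rep_X[OF r']] rep_rep_inner[OF rep_int_dX rep_X[OF r']] T Qeq
    by (simp add: algebra_simps)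
  finally show ?thesis .
qed

lemma N_T: "AE \<omega> in M. N T \<omega> = int_dX M W1 W2 H1 H2 T hT \<omega>"
  by (rule N_unique[OF _ rep_in_closure[OF adm_sol rep_int_dX] int_dX_orth]) (use T in auto)

text \<open>By \<open>N_sq_eq\<close> the variance is the inner product of the integral with the
  signal. Only \<open>W1\<close> contributes, and the two weights multiply to
  \<open>t powr (1 - 2 * H1)\<close>.\<close>

lemma N_T_sq: "(\<integral>\<omega>. (N T \<omega>)\<^sup>2 \<partial>M) = \<gamma>\<^sup>2 * (LINT t:{0..T}|lborel. hT t * t powr (1 - 2 * H1))"
proof -
  have T': "T \<in> {0..T}" "0 \<le> T" using T by auto
  let ?I = "int_dX M W1 W2 H1 H2 T hT"
  have IL: "?I \<in> L2 M" by (rule L_L2[OF rep_in_L[OF rep_int_dX]])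
  have "(\<integral>\<omega>. (N T \<omega>)\<^sup>2 \<partial>M) = (\<integral>\<omega>. N T \<omega> * X1t T \<omega> \<partial>M)" by (rule N_sq_eq[OF T'(1)])
  also have "\<dots> = (\<integral>\<omega>. X1t T \<omega> * ?I \<omega> \<partial>M)"
    by (rule integral_cong_AE)
      (use N_T N_meas(1)[of T] L2_meas[OF IL] L2_meas[OF L_L2[OF X1_in_L[of T]]] T' in auto)
  also have "\<dots> = \<gamma>\<^sup>2 * (\<integral>s. wtd (upto_ind T) s * wtd (restr hT) s \<partial>lborel)"
    by (rule rep1_rep_inner[OF rep1_X1 rep_int_dX]) (use T in auto)
  also have "(\<integral>s. wtd (upto_ind T) s * wtd (restr hT) s \<partial>lborel) = (LINT t:{0..T}|lborel. hT t * t powr (1 - 2 * H1))"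
    unfolding set_lebesgue_integral_def
  proof (rule Bochner_Integration.integral_cong)
    fix t
    show "wtd (upto_ind T) t * wtd (restr hT) t = indicat_real {0..T} t *\<^sub>R (hT t * t powr (1 - 2 * H1))"
      unfolding powr_al_sq[symmetric]
      by (cases "t = 0") (auto simp: wtd_def restr_def indicator_def power2_eq_square)
  qed simp
  finally show ?thesis .
qed

end

text \<open>The variance that enters the normalisation of \<open>dens\<close>; it cancels in
  \<open>likelihood\<close>.\<close>

lemma X1_T_sq: "(\<integral>\<omega>. (X1t T \<omega>)\<^sup>2 \<partial>M) = \<gamma>\<^sup>2 * T powr (2 - 2 * H1) / (2 - 2 * H1)"
proof -
  have "rep1 (upto_ind T) (X1t T)" by (rule rep1_X1) (use T in auto)
  then have "nrm M (X1t T) = nrm lborel (\<lambda>s. \<gamma> * wtd (upto_ind T) s)"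
    unfolding rep1_def by (rule wiener_pair_nrm[OF W1])
  then have "(nrm M (X1t T))\<^sup>2 = (\<gamma> * nrm lborel (wtd (upto_ind T)))\<^sup>2"
    using gammaH_pos by (simp add: nrm_scale)
  then have "(\<integral>\<omega>. (X1t T \<omega>)\<^sup>2 \<partial>M) = \<gamma>\<^sup>2 * (\<integral>s. (upto_ind T s * s powr al)\<^sup>2 \<partial>lborel)"
    by (simp only: power_mult_distrib nrm_sq wtd_upto[OF order_refl])
  then show ?thesis using T by (simp add: integral_powr_al)
qed

text \<open>The observation contains the signal, so the covariance equals the variance of the
  signal. By \<open>N_sq_pos\<close> this keeps the bracket away from 0.\<close>

lemma X1_X_T_pos: "0 < (\<integral>\<omega>. X1t T \<omega> * Xt T \<omega> \<partial>M)"
proof -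
  have "(\<integral>\<omega>. X1t T \<omega> * Xt T \<omega> \<partial>M) = \<gamma>\<^sup>2 * (\<integral>s. wtd (upto_ind T) s * wtd (upto_ind T) s \<partial>lborel)"
    by (rule rep1_rep_inner[OF rep1_X1 rep_X]) (use T in auto)
  also have "\<dots> = \<gamma>\<^sup>2 * (\<integral>s. (upto_ind T s * s powr al)\<^sup>2 \<partial>lborel)"
    by (simp add: wtd_upto power2_eq_square)
  also have "\<dots> = \<gamma>\<^sup>2 * (T powr (2 - 2 * H1) / (2 - 2 * H1))" using T by (simp add: integral_powr_al)
  also have "0 < \<dots>" using gammaH_pos T H by simp
  finally show ?thesis .
qed

text \<open>With a = \<theta> \<kappa> the conditional exponential moment carries a^2 / 2 times the
  residual variance \<open>v - V\<close>, and the normalisation of the density removes the part with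
  \<open>v\<close>, leaving the bracket.\<close>

lemma likelihood:
  "AE \<omega> in M. real_cond_exp M (F T) (dens M W1 H1 T \<theta>) \<omega>
    = exp (\<theta> * kappaH H1 * N T \<omega> - 1/2 * \<theta>\<^sup>2 * (kappaH H1)\<^sup>2 * (\<integral>\<omega>. (N T \<omega>)\<^sup>2 \<partial>M))"
proof -
  have T': "T \<in> {0..T}" using T by auto
  interpret FT: finite_measure_subalgebra M "F T" by (rule fms) simp
  define a where "a = \<theta> * kappaH H1"
  define v where "v = \<gamma>\<^sup>2 * T powr (2 - 2 * H1) / (2 - 2 * H1)"
  define V where "V = (\<integral>\<omega>. (N T \<omega>)\<^sup>2 \<partial>M)"
  have d: "dens M W1 H1 T \<theta> = (\<lambda>\<omega>. exp (- (a\<^sup>2 / 2 * v)) * exp (a * X1t T \<omega>))"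
  proof
    fix \<omega>
    have "\<theta> * kappaH H1 * X1t T \<omega> - 1/2 * \<theta>\<^sup>2 * (kappaH H1)\<^sup>2 * v = - (a\<^sup>2 / 2 * v) + a * X1t T \<omega>"
      by (simp add: a_def power_mult_distrib)
    then show "dens M W1 H1 T \<theta> \<omega> = exp (- (a\<^sup>2 / 2 * v)) * exp (a * X1t T \<omega>)"
      unfolding dens_def v_def[symmetric] by (simp only: exp_add)
  qed
  have i: "integrable M (\<lambda>\<omega>. exp (a * X1t T \<omega>))"
    by (rule gaussian_space_mgf[OF L_gaussian X1_in_L]) (use T in auto)
  have "AE \<omega> in M. real_cond_exp M (F T) (dens M W1 H1 T \<theta>) \<omega>
      = exp (- (a\<^sup>2 / 2 * v)) * real_cond_exp M (F T) (\<lambda>\<omega>. exp (a * X1t T \<omega>)) \<omega>"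
    unfolding d by (rule FT.real_cond_exp_cmult[OF i])
  moreover have "AE \<omega> in M. real_cond_exp M (F T) (\<lambda>\<omega>. exp (a * X1t T \<omega>)) \<omega> = exp (a * N T \<omega> + a\<^sup>2 / 2 * (v - V))"
    using cond_exp_exp[OF T', of a] by (simp only: X1_T_sq v_def V_def)
  ultimately show ?thesis
  proof eventually_elim
    case (elim \<omega>)
    have "\<theta> * kappaH H1 * N T \<omega> - 1/2 * \<theta>\<^sup>2 * (kappaH H1)\<^sup>2 * V = - (a\<^sup>2 / 2 * v) + (a * N T \<omega> + a\<^sup>2 / 2 * (v - V))"
      by (simp add: a_def power_mult_distrib field_simps)
    then show ?case unfolding elim V_def[symmetric] by (simp only: exp_add)
  qed
qed

end

text \<open>Completing the square: the gap is \<kappa>^2 V / 2 times the squared distance of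
  \<theta> from the maximiser.\<close>

lemma quadratic_exponent_strict_max:
  fixes \<kappa> V x \<theta> :: real
  assumes "0 < \<kappa>" "0 < V" "\<theta> \<noteq> x / (\<kappa> * V)"
  shows "\<theta> * \<kappa> * x - 1/2 * \<theta>\<^sup>2 * \<kappa>\<^sup>2 * V < (x / (\<kappa> * V)) * \<kappa> * x - 1/2 * (x / (\<kappa> * V))\<^sup>2 * \<kappa>\<^sup>2 * V"
proof -
  define y where "y = x / (\<kappa> * V)"
  have x: "x = y * (\<kappa> * V)" using assms by (simp add: y_def)
  have "0 < 1/2 * (\<kappa>\<^sup>2 * V) * (\<theta> - y)\<^sup>2" using assms by (simp add: y_def)
  then show ?thesis     using assms(1,2) unfolding y_def[symmetric] x by (simp add: power2_eq_square algebra_simps)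
qed

theorem theorem2p4:
  fixes M :: "'a measure" and W1 W2 :: "real \<Rightarrow> 'a \<Rightarrow> real"
    and H1 H2 T :: real and hT :: "real \<Rightarrow> real"
  assumes H: "1/2 < H1" "H1 < H2" "H2 < 1" "H2 - H1 > 1/4"
    and T: "T > 0"
    and P: "prob_space M"
    and W: "wiener_process M W1" "wiener_process M W2" "indep_processes M W1 W2"
    and sol: "solves_ET H1 H2 T hT"
    and uniq: "\<And>h. solves_ET H1 H2 T h \<Longrightarrow> \<forall>u\<in>{0<..T}. h u = hT u"
  defines "F \<equiv> FX M W1 W2 H1 H2"
    and "N \<equiv> Nproc M W1 W2 H1 H2"
    and "V \<equiv> (gammaH H1)\<^sup>2 * (LINT t:{0..T}|lborel. hT t * t powr (1 - 2 * H1))"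
    and "\<kappa> \<equiv> kappaH H1"
  shows
    \<comment> \<open>(i) square integrable Gaussian martingale, N(T) = int hT dX, and its bracket\<close>
    "sq_int_martingale_on M F N T \<and> gaussian_process_on M N {0..T}
     \<and> (AE \<omega> in M. N T \<omega> = int_dX M W1 W2 H1 H2 T hT \<omega>)
     \<and> mono_on {0..T} (\<lambda>t. integral\<^sup>L M (\<lambda>\<omega>. (N t \<omega>)\<^sup>2))
     \<and> martingale_on M F (\<lambda>t \<omega>. (N t \<omega>)\<^sup>2 - integral\<^sup>L M (\<lambda>\<omega>'. (N t \<omega>')\<^sup>2)) T
     \<and> integral\<^sup>L M (\<lambda>\<omega>. (N T \<omega>)\<^sup>2) = V
     \<comment> \<open>(ii) the likelihood function\<close>
     \<and> (\<forall>\<theta>. AE \<omega> in M. real_cond_exp M (F T) (dens M W1 H1 T \<theta>) \<omega>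
                         = exp (\<theta> * \<kappa> * N T \<omega> - 1/2 * \<theta>\<^sup>2 * \<kappa>\<^sup>2 * V))
     \<comment> \<open>(iii) the maximum likelihood estimator\<close>
     \<and> (AE \<omega> in M. \<forall>\<theta>. \<theta> \<noteq> N T \<omega> / (\<kappa> * V) \<longrightarrow>
           exp (\<theta> * \<kappa> * N T \<omega> - 1/2 * \<theta>\<^sup>2 * \<kappa>\<^sup>2 * V)
         < exp ((N T \<omega> / (\<kappa> * V)) * \<kappa> * N T \<omega> - 1/2 * (N T \<omega> / (\<kappa> * V))\<^sup>2 * \<kappa>\<^sup>2 * V))"
proof -
  interpret prob_space M by (rule P)
  interpret m: filtering_model H1 H2 M W1 W2 T
    by unfold_locales (use H T W in auto)
  have F: "F = m.F" by (rule ext) (simp add: F_def FX_def)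
  have N: "N = m.N" by (rule ext) (simp add: N_def Nproc_def m.N_def FX_def)
  have V: "V = (\<integral>\<omega>. (m.N T \<omega>)\<^sup>2 \<partial>M)" unfolding V_def by (rule m.N_T_sq[OF sol, symmetric])
  \<comment> \<open>Positivity of the bracket makes the estimator a genuine quotient and the maximum
    strict.\<close>
  have Vpos: "0 < V" unfolding V
    by (rule m.N_sq_pos) (use T m.X1_X_T_pos in auto)
  have kpos: "0 < \<kappa>" unfolding \<kappa>_def by (rule m.kappaH_pos)
  show ?thesis
    unfolding F N
  proof (intro conjI allI)
    show "sq_int_martingale_on M m.F m.N T" by (rule m.N_martingale)
    show "gaussian_process_on M m.N {0..T}" by (rule m.N_gaussian)
    show "AE \<omega> in M. m.N T \<omega> = int_dX M W1 W2 H1 H2 T hT \<omega>" by (rule m.N_T[OF sol])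
    show "mono_on {0..T} (\<lambda>t. integral\<^sup>L M (\<lambda>\<omega>. (m.N t \<omega>)\<^sup>2))" by (rule m.N_sq_mono)
    show "martingale_on M m.F (\<lambda>t \<omega>. (m.N t \<omega>)\<^sup>2 - integral\<^sup>L M (\<lambda>\<omega>'. (m.N t \<omega>')\<^sup>2)) T"
      by (rule m.N_sq_martingale)
    show "integral\<^sup>L M (\<lambda>\<omega>. (m.N T \<omega>)\<^sup>2) = V" by (rule V[symmetric])
    show "AE \<omega> in M. real_cond_exp M (m.F T) (dens M W1 H1 T \<theta>) \<omega>
        = exp (\<theta> * \<kappa> * m.N T \<omega> - 1/2 * \<theta>\<^sup>2 * \<kappa>\<^sup>2 * V)" for \<theta>
      unfolding V \<kappa>_def by (rule m.likelihood)
    show "AE \<omega> in M. \<forall>\<theta>. \<theta> \<noteq> m.N T \<omega> / (\<kappa> * V) \<longrightarrow>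
           exp (\<theta> * \<kappa> * m.N T \<omega> - 1/2 * \<theta>\<^sup>2 * \<kappa>\<^sup>2 * V)
         < exp ((m.N T \<omega> / (\<kappa> * V)) * \<kappa> * m.N T \<omega> - 1/2 * (m.N T \<omega> / (\<kappa> * V))\<^sup>2 * \<kappa>\<^sup>2 * V)"
      using quadratic_exponent_strict_max[OF kpos Vpos] by simp
  qed
qed

end
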